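(* Let $Q\subseteq\mathbb{R}^m$ be a closed set, let $g_1,\ldots,g_s\in\mathbb{R}[\mathrm{x},\mathrm{y}]$, and let $K=\{x\in\mathbb{R}^n : g_1(x,y)\ge 0,\ldots,g_s(x,y)\ge 0\ \ \forall y\in Q\}$. Let $\nu$ be a nonnegative Borel measure on $\mathbb{R}^m$ with $\operatorname{supp}(\nu)=Q$ satisfying the multivariate Carleman condition. Assume the quadratic module $\operatorname{QM}[g,\nu]$ is archimedean. Then a multisequence $z=(z_\alpha)_{\alpha\in\mathbb{N}^n}$ of real numbers is a $K$-moment sequence if and only if $\mathscr{R}_z(f)\ge 0$ for all $f\in\operatorname{QM}[g,\nu]$.
   Context: Here $\mathrm{x}=(\mathrm{x}_1,\ldots,\mathrm{x}_n)$ and $\mathrm{y}=(\mathrm{y}_1,\ldots,\mathrm{y}_m)$ are tuples of variables; $\mathbb{N}$ is the set of nonnegative integers. All measures are finite, and $\nu$ has finite moments of all orders. The measure $\nu$ satisfies the multivariate Carleman condition if $\sum_{d=1}^\infty\big(\int y_j^{2d}\,d\nu(y)\big)^{-\frac{1}{2d}}=\infty$ for $j=1,\ldots,m$ (a term with zero moment is read as $+\infty$). $\Sigma^2[\mathrm{x},\mathrm{y}]$ is the cone of sums of squares of polynomials in $\mathbb{R}[\mathrm{x},\mathrm{y}]$. With $g_0:=1$, the quadratic module associated to $g=(g_0,\ldots,g_s)$ and $\nu$ is $$\operatorname{QM}[g,\nu]:=\Big\{\sum_{j=0}^s\int \tau_j(\mathrm{x},y)g_j(\mathrm{x},y)\,d\nu(y)\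 :\ \tau_0,\ldots,\tau_s\in\Sigma^2[\mathrm{x},\mathrm{y}]\Big\}\subseteq\mathbb{R}[\mathrm{x}].$$ It is called archimedean if there is an integer $N>0$ with $N-\mathrm{x}_1^2-\cdots-\mathrm{x}_n^2\in\operatorname{QM}[g,\nu]$. The Riesz functional of $z$ is the linear functional $\mathscr{R}_z:\mathbb{R}[\mathrm{x}]\to\mathbb{R}$ with $\mathscr{R}_z(\mathrm{x}^\alpha)=z_\alpha$. The multisequence $z$ is a $K$-moment sequence if there is a nonnegative Borel measure $\mu$ on $\mathbb{R}^n$ with $\operatorname{supp}(\mu)\subseteq K$ and $z_\alpha=\int x^\alpha\,d\mu(x)$ for all $\alpha\in\mathbb{N}^n$. *)

theory Defs
  imports "HOL-Analysis.Analysis" "HOL-Library.Poly_Mapping"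
begin

text \<open>
  A polynomial over the reals in the finitely many variables \<open>'v\<close> is a finitely supported map from
  exponents \<open>'v \<Rightarrow>\<^sub>0 nat\<close> to coefficients; addition and (convolution) multiplication are those of
  \<^theory>\<open>HOL-Library.Poly_Mapping\<close>.  With \<open>n = CARD('n)\<close> and \<open>m = CARD('m)\<close>, the variables of
  \<open>\<real>[x,y]\<close> are indexed by the sum type \<open>'n + 'm\<close>.
\<close>

type_synonym 'v exponent = "'v \<Rightarrow>\<^sub>0 nat"
type_synonym 'v rpoly = "'v exponent \<Rightarrow>\<^sub>0 real"

definition pvar :: "'v \<Rightarrow> 'v rpoly" where
  "pvar i = Poly_Mapping.single (Poly_Mapping.single i 1) 1"

definition monom_eval :: "'v::finite exponent \<Rightarrow> ('v \<Rightarrow> real) \<Rightarrow> real" where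
  "monom_eval \<alpha> x = (\<Prod>i\<in>UNIV. x i ^ Poly_Mapping.lookup \<alpha> i)"

definition poly_eval :: "'v::finite rpoly \<Rightarrow> ('v \<Rightarrow> real) \<Rightarrow> real" where
  "poly_eval p x = (\<Sum>\<alpha>\<in>Poly_Mapping.keys p. Poly_Mapping.lookup p \<alpha> * monom_eval \<alpha> x)"

definition poly_eval2 :: "('n::finite + 'm::finite) rpoly \<Rightarrow> real^'n \<Rightarrow> real^'m \<Rightarrow> real" where
  "poly_eval2 p x y = poly_eval p (case_sum (($) x) (($) y))"

definition sums_of_squares :: "'v rpoly set" where
  "sums_of_squares = {p. \<exists>(k::nat) q. p = (\<Sum>i<k. (q i)\<^sup>2)}"

definition measure_support :: "'a::topological_space measure \<Rightarrow> 'a set" where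
  "measure_support M = {x. \<forall>U. open U \<longrightarrow> x \<in> U \<longrightarrow> emeasure M U > 0}"

definition finite_moments :: "(real^'m) measure \<Rightarrow> bool" where
  "finite_moments \<nu> \<longleftrightarrow> (\<forall>\<beta>. integrable \<nu> (\<lambda>y. monom_eval \<beta> (($) y)))"

definition carleman_term :: "(real^'m) measure \<Rightarrow> 'm::finite \<Rightarrow> nat \<Rightarrow> ennreal" where
  "carleman_term \<nu> j d =
     (if (\<integral>y. (y $ j) ^ (2 * d) \<partial>\<nu>) = 0 then \<infinity>
      else ennreal ((\<integral>y. (y $ j) ^ (2 * d) \<partial>\<nu>) powr (- 1 / real (2 * d))))"

text \<open>\<^const>\<open>suminf\<close> runs over \<open>d \<ge> 0\<close>, whereas the Carleman series starts at \<open>d = 1\<close>; hence the shift.\<close>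

definition carleman :: "(real^'m) measure \<Rightarrow> bool" where
  "carleman \<nu> \<longleftrightarrow> (\<forall>j. suminf (\<lambda>d. carleman_term \<nu> j (Suc d)) = \<infinity>)"

text \<open>
  Integration in \<open>y\<close>, taken coefficientwise, so that the result is a polynomial in \<open>x\<close>: the monomial
  \<open>c x\<^sup>\<alpha> y\<^sup>\<beta>\<close> is sent to \<open>(c \<integral> y\<^sup>\<beta> d\<nu>) x\<^sup>\<alpha>\<close>.  Here \<open>map_key Inl \<gamma>\<close> and \<open>map_key Inr \<gamma>\<close> are the
  \<open>x\<close>-part \<open>\<alpha>\<close> and the \<open>y\<close>-part \<open>\<beta>\<close> of an exponent \<open>\<gamma>\<close>.
\<close>

definition integral_y :: "(real^'m) measure \<Rightarrow> ('n + 'm::finite) rpoly \<Rightarrow> 'n rpoly" where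
  "integral_y \<nu> p =
     (\<Sum>\<gamma>\<in>Poly_Mapping.keys p.
        Poly_Mapping.single (Poly_Mapping.map_key Inl \<gamma>)
          (Poly_Mapping.lookup p \<gamma> *
            (\<integral>y. monom_eval (Poly_Mapping.map_key Inr \<gamma>) (($) y) \<partial>\<nu>)))"

definition quadratic_module ::
    "nat \<Rightarrow> (nat \<Rightarrow> ('n + 'm::finite) rpoly) \<Rightarrow> (real^'m) measure \<Rightarrow> 'n rpoly set" where
  "quadratic_module s g \<nu> =
     {\<Sum>j\<le>s. integral_y \<nu> (\<tau> j * g j) | \<tau>. \<forall>j\<le>s. \<tau> j \<in> sums_of_squares}"

definition archimedean :: "'n::finite rpoly set \<Rightarrow> bool" where
  "archimedean Q \<longleftrightarrow> (\<exists>N::int. N > 0 \<and> of_int N - (\<Sum>i\<in>UNIV. (pvar i)\<^sup>2) \<in> Q)"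

definition riesz :: "('n exponent \<Rightarrow> real) \<Rightarrow> 'n rpoly \<Rightarrow> real" where
  "riesz z f = (\<Sum>\<alpha>\<in>Poly_Mapping.keys f. Poly_Mapping.lookup f \<alpha> * z \<alpha>)"

definition moment_sequence :: "(real^'n) set \<Rightarrow> ('n::finite exponent \<Rightarrow> real) \<Rightarrow> bool" where
  "moment_sequence K z \<longleftrightarrow>
     (\<exists>\<mu>. sets \<mu> = sets borel \<and> finite_measure \<mu> \<and> measure_support \<mu> \<subseteq> K \<and>
        (\<forall>\<alpha>. integrable \<mu> (\<lambda>x. monom_eval \<alpha> (($) x)) \<and>
             z \<alpha> = (\<integral>x. monom_eval \<alpha> (($) x) \<partial>\<mu>)))"

lemma lookup_map_key_Inl [simp]:
  "Poly_Mapping.lookup (Poly_Mapping.map_key Inl \<gamma>) i = Poly_Mapping.lookup \<gamma> (Inl i)"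
  by (simp add: map_key.rep_eq)

lemma lookup_map_key_Inr [simp]:
  "Poly_Mapping.lookup (Poly_Mapping.map_key Inr \<gamma>) j = Poly_Mapping.lookup \<gamma> (Inr j)"
  by (simp add: map_key.rep_eq)

lemma riesz_superset:
  assumes "finite A" "Poly_Mapping.keys f \<subseteq> A"
  shows "riesz z f = (\<Sum>\<alpha>\<in>A. Poly_Mapping.lookup f \<alpha> * z \<alpha>)"
  unfolding riesz_def using assms
  by (intro sum.mono_neutral_left) (auto simp: in_keys_iff)

lemma riesz_add: "riesz z (f + h) = riesz z f + riesz z h"
proof -
  let ?A = "Poly_Mapping.keys f \<union> Poly_Mapping.keys h"
  have "Poly_Mapping.keys (f + h) \<subseteq> ?A" by (rule Poly_Mapping.keys_add)
  then show ?thesis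
    by (simp add: riesz_superset[of ?A] lookup_add distrib_right sum.distrib)
qed

lemma riesz_sum: "riesz z (\<Sum>i\<in>I. f i) = (\<Sum>i\<in>I. riesz z (f i))"
proof (induction I rule: infinite_finite_induct)
  case empty
  show ?case by (simp add: riesz_def)
qed (simp_all add: riesz_add, simp add: riesz_def)

lemma riesz_single [simp]: "riesz z (Poly_Mapping.single \<alpha> c) = c * z \<alpha>"
  by (simp add: riesz_def)

lemma poly_eval_riesz: "poly_eval p x = riesz (\<lambda>\<alpha>. monom_eval \<alpha> x) p"
  by (simp add: poly_eval_def riesz_def)

lemma monom_eval_sum:
  "monom_eval \<gamma> (case_sum x y) =
     monom_eval (Poly_Mapping.map_key Inl \<gamma>) x * monom_eval (Poly_Mapping.map_key Inr \<gamma>) y"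
proof -
  have "monom_eval \<gamma> (case_sum x y) =
      (\<Prod>i\<in>range Inl. case_sum x y i ^ Poly_Mapping.lookup \<gamma> i) *
      (\<Prod>i\<in>range Inr. case_sum x y i ^ Poly_Mapping.lookup \<gamma> i)"
    unfolding monom_eval_def UNIV_sum by (rule prod.union_disjoint) auto
  then show ?thesis
    by (simp add: monom_eval_def prod.reindex)
qed

lemma poly_eval_integral_y:
  assumes "finite_moments \<nu>"
  shows "poly_eval (integral_y \<nu> p) (($) x) = (\<integral>y. poly_eval2 p x y \<partial>\<nu>)"
proof -
  have "integrable \<nu> (\<lambda>y. monom_eval \<beta> (($) y))" for \<beta>
    using assms by (simp add: finite_moments_def)
  then show ?thesis
    by (simp add: poly_eval2_def poly_eval_def[of p] monom_eval_sum integral_y_def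
        poly_eval_riesz[where x = "($) x"] riesz_sum mult_ac)
qed

end

theory Submission
  imports Defs "HOL-Probability.Probability" "HOL-Real_Asymp.Real_Asymp"
begin

text \<open>
  If \<open>z\<close> has a representing measure \<open>\<mu>\<close> on \<open>K\<close>, then \<open>\<R>\<^sub>z(f) = \<integral> f d\<mu>\<close>.  An element
  \<open>f(x) = \<Sum>\<^sub>j \<integral> \<tau>\<^sub>j(x,y) g\<^sub>j(x,y) d\<nu>(y)\<close> of the quadratic module is nonnegative at every \<open>x \<in> K\<close>,
  because \<open>\<nu>\<close>-almost every \<open>y\<close> lies in the support \<open>Q\<close> of \<open>\<nu>\<close>; integration against \<open>\<mu>\<close> gives one
  direction (lemma \<open>riesz_nonneg_of_moment_sequence\<close>).

  For the converse write \<open>L = \<R>\<^sub>z\<close>.  Squares \<open>p(x)\<^sup>2\<close> can be moved under the integral over \<open>y\<close>, so the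
  quadratic module is stable under multiplication by them, and the Archimedean condition yields
  \<open>L(p\<^sup>2) \<ge> 0\<close> and \<open>L((N - \<Sum>\<^sub>i x\<^sub>i\<^sup>2) p\<^sup>2) \<ge> 0\<close> for all \<open>p \<in> \<real>[x]\<close>.  The proof then has two halves.

  \<^item> A representing measure exists (\<open>representing_measure\<close>).  Call \<open>a\<close> a positive multiplier if
    \<open>L(a p\<^sup>2) \<ge> 0\<close> for all \<open>p\<close>.  With \<open>a\<close> also \<open>(N - x\<^sub>i\<^sup>2) a\<close> is one: by the Cauchy-Schwarz inequality
    the numbers \<open>b\<^sub>k = L(a x\<^sub>i\<^sup>2\<^sup>k p\<^sup>2)\<close> form a logarithmically convex sequence, they grow at most like
    \<open>N\<^sup>k\<close>, and this is only possible if \<open>b\<^sub>1 \<le> N b\<^sub>0\<close>.  Hence \<open>L\<close> is nonnegative on all products of the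
    factors \<open>\<surd>N \<plusminus> x\<^sub>i\<close>, in particular on the Bernstein polynomials of a cube.  The values of \<open>L\<close> on
    them are the weights of discrete measures on a grid, and the moments of these measures converge
    to \<open>L\<close>.  Compactness of a product of intervals gives a limit of the discrete measures along some
    filter, as a finitely additive probability; its joint laws on countably many simple functions
    are a projective family, and the Daniell-Kolmogorov theorem turns it into a genuine measure \<open>\<mu>\<close>.

  \<^item> The support of \<open>\<mu>\<close> lies in \<open>K\<close>.  For \<open>p \<in> \<real>[x]\<close> and \<open>r \<in> \<real>[y]\<close> the polynomial
    \<open>\<integral> (p(x) r(y))\<^sup>2 g\<^sub>j(x,y) d\<nu>(y)\<close> belongs to the quadratic module, so
    \<open>\<integral> r(y)\<^sup>2 G(y) d\<nu>(y) \<ge> 0\<close> for \<open>G(y) = \<integral> p(x)\<^sup>2 g\<^sub>j(x,y) d\<mu>(x)\<close>.  Lemma \<open>nonneg_on_support\<close> says that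
    such a polynomial \<open>G\<close> is nonnegative on the support of a measure satisfying Carleman's condition.
    It is applied to \<open>\<nu>\<close> and \<open>G\<close>, and then, for each fixed \<open>y \<in> Q\<close>, to \<open>\<mu>\<close> and \<open>g\<^sub>j(\<cdot>,y)\<close>; the measure
    \<open>\<mu>\<close> satisfies Carleman's condition because it is carried by a bounded set.

  Lemma \<open>nonneg_on_support\<close> is a statement about polynomial approximation.  If \<open>u\<^sup>2\<close> could replace
  \<open>r\<^sup>2\<close> for Gaussians \<open>u\<close> concentrated at a point of the support, the sign of \<open>G\<close> at that point would
  follow.  So it suffices to approximate Gaussians, hence products of cosines \<open>cos(l y\<^sub>j + \<phi>)\<close>, by
  polynomials in \<open>L\<^sup>2\<close> of the measure \<open>\<bar>G\<bar> \<nu>\<close>.  At \<open>l = 0\<close> such a cosine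
  and all its derivatives with respect to \<open>l\<close> are polynomials, and the norms of the derivatives are
  controlled by the moments of \<open>\<nu>\<close>; Carleman's condition provides the quasianalyticity that forces
  the distance from the polynomials to vanish for all \<open>l\<close>.  Bang's proof of the Denjoy-Carleman
  theorem only compares Taylor expansions at different points, so it works for the distance as it
  does for the absolute value, one coordinate at a time (\<open>near_cos\<close>).
\<close>

section \<open>Carleman's inequality and logarithmically convex sequences\<close>

lemma sum_by_parts_telescope:
  fixes b :: "nat \<Rightarrow> real"
  shows "(\<Sum>n<N. (\<Sum>k\<le>n. b k) / ((real n + 1) * (real n + 2)))
    = (\<Sum>k<N. b k / (real k + 1)) - (\<Sum>k<N. b k) / (real N + 1)"
proof (induction N)
  case (Suc N)
  have *: "1 / ((real N + 1) * (real N + 2)) = 1 / (real N + 1) - 1 / (real N + 2)"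
    by (simp add: field_simps)
  have "(\<Sum>k\<le>N. b k) / ((real N + 1) * (real N + 2))
      = (\<Sum>k<Suc N. b k) * (1 / (real N + 1) - 1 / (real N + 2))"
    unfolding *[symmetric] by (simp add: lessThan_Suc_atMost)
  then show ?case
    unfolding sum.lessThan_Suc[of _ N] Suc.IH
    by (simp add: add_divide_distrib distrib_right right_diff_distrib diff_divide_distrib add.commute)
qed simp

text \<open>
  The weights \<open>c\<^sub>k = (k + 2)\<^sup>k\<^sup>+\<^sup>1 / (k + 1)\<^sup>k\<close> satisfy \<open>c\<^sub>0 \<cdots> c\<^sub>n = (n + 2)\<^sup>n\<^sup>+\<^sup>1\<close>, so applying the inequality of
  the arithmetic and geometric mean to \<open>c\<^sub>k r\<^sub>k\<close> instead of \<open>r\<^sub>k\<close> gains a factor \<open>1 / (n + 2)\<close>.  The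
  coefficients \<open>1 / ((n + 1) (n + 2))\<close> telescope when the order of summation is exchanged, and what is
  left is \<open>c\<^sub>k / (k + 1) \<le> e\<close>.
\<close>

theorem carleman_inequality:
  fixes r :: "nat \<Rightarrow> real"
  assumes pos: "\<And>k. r k > 0" and "summable r"
  shows "summable (\<lambda>n. (\<Prod>k\<le>n. r k) powr (1 / (real n + 1)))"
proof -
  define c where "c k = (real k + 2) ^ Suc k / (real k + 1) ^ k" for k :: nat
  have c_pos: "c k > 0" for k by (simp add: c_def)
  have prod_c: "(\<Prod>k\<le>n. c k) = (real n + 2) ^ Suc n" for n
  proof (induction n)
    case (Suc n)
    have "(real n + 2) ^ Suc n \<noteq> 0" by simp
    then show ?case
      using Suc by (simp add: c_def add.commute field_simps del: power_Suc)
  qed (simp add: c_def)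
  have c_le: "c k / (real k + 1) \<le> exp 1" for k
  proof -
    have "c k / (real k + 1) = (1 + 1 / (real k + 1)) ^ Suc k"
    proof -
      have "(real k + 2) / (real k + 1) = 1 + 1 / (real k + 1)" by (simp add: field_simps)
      then show ?thesis
        by (metis (no_types, lifting) c_def divide_divide_eq_left power_Suc2 power_divide)
    qed
    also have "\<dots> \<le> exp (1 / (real k + 1)) ^ Suc k"
      by (intro power_mono) (auto simp: exp_ge_add_one_self)
    also have "\<dots> = exp (real (Suc k) * (1 / (real k + 1)))" by (rule exp_of_nat_mult[symmetric])
    also have "real (Suc k) * (1 / (real k + 1)) = 1" by (simp add: field_simps)
    finally show ?thesis .
  qed
  have gm: "(\<Prod>k\<le>n. r k) powr (1 / (real n + 1))
      \<le> (\<Sum>k\<le>n. c k * r k) / ((real n + 1) * (real n + 2))" for n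
  proof -
    have "((real n + 2) ^ Suc n) powr (1 / (real n + 1)) = real n + 2"
      by (subst powr_realpow[symmetric]) (auto simp: powr_powr add.commute)
    then have "(\<Prod>k\<le>n. r k) powr (1 / (real n + 1)) * (real n + 2)
        = (\<Prod>k\<le>n. c k * r k) powr (1 / (real n + 1))"
      by (simp add: prod.distrib prod_c powr_mult prod_nonneg pos less_imp_le del: power_Suc)
    also have "\<dots> \<le> (\<Sum>k\<le>n. c k * r k / (real n + 1))"
      using arith_geom_mean[of "{..n}" "\<lambda>k. c k * r k"] c_pos pos
      by (auto simp: less_imp_le add.commute)
    also have "\<dots> = (\<Sum>k\<le>n. c k * r k) / (real n + 1)" by (simp add: sum_divide_distrib)
    finally have "(\<Prod>k\<le>n. r k) powr (1 / (real n + 1)) \<le> (\<Sum>k\<le>n. c k * r k) / (real n + 1) / (real n + 2)"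
      by (simp only: pos_le_divide_eq[of "real n + 2"])
    then show ?thesis by simp
  qed
  show ?thesis
  proof (rule summableI_nonneg_bounded)
    fix N
    have "(\<Sum>n<N. (\<Prod>k\<le>n. r k) powr (1 / (real n + 1)))
        \<le> (\<Sum>n<N. (\<Sum>k\<le>n. c k * r k) / ((real n + 1) * (real n + 2)))"
      by (intro sum_mono gm)
    also have "\<dots> \<le> (\<Sum>k<N. c k * r k / (real k + 1))"
      unfolding sum_by_parts_telescope using c_pos pos by (simp add: sum_nonneg less_imp_le)
    also have "\<dots> = (\<Sum>k<N. (c k / (real k + 1)) * r k)" by simp
    also have "\<dots> \<le> (\<Sum>k<N. exp 1 * r k)"
      by (intro sum_mono mult_right_mono c_le) (use pos in \<open>auto simp: less_imp_le\<close>)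
    also have "\<dots> = exp 1 * (\<Sum>k<N. r k)" by (simp add: sum_distrib_left)
    also have "\<dots> \<le> exp 1 * suminf r"
      by (intro mult_left_mono sum_le_suminf) (use assms in \<open>auto simp: less_imp_le\<close>)
    finally show "(\<Sum>n<N. (\<Prod>k\<le>n. r k) powr (1 / (real n + 1))) \<le> exp 1 * suminf r" .
  qed simp
qed

text \<open>
  The quotient \<open>A\<^sub>0 / A\<^sub>n\<close> is the product of the first \<open>n\<close> ratios, so \<open>A\<^sub>n\<^sup>-\<^sup>1\<^sup>/\<^sup>n\<close> is at most their geometric
  mean, and Carleman's inequality applies.
\<close>

lemma not_summable_ratio:
  fixes A :: "nat \<Rightarrow> real"
  assumes pos: "\<And>n. A n > 0" and "A 0 \<ge> 1"
    and div: "\<not> summable (\<lambda>n. A (Suc n) powr (- 1 / (real n + 1)))"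
  shows "\<not> summable (\<lambda>n. A n / A (Suc n))"
proof
  assume "summable (\<lambda>n. A n / A (Suc n))"
  then have s: "summable (\<lambda>n. (\<Prod>k\<le>n. A k / A (Suc k)) powr (1 / (real n + 1)))"
    by (intro carleman_inequality) (use pos in auto)
  have prod: "(\<Prod>k\<le>n. A k / A (Suc k)) = A 0 / A (Suc n)" for n
    by (induction n) (use pos in \<open>auto simp: less_imp_neq[THEN not_sym]\<close>)
  have "A (Suc n) powr (- 1 / (real n + 1)) \<le> (\<Prod>k\<le>n. A k / A (Suc k)) powr (1 / (real n + 1))" for n
  proof -
    have "A (Suc n) powr (- 1 / (real n + 1)) = (1 / A (Suc n)) powr (1 / (real n + 1))"
      using pos[of "Suc n"] by (simp add: powr_divide powr_minus_divide)
    also have "\<dots> \<le> (A 0 / A (Suc n)) powr (1 / (real n + 1))"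
      using pos[of "Suc n"] \<open>A 0 \<ge> 1\<close> by (intro powr_mono2 divide_right_mono) auto
    finally show ?thesis unfolding prod .
  qed
  then have "summable (\<lambda>n. A (Suc n) powr (- 1 / (real n + 1)))"
    by (intro summable_comparison_test'[OF s, of 0]) auto
  with div show False ..
qed

text \<open>
  Splitting off a weight by the Cauchy-Schwarz inequality doubles the order of the moments and takes
  a square root.  The divergence survives: logarithmic convexity makes the ratios \<open>r\<^sub>n\<close> decrease, and
  the new ratio \<open>\<surd>(r\<^sub>2\<^sub>n r\<^sub>2\<^sub>n\<^sub>+\<^sub>1)\<close> dominates both \<open>r\<^sub>2\<^sub>n\<^sub>+\<^sub>1\<close> and \<open>r\<^sub>2\<^sub>n\<^sub>+\<^sub>2\<close>.
\<close>

lemma not_summable_ratio_sqrt_even: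
  fixes A :: "nat \<Rightarrow> real"
  assumes pos: "\<And>n. A n > 0" and lc: "\<And>n. (A (Suc n))\<^sup>2 \<le> A n * A (Suc (Suc n))"
    and div: "\<not> summable (\<lambda>n. A n / A (Suc n))"
  shows "\<not> summable (\<lambda>n. sqrt (A (2 * n)) / sqrt (A (2 * Suc n)))"
proof
  assume s: "summable (\<lambda>n. sqrt (A (2 * n)) / sqrt (A (2 * Suc n)))"
  define r where "r n = A n / A (Suc n)" for n
  have r_pos: "r n > 0" for n using pos by (simp add: r_def)
  have r_dec: "r (Suc n) \<le> r n" for n
    using lc[of n] pos[of n] pos[of "Suc n"] pos[of "Suc (Suc n)"]
    by (simp add: r_def field_simps power2_eq_square)
  define q where "q n = sqrt (A (2 * n)) / sqrt (A (2 * Suc n))" for n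
  have q: "q n \<ge> r (2 * n + 1)" for n
  proof -
    have "q n = sqrt (r (2 * n) * r (2 * n + 1))"
      using pos[of "2*n+1"] by (simp add: q_def r_def real_sqrt_divide[symmetric])
    also have "\<dots> \<ge> sqrt (r (2 * n + 1) * r (2 * n + 1))"
      using r_dec[of "2*n"] r_pos[of "2*n+1"] by (intro real_sqrt_le_mono mult_right_mono) auto
    finally show ?thesis using r_pos[of "2*n+1"] by simp
  qed
  have pair: "(\<Sum>k<2 * n. r (Suc k)) \<le> 2 * (\<Sum>k<n. q k)" for n
  proof (induction n)
    case (Suc n)
    have "r (Suc (2 * n)) + r (Suc (Suc (2 * n))) \<le> 2 * q n"
      using q[of n] r_dec[of "2*n+1"] by simp
    with Suc show ?case by simp
  qed simp
  have "summable (\<lambda>k. r (Suc k))"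
  proof (rule summableI_nonneg_bounded)
    fix n
    have "(\<Sum>k<n. r (Suc k)) \<le> (\<Sum>k<2 * n. r (Suc k))"
      by (intro sum_mono2) (use r_pos in \<open>auto simp: less_imp_le\<close>)
    also have "\<dots> \<le> 2 * (\<Sum>k<n. q k)" by (rule pair)
    also have "\<dots> \<le> 2 * suminf q"
      using s by (intro mult_left_mono sum_le_suminf)
        (auto simp: q_def[abs_def] intro!: divide_nonneg_nonneg less_imp_le[OF pos])
    finally show "(\<Sum>k<n. r (Suc k)) \<le> 2 * suminf q" .
  qed (use r_pos in \<open>auto simp: less_imp_le\<close>)
  then have "summable r" by (simp add: summable_Suc_iff)
  with div show False by (simp add: r_def[abs_def])
qed

section \<open>Approximation by polynomials in mean square\<close>

lemma quadratic_discriminant_le: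
  fixes a b c :: real
  assumes "\<And>t. 0 \<le> a + 2 * t * b + t\<^sup>2 * c" and "0 \<le> c"
  shows "b\<^sup>2 \<le> a * c"
proof (cases "c = 0")
  case True
  have "b = 0"
  proof (rule ccontr)
    assume "b \<noteq> 0"
    with assms(1)[of "- (a + 1) / (2 * b)"] True show False by (simp add: field_simps)
  qed
  then show ?thesis using True by simp
next
  case False
  with \<open>0 \<le> c\<close> have "c > 0" by simp
  with assms(1)[of "- b / c"] show ?thesis by (simp add: power2_eq_square field_simps)
qed

lemma integrable_mult_L2:
  fixes f h :: "'a \<Rightarrow> real"
  assumes [measurable]: "f \<in> borel_measurable M" "h \<in> borel_measurable M"
    and "integrable M (\<lambda>x. (f x)\<^sup>2)" "integrable M (\<lambda>x. (h x)\<^sup>2)"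
  shows "integrable M (\<lambda>x. f x * h x)"
proof (rule Bochner_Integration.integrable_bound)
  show "integrable M (\<lambda>x. (f x)\<^sup>2 + (h x)\<^sup>2)" using assms by simp
  have "\<bar>f x * h x\<bar> \<le> (f x)\<^sup>2 + (h x)\<^sup>2" for x
  proof -
    have "0 \<le> \<bar>f x\<bar> * \<bar>h x\<bar>" by simp
    with sum_squares_bound[of "\<bar>f x\<bar>" "\<bar>h x\<bar>"] show ?thesis
      unfolding abs_mult by (simp only: mult.assoc power2_abs)
  qed
  then show "AE x in M. norm (f x * h x) \<le> norm ((f x)\<^sup>2 + (h x)\<^sup>2)" by simp
qed simp

lemma integral_Cauchy_Schwarz:
  fixes f h :: "'a \<Rightarrow> real"
  assumes [measurable]: "f \<in> borel_measurable M" "h \<in> borel_measurable M"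
    and f: "integrable M (\<lambda>x. (f x)\<^sup>2)" and h: "integrable M (\<lambda>x. (h x)\<^sup>2)"
  shows "\<bar>\<integral>x. f x * h x \<partial>M\<bar> \<le> sqrt (\<integral>x. (f x)\<^sup>2 \<partial>M) * sqrt (\<integral>x. (h x)\<^sup>2 \<partial>M)"
proof -
  have fh: "integrable M (\<lambda>x. f x * h x)" by (intro integrable_mult_L2 assms)
  have "0 \<le> (\<integral>x. (f x)\<^sup>2 \<partial>M) + 2 * t * (\<integral>x. f x * h x \<partial>M) + t\<^sup>2 * (\<integral>x. (h x)\<^sup>2 \<partial>M)" for t
  proof -
    have "0 \<le> (\<integral>x. (f x + t * h x)\<^sup>2 \<partial>M)" by simp
    also have "(\<lambda>x. (f x + t * h x)\<^sup>2) = (\<lambda>x. (f x)\<^sup>2 + (2 * t) * (f x * h x) + t\<^sup>2 * (h x)\<^sup>2)"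
      by (auto simp: power2_eq_square algebra_simps)
    finally show ?thesis using f h fh by simp
  qed
  then have "(\<integral>x. f x * h x \<partial>M)\<^sup>2 \<le> (\<integral>x. (f x)\<^sup>2 \<partial>M) * (\<integral>x. (h x)\<^sup>2 \<partial>M)" (is "?b\<^sup>2 \<le> ?a * ?c")
    by (intro quadratic_discriminant_le) simp_all
  then have "sqrt (?b\<^sup>2) \<le> sqrt (?a * ?c)" by (rule real_sqrt_le_mono)
  then show ?thesis by (simp add: real_sqrt_mult)
qed

lemma integral_Minkowski:
  fixes f h :: "'a \<Rightarrow> real"
  assumes [measurable]: "f \<in> borel_measurable M" "h \<in> borel_measurable M"
    and f: "integrable M (\<lambda>x. (f x)\<^sup>2)" and h: "integrable M (\<lambda>x. (h x)\<^sup>2)"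
  shows "integrable M (\<lambda>x. (f x + h x)\<^sup>2)"
    and "sqrt (\<integral>x. (f x + h x)\<^sup>2 \<partial>M) \<le> sqrt (\<integral>x. (f x)\<^sup>2 \<partial>M) + sqrt (\<integral>x. (h x)\<^sup>2 \<partial>M)"
proof -
  have fh: "integrable M (\<lambda>x. f x * h x)" by (intro integrable_mult_L2 assms)
  have eq: "(\<lambda>x. (f x + h x)\<^sup>2) = (\<lambda>x. (f x)\<^sup>2 + 2 * (f x * h x) + (h x)\<^sup>2)"
    by (auto simp: power2_eq_square algebra_simps)
  show "integrable M (\<lambda>x. (f x + h x)\<^sup>2)" unfolding eq using f h fh by simp
  have "(\<integral>x. (f x + h x)\<^sup>2 \<partial>M)
      = (\<integral>x. (f x)\<^sup>2 \<partial>M) + 2 * (\<integral>x. f x * h x \<partial>M) + (\<integral>x. (h x)\<^sup>2 \<partial>M)"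
    unfolding eq using f h fh by simp
  also have "\<dots> \<le> (\<integral>x. (f x)\<^sup>2 \<partial>M) + 2 * (sqrt (\<integral>x. (f x)\<^sup>2 \<partial>M) * sqrt (\<integral>x. (h x)\<^sup>2 \<partial>M)) + (\<integral>x. (h x)\<^sup>2 \<partial>M)"
    using integral_Cauchy_Schwarz[OF assms] by linarith
  also have "\<dots> = (sqrt (\<integral>x. (f x)\<^sup>2 \<partial>M) + sqrt (\<integral>x. (h x)\<^sup>2 \<partial>M))\<^sup>2"
    by (simp add: power2_sum)
  finally show "sqrt (\<integral>x. (f x + h x)\<^sup>2 \<partial>M) \<le> sqrt (\<integral>x. (f x)\<^sup>2 \<partial>M) + sqrt (\<integral>x. (h x)\<^sup>2 \<partial>M)"
    by (intro real_le_lsqrt) auto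
qed

text \<open>
  A predicate with an explicit witness stands in for the distance, which would be an infimum over all
  polynomials; subadditivity and homogeneity then hold without choosing near-minimizers.
\<close>

definition poly_close :: "('a::real_normed_vector) measure \<Rightarrow> real \<Rightarrow> ('a \<Rightarrow> real) \<Rightarrow> bool" where
  "poly_close \<rho> e f \<longleftrightarrow> f \<in> borel_measurable \<rho> \<and>
    (\<exists>p. real_polynomial_function p \<and> p \<in> borel_measurable \<rho> \<and>
      integrable \<rho> (\<lambda>x. (f x - p x)\<^sup>2) \<and> sqrt (\<integral>x. (f x - p x)\<^sup>2 \<partial>\<rho>) \<le> e)"

lemma poly_close_mono: "poly_close \<rho> a f \<Longrightarrow> a \<le> b \<Longrightarrow> poly_close \<rho> b f"
  unfolding poly_close_def
  by (elim conjE exE, intro conjI exI, assumption+) (rule order_trans)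

lemma poly_close_add:
  assumes "poly_close \<rho> a f" "poly_close \<rho> b h"
  shows "poly_close \<rho> (a + b) (\<lambda>x. f x + h x)"
proof -
  obtain p q where p: "real_polynomial_function p" "p \<in> borel_measurable \<rho>"
      "integrable \<rho> (\<lambda>x. (f x - p x)\<^sup>2)" "sqrt (\<integral>x. (f x - p x)\<^sup>2 \<partial>\<rho>) \<le> a"
    and q: "real_polynomial_function q" "q \<in> borel_measurable \<rho>"
      "integrable \<rho> (\<lambda>x. (h x - q x)\<^sup>2)" "sqrt (\<integral>x. (h x - q x)\<^sup>2 \<partial>\<rho>) \<le> b"
    and [measurable]: "f \<in> borel_measurable \<rho>" "h \<in> borel_measurable \<rho>"
    using assms unfolding poly_close_def by blast
  note [measurable] = p(2) q(2)
  have eq: "f x + h x - (p x + q x) = (f x - p x) + (h x - q x)" for x by simp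
  show ?thesis
    unfolding poly_close_def
  proof (intro conjI exI[of _ "\<lambda>x. p x + q x"])
    show "integrable \<rho> (\<lambda>x. (f x + h x - (p x + q x))\<^sup>2)"
      unfolding eq by (rule integral_Minkowski) (use p(3) q(3) in auto)
    have "sqrt (\<integral>x. (f x + h x - (p x + q x))\<^sup>2 \<partial>\<rho>)
        \<le> sqrt (\<integral>x. (f x - p x)\<^sup>2 \<partial>\<rho>) + sqrt (\<integral>x. (h x - q x)\<^sup>2 \<partial>\<rho>)"
      unfolding eq by (rule integral_Minkowski) (use p(3) q(3) in auto)
    then show "sqrt (\<integral>x. (f x + h x - (p x + q x))\<^sup>2 \<partial>\<rho>) \<le> a + b" using p(4) q(4) by linarith
  qed (use p(1) q(1) in auto)
qed

lemma poly_close_scale: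
  assumes "poly_close \<rho> a f"
  shows "poly_close \<rho> (\<bar>c\<bar> * a) (\<lambda>x. c * f x)"
proof -
  obtain p where p: "real_polynomial_function p" "p \<in> borel_measurable \<rho>"
      "integrable \<rho> (\<lambda>x. (f x - p x)\<^sup>2)" "sqrt (\<integral>x. (f x - p x)\<^sup>2 \<partial>\<rho>) \<le> a"
    and [measurable]: "f \<in> borel_measurable \<rho>"
    using assms unfolding poly_close_def by blast
  note [measurable] = p(2)
  have eq: "(c * f x - c * p x)\<^sup>2 = c\<^sup>2 * (f x - p x)\<^sup>2" for x
    by (simp add: power_mult_distrib[symmetric] right_diff_distrib)
  show ?thesis
    unfolding poly_close_def
  proof (intro conjI exI[of _ "\<lambda>x. c * p x"])
    show "integrable \<rho> (\<lambda>x. (c * f x - c * p x)\<^sup>2)" unfolding eq using p(3) by simp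
    have "sqrt (\<integral>x. (c * f x - c * p x)\<^sup>2 \<partial>\<rho>) = \<bar>c\<bar> * sqrt (\<integral>x. (f x - p x)\<^sup>2 \<partial>\<rho>)"
      unfolding eq by (simp add: real_sqrt_mult)
    also have "\<dots> \<le> \<bar>c\<bar> * a" by (intro mult_left_mono p(4)) simp
    finally show "sqrt (\<integral>x. (c * f x - c * p x)\<^sup>2 \<partial>\<rho>) \<le> \<bar>c\<bar> * a" .
  qed (use p(1) in auto)
qed

lemma poly_close_norm:
  assumes "f \<in> borel_measurable \<rho>" "integrable \<rho> (\<lambda>x. (f x)\<^sup>2)" "sqrt (\<integral>x. (f x)\<^sup>2 \<partial>\<rho>) \<le> a"
  shows "poly_close \<rho> a f"
  using assms unfolding poly_close_def
  by (intro conjI exI[of _ "\<lambda>x. 0"]) auto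

section \<open>Bang's estimate for quasianalytic approximation\<close>

text \<open>
  Differentiating the cosine shifts its argument by \<open>\<pi> / 2\<close>, so all Taylor coefficients are again
  cosines.  Staying with real functions of this shape replaces the use of complex exponentials.
\<close>

lemma cos_taylor_remainder:
  fixes a t :: real
  shows "\<bar>cos (a + t) - (\<Sum>i<n. t ^ i / fact i * cos (a + real i * pi / 2))\<bar> \<le> \<bar>t\<bar> ^ n / fact n"
proof -
  define diff where "diff m s = cos (a + s + real m * pi / 2)" for m :: nat and s
  have "\<forall>m s. DERIV (diff m) s :> diff (Suc m) s"
  proof (intro allI)
    fix m s
    have "diff (Suc m) s = - sin (a + s + real m * pi / 2)"
    proof -
      have "a + s + real (Suc m) * pi / 2 = (a + s + real m * pi / 2) + pi / 2"
        by (simp add: distrib_right add_divide_distrib)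
      then show ?thesis by (simp only: diff_def cos_add[of _ "pi / 2"]) simp
    qed
    then show "DERIV (diff m) s :> diff (Suc m) s"
      unfolding diff_def by (auto intro!: derivative_eq_intros)
  qed
  from Maclaurin_all_le[OF refl this, where x = t and n = n]
  obtain u where "diff 0 t = (\<Sum>m<n. diff m 0 / fact m * t ^ m) + diff n u / fact n * t ^ n"
    by blast
  then have "cos (a + t) - (\<Sum>i<n. t ^ i / fact i * cos (a + real i * pi / 2)) = diff n u / fact n * t ^ n"
    by (simp add: diff_def mult.commute)
  also have "\<bar>\<dots>\<bar> = \<bar>diff n u\<bar> * (\<bar>t\<bar> ^ n / fact n)"
    by (simp add: abs_mult power_abs)
  also have "\<dots> \<le> 1 * (\<bar>t\<bar> ^ n / fact n)"
    by (intro mult_right_mono) (auto simp: diff_def)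
  finally show ?thesis by simp
qed

text \<open>
  The cosine differs from \<open>1 - w\<^sup>2 / 2\<close> by at most \<open>w\<^sup>4 / 24\<close>; raising to the \<open>k\<close>-th power multiplies the
  error by at most \<open>k\<close> as long as both numbers lie in \<open>[-1, 1]\<close>, and \<open>k (z / \<surd>k)\<^sup>4\<close> tends to \<open>0\<close>.
\<close>

lemma cos_power_tendsto_gaussian:
  "(\<lambda>k::nat. cos (z / sqrt (real k)) ^ k) \<longlonglongrightarrow> exp (- z\<^sup>2 / 2)"
proof -
  have cos_bound: "\<bar>cos w - (1 - w\<^sup>2 / 2)\<bar> \<le> w ^ 4 / 24" for w :: real
  proof -
    have "cos (3 * pi / 2) = 0" using cos_3over2_pi by (simp add: field_simps)
    then have "(\<Sum>i<4. w ^ i / fact i * cos (0 + real i * pi / 2)) = 1 - w\<^sup>2 / 2"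
      by (simp add: eval_nat_numeral)
    with cos_taylor_remainder[of 0 w 4] show ?thesis by (simp add: fact_numeral)
  qed
  have lim: "(\<lambda>k::nat. (1 - z\<^sup>2 / 2 / real k) ^ k) \<longlonglongrightarrow> exp (- z\<^sup>2 / 2)"
    using tendsto_exp_limit_sequentially[of "- z\<^sup>2 / 2"] by simp
  have "(\<lambda>k::nat. cos (z / sqrt (real k)) ^ k - (1 - z\<^sup>2 / 2 / real k) ^ k) \<longlonglongrightarrow> 0"
  proof (rule Lim_null_comparison)
    show "(\<lambda>k::nat. z ^ 4 / 24 / real k) \<longlonglongrightarrow> 0" by real_asymp
    have "eventually (\<lambda>k::nat. 0 < k \<and> z\<^sup>2 \<le> real k) sequentially"
      by (intro eventually_conj eventually_gt_at_top eventually_compose_filterlim[OF eventually_ge_at_top filterlim_real_sequentially])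
    then show "eventually (\<lambda>k. norm (cos (z / sqrt (real k)) ^ k - (1 - z\<^sup>2 / 2 / real k) ^ k) \<le> z ^ 4 / 24 / real k) sequentially"
    proof eventually_elim
      case (elim k)
      define w where "w = z / sqrt (real k)"
      have w2: "w\<^sup>2 = z\<^sup>2 / real k" by (simp add: w_def power_divide)
      then have w4: "w ^ 4 = z ^ 4 / (real k)\<^sup>2"
        by (metis (no_types, lifting) power2_eq_square power4_eq_xxxx power_divide mult.assoc)
      have "z\<^sup>2 / real k \<le> 1" "0 \<le> z\<^sup>2 / real k" using elim by auto
      then have "norm (1 - z\<^sup>2 / 2 / real k) \<le> 1" by (simp add: abs_le_iff)
      then have "norm (cos w ^ k - (1 - z\<^sup>2 / 2 / real k) ^ k) \<le> real k * norm (cos w - (1 - z\<^sup>2 / 2 / real k))"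
        by (intro norm_power_diff) auto
      also have "\<dots> \<le> real k * (w ^ 4 / 24)"
        using cos_bound[of w] w2 by (intro mult_left_mono) (auto simp: mult.commute)
      also have "\<dots> = z ^ 4 / 24 / real k" using elim by (simp add: w4 power2_eq_square)
      finally show ?case by (simp add: w_def)
    qed
  qed
  from tendsto_add[OF this lim] show ?thesis by simp
qed
text \<open>
  The setting of Bang's argument.  Read \<open>near a f\<close> as: the distance of \<open>f\<close> from a fixed linear
  space is at most \<open>a\<close>.  The functions \<open>y\<^sup>k v\<close> belong to the closure of that space (\<open>near_start\<close>), their
  size is at most \<open>M k\<close> (\<open>near_dominated\<close>), and the divergence of \<open>\<Sum> M k / M (k + 1)\<close> is the
  Denjoy-Carleman condition for the logarithmically convex sequence \<open>M\<close>.
\<close>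

locale quasianalytic_approximation =
  fixes \<rho> :: "'a measure" and near :: "real \<Rightarrow> ('a \<Rightarrow> real) \<Rightarrow> bool"
    and y v :: "'a \<Rightarrow> real" and M :: "nat \<Rightarrow> real"
  assumes measurable_y [measurable]: "y \<in> borel_measurable \<rho>"
    and measurable_v [measurable]: "v \<in> borel_measurable \<rho>"
    and near_add: "\<And>a b f h. near a f \<Longrightarrow> near b h \<Longrightarrow> near (a + b) (\<lambda>x. f x + h x)"
    and near_scale: "\<And>a c f. near a f \<Longrightarrow> near (\<bar>c\<bar> * a) (\<lambda>x. c * f x)"
    and near_mono: "\<And>a b f. near a f \<Longrightarrow> a \<le> b \<Longrightarrow> near b f"
    and near_dominated: "\<And>c k f. f \<in> borel_measurable \<rho> \<Longrightarrow> 0 \<le> c \<Longrightarrow>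
        (\<And>x. \<bar>f x\<bar> \<le> c * \<bar>y x ^ k * v x\<bar>) \<Longrightarrow> near (c * M k) f"
    and near_start: "\<And>k e. 0 < e \<Longrightarrow> near e (\<lambda>x. y x ^ k * v x)"
    and M_pos: "\<And>k. 0 < M k"
    and M_log_convex: "\<And>k. (M (Suc k))\<^sup>2 \<le> M k * M (Suc (Suc k))"
    and M_divergent: "\<not> summable (\<lambda>k. M k / M (Suc k))"
begin

lemma near_sum:
  assumes "finite I" "\<And>i. i \<in> I \<Longrightarrow> near (a i) (f i)"
  shows "near (\<Sum>i\<in>I. a i) (\<lambda>x. \<Sum>i\<in>I. f i x)"
  using assms
proof (induction I rule: finite_induct)
  case empty
  have "near (0 * M 0) (\<lambda>x. 0)" by (rule near_dominated) auto
  then show ?case by simp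
qed (auto intro: near_add)

lemma M_ratio_mono: "M (Suc k) / M k \<le> M (Suc n) / M n" if "k \<le> n"
  using that
proof (induction n rule: dec_induct)
  case (step n)
  have "M (Suc n) / M n \<le> M (Suc (Suc n)) / M (Suc n)"
    using M_log_convex[of n] M_pos[of n] M_pos[of "Suc n"]
    by (simp add: field_simps power2_eq_square)
  with step.IH show ?case by simp
qed simp

lemma M_add_le: "M (k + i) \<le> M k * (M (Suc n) / M n) ^ i" if "k + i \<le> Suc n"
  using that
proof (induction i)
  case (Suc i)
  have "M (k + Suc i) = M (k + i) * (M (Suc (k + i)) / M (k + i))"
    using M_pos[of "k + i"] by simp
  also have "\<dots> \<le> (M k * (M (Suc n) / M n) ^ i) * (M (Suc n) / M n)"
    using Suc M_ratio_mono[of "k + i" n]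
    by (intro mult_mono) (auto intro!: divide_nonneg_nonneg mult_nonneg_nonneg zero_le_power less_imp_le[OF M_pos])
  finally show ?case by (simp add: mult_ac)
qed simp

text \<open>
  For a smooth function \<open>F\<close> with derivatives bounded by \<open>M\<close>, Bang considers the condition
  \<open>\<bar>F\<^sup>(\<^sup>k\<^sup>)(l)\<bar> \<le> e\<^sup>k\<^sup>-\<^sup>n M k\<close> for all \<open>k\<close>.  Here the \<open>k\<close>-th derivative of \<open>v cos(l y + \<phi>)\<close> with respect to \<open>l\<close> is
  \<open>y\<^sup>k v cos(l y + \<phi> + k \<pi> / 2)\<close>, and its absolute value is replaced by its distance; quantifying over
  all phases \<open>\<phi>\<close> absorbs the shift.  The condition is trivial for \<open>k \<ge> n\<close>.
\<close>

definition close_at :: "nat \<Rightarrow> real \<Rightarrow> bool" where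
  "close_at n l \<longleftrightarrow>
    (\<forall>k \<phi>. near (exp (real k - real n) * M k) (\<lambda>x. y x ^ k * v x * cos (l * y x + \<phi>)))"

lemma close_at_zero: "close_at n 0"
  unfolding close_at_def
proof (intro allI)
  fix k \<phi>
  have "near (\<bar>cos \<phi>\<bar> * (exp (real k - real n) * M k)) (\<lambda>x. cos \<phi> * (y x ^ k * v x))"
    by (intro near_scale near_start) (simp add: M_pos)
  moreover have "\<bar>cos \<phi>\<bar> * (exp (real k - real n) * M k) \<le> 1 * (exp (real k - real n) * M k)"
    using less_imp_le[OF M_pos[of k]] by (intro mult_right_mono) auto
  ultimately show "near (exp (real k - real n) * M k) (\<lambda>x. y x ^ k * v x * cos (0 * y x + \<phi>))"
    by (auto simp: mult_ac intro: near_mono)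
qed

lemma near_trivial: "near (M k) (\<lambda>x. y x ^ k * v x * cos (l * y x + \<phi>))"
proof -
  have "near (1 * M k) (\<lambda>x. y x ^ k * v x * cos (l * y x + \<phi>))"
  proof (rule near_dominated)
    fix x
    have "\<bar>y x ^ k * v x\<bar> * \<bar>cos (l * y x + \<phi>)\<bar> \<le> \<bar>y x ^ k * v x\<bar> * 1"
      by (intro mult_left_mono) auto
    then show "\<bar>y x ^ k * v x * cos (l * y x + \<phi>)\<bar> \<le> 1 * \<bar>y x ^ k * v x\<bar>"
      by (simp add: abs_mult)
  qed auto
  then show ?thesis by simp
qed

text \<open>
  A step of length \<open>h \<le> M n / (e M (n + 1))\<close> loses only one unit of \<open>n\<close>.  Expand the \<open>k\<close>-th derivative
  around \<open>l\<close> up to order \<open>m = n + 1 - k\<close>.  By logarithmic convexity \<open>M (k + i) \<le> M k q\<^sup>i\<close> with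
  \<open>q = M (n + 1) / M n\<close>, so the \<open>i\<close>-th term has distance at most \<open>e\<^sup>k\<^sup>-\<^sup>n\<^sup>-\<^sup>1 M k (e h q)\<^sup>i / i!\<close>; the remainder
  is estimated trivially and obeys the same bound with \<open>i = m\<close>.  Since \<open>e h q \<le> 1\<close>, the exponential
  series contributes at most a factor \<open>e\<close>.
\<close>

lemma close_at_step:
  assumes l: "close_at (Suc n) l" and h: "0 \<le> h" "h \<le> M n / M (Suc n) / exp 1"
  shows "close_at n (l + h)"
  unfolding close_at_def
proof (intro allI)
  fix k \<phi>
  show "near (exp (real k - real n) * M k) (\<lambda>x. y x ^ k * v x * cos ((l + h) * y x + \<phi>))"
  proof (cases "k \<le> n")
    case False
    then have "1 * M k \<le> exp (real k - real n) * M k"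
      using M_pos[of k] by (intro mult_right_mono) auto
    then show ?thesis by (intro near_mono[OF near_trivial]) simp
  next
    case True
    define m where "m = Suc n - k"
    have km: "k + m = Suc n" using True by (simp add: m_def)
    define q where "q = M (Suc n) / M n"
    have q: "q > 0" using M_pos by (simp add: q_def)
    define U where "U i \<psi> x = y x ^ i * v x * cos (l * y x + \<psi>)" for i \<psi> x
    define R where "R x = y x ^ k * v x * cos ((l + h) * y x + \<phi>)
        - (\<Sum>i<m. h ^ i / fact i * U (k + i) (\<phi> + real i * pi / 2) x)" for x
    define E where "E = exp (real k - real (Suc n)) * M k"
    have taylor_term: "near (E * ((exp 1 * h * q) ^ i / fact i)) (\<lambda>x. h ^ i / fact i * U (k + i) (\<phi> + real i * pi / 2) x)"
      if "i < m" for i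
    proof -
      have "near (\<bar>h ^ i / fact i\<bar> * (exp (real (k + i) - real (Suc n)) * M (k + i)))
          (\<lambda>x. h ^ i / fact i * U (k + i) (\<phi> + real i * pi / 2) x)"
        using l[unfolded close_at_def, rule_format, of "k + i" "\<phi> + real i * pi / 2"]
        unfolding U_def by (intro near_scale) simp
      moreover have "\<bar>h ^ i / fact i\<bar> * (exp (real (k + i) - real (Suc n)) * M (k + i))
          \<le> h ^ i / fact i * (exp (real (k + i) - real (Suc n)) * (M k * q ^ i))"
        using h that km unfolding q_def
        by (intro mult_mono mult_left_mono M_add_le) (auto intro!: mult_nonneg_nonneg less_imp_le[OF M_pos])
      moreover have "exp (real (k + i) - real (Suc n)) = exp (real k - real (Suc n)) * exp 1 ^ i"
        by (simp add: exp_of_nat_mult[symmetric] exp_add[symmetric])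
      ultimately show ?thesis
        by (elim near_mono) (simp add: E_def power_mult_distrib mult_ac)
    qed
    have rest: "near (E * ((exp 1 * h * q) ^ m / fact m)) R"
    proof -
      have "near (h ^ m / fact m * M (k + m)) R"
      proof (rule near_dominated)
        show "R \<in> borel_measurable \<rho>" unfolding R_def U_def by measurable
        show "0 \<le> h ^ m / fact m" using h by simp
        fix x
        have "R x = y x ^ k * v x * (cos ((l * y x + \<phi>) + h * y x)
            - (\<Sum>i<m. (h * y x) ^ i / fact i * cos ((l * y x + \<phi>) + real i * pi / 2)))"
          unfolding R_def U_def right_diff_distrib sum_distrib_left power_add power_mult_distrib
          by (intro arg_cong2[where f = "(-)"] sum.cong refl) (simp_all add: algebra_simps)
        also have "\<bar>\<dots>\<bar> \<le> \<bar>y x ^ k * v x\<bar> * (\<bar>h * y x\<bar> ^ m / fact m)"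
          unfolding abs_mult[of "y x ^ k * v x"]
          by (intro mult_left_mono cos_taylor_remainder) auto
        also have "\<dots> = h ^ m / fact m * \<bar>y x ^ (k + m) * v x\<bar>"
          using h by (simp add: abs_mult power_abs power_mult_distrib power_add)
        finally show "\<bar>R x\<bar> \<le> h ^ m / fact m * \<bar>y x ^ (k + m) * v x\<bar>" .
      qed
      moreover have "h ^ m / fact m * M (k + m) \<le> h ^ m / fact m * (M k * q ^ m)"
        using h km unfolding q_def by (intro mult_left_mono M_add_le) auto
      moreover have "exp (real k - real (Suc n)) * exp 1 ^ m = 1"
        using km by (simp add: exp_of_nat_mult[symmetric] exp_add[symmetric] m_def True)
      then have "E * ((exp 1 * h * q) ^ m / fact m) = h ^ m / fact m * (M k * q ^ m)"
        unfolding E_def power_mult_distrib by (simp add: mult_ac)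
      ultimately show ?thesis by (elim near_mono) simp
    qed
    have "near ((\<Sum>i<m. E * ((exp 1 * h * q) ^ i / fact i)) + E * ((exp 1 * h * q) ^ m / fact m))
        (\<lambda>x. (\<Sum>i<m. h ^ i / fact i * U (k + i) (\<phi> + real i * pi / 2) x) + R x)"
      by (intro near_add near_sum taylor_term rest) auto
    then have "near (E * (\<Sum>i<Suc m. (exp 1 * h * q) ^ i / fact i))
        (\<lambda>x. y x ^ k * v x * cos ((l + h) * y x + \<phi>))"
      by (simp add: R_def sum_distrib_left distrib_left)
    moreover have "E * (\<Sum>i<Suc m. (exp 1 * h * q) ^ i / fact i) \<le> exp (real k - real n) * M k"
    proof -
      have z: "0 \<le> exp 1 * h * q" "exp 1 * h * q \<le> 1"
        using h q M_pos[of n] M_pos[of "Suc n"] by (auto simp: q_def field_simps)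
      have s: "(\<lambda>i. (exp 1 * h * q) ^ i / fact i) sums exp (exp 1 * h * q)"
        using exp_converges[of "exp 1 * h * q"] by (simp add: field_simps)
      have "(\<Sum>i<Suc m. (exp 1 * h * q) ^ i / fact i) \<le> exp (exp 1 * h * q)"
        unfolding sums_unique[OF s] using sums_summable[OF s] zero_le_power[OF z(1)]
        by (intro sum_le_suminf) auto
      also have "\<dots> \<le> exp 1" using z by simp
      finally have "E * (\<Sum>i<Suc m. (exp 1 * h * q) ^ i / fact i) \<le> E * exp 1"
        using M_pos[of k] by (intro mult_left_mono) (auto simp: E_def)
      also have "\<dots> = exp (real k - real n) * M k"
        by (simp add: E_def exp_add[symmetric] mult.commute mult.left_commute)
      finally show ?thesis .
    qed
    ultimately show ?thesis by (rule near_mono)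
  qed
qed

text \<open>
  Start at \<open>l = 0\<close> with the index \<open>n + d\<close>, where the condition holds for every index, and take \<open>d\<close> steps of
  maximal length down to the index \<open>n\<close>.
\<close>

lemma close_at_reach:
  "0 \<le> l \<Longrightarrow> l \<le> (\<Sum>i<d. M (n + i) / M (Suc (n + i)) / exp 1) \<Longrightarrow> close_at n l"
proof (induction d arbitrary: n l)
  case 0
  then show ?case using close_at_zero by simp
next
  case (Suc d)
  define a where "a = M n / M (Suc n) / exp 1"
  have "a > 0" using M_pos by (simp add: a_def)
  (* The last step of the chain covers at most a; the maximum handles targets that are closer
     than one full step. *)
  define l' where "l' = max 0 (l - a)"
  have "l \<le> a + (\<Sum>i<d. M (Suc n + i) / M (Suc (Suc n + i)) / exp 1)"
    using Suc.prems(2) unfolding sum.lessThan_Suc_shift by (simp add: a_def)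
  moreover have "0 \<le> (\<Sum>i<d. M (Suc n + i) / M (Suc (Suc n + i)) / exp 1)"
    by (intro sum_nonneg divide_nonneg_nonneg less_imp_le[OF M_pos]) simp
  ultimately have "close_at (Suc n) l'"
    by (intro Suc.IH) (auto simp: l'_def)
  then have "close_at n (l' + (l - l'))"
    by (rule close_at_step) (use Suc.prems(1) \<open>a > 0\<close> in \<open>auto simp: l'_def a_def[symmetric] simp del: divide_divide_eq_left\<close>)
  then show ?case by simp
qed

text \<open>
  The Denjoy-Carleman theorem for distances: the total length of the steps from index \<open>\<infinity>\<close> down to \<open>n\<close>
  is infinite, so \<open>close_at n l\<close> holds for every \<open>n\<close>, and its instance \<open>k = 0\<close> bounds the distance by
  \<open>e\<^sup>-\<^sup>n M 0\<close>.
\<close>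

theorem near_cos:
  assumes "0 \<le> l" "0 < e"
  shows "near e (\<lambda>x. v x * cos (l * y x + \<phi>))"
proof -
  obtain n where "M 0 / e < real n"
    using reals_Archimedean2 by blast
  also have "real n < exp (real n)"
    using exp_ge_add_one_self[of "real n"] by linarith
  finally have n: "M 0 / e < exp (real n)" .
  have "\<exists>d. l \<le> (\<Sum>i<d. M (n + i) / M (Suc (n + i)) / exp 1)"
  proof (rule ccontr)
    assume "\<nexists>d. l \<le> (\<Sum>i<d. M (n + i) / M (Suc (n + i)) / exp 1)"
    then have "summable (\<lambda>i. M (n + i) / M (Suc (n + i)) / exp 1)"
      by (intro summableI_nonneg_bounded[where x = l])
        (auto simp: not_le less_imp_le M_pos)
    from summable_mult[OF this, of "exp 1"] have "summable (\<lambda>i. M (i + n) / M (Suc (i + n)))"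
      by (simp add: add.commute)
    then show False
      using M_divergent summable_iff_shift[of "\<lambda>k. M k / M (Suc k)" n] by simp
  qed
  then have "close_at n l" using close_at_reach assms(1) by blast
  then have "near (exp (real 0 - real n) * M 0) (\<lambda>x. y x ^ 0 * v x * cos (l * y x + \<phi>))"
    unfolding close_at_def by blast
  moreover have "exp (real 0 - real n) * M 0 \<le> e"
    using n \<open>0 < e\<close> by (simp add: exp_minus field_simps)
  ultimately show ?thesis by (auto elim: near_mono)
qed

end

section \<open>Localisation under the Carleman condition\<close>

text \<open>
  Carleman's condition for one real function \<open>y\<close>.  The summand \<open>1\<close> has the effect of adding a unit mass
  at a point with \<open>y = 1\<close>: it does not affect the divergence, but makes all moments positive and
  bounded away from \<open>0\<close>.
\<close>

definition carleman_condition :: "'a measure \<Rightarrow> ('a \<Rightarrow> real) \<Rightarrow> bool" where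
  "carleman_condition \<nu> y \<longleftrightarrow>
    \<not> summable (\<lambda>d. (1 + (\<integral>x. y x ^ (2 * Suc d) \<partial>\<nu>)) powr (- 1 / real (2 * Suc d)))"

locale polynomial_moments = finite_measure \<nu> for \<nu> :: "'a::euclidean_space measure" +
  assumes sets_borel [measurable_cong]: "sets \<nu> = sets borel"
    and integrable_polynomial: "real_polynomial_function p \<Longrightarrow> integrable \<nu> p"
begin

lemma measurable_polynomial: "real_polynomial_function p \<Longrightarrow> p \<in> borel_measurable borel"
  by (simp add: borel_measurable_continuous_onI continuous_on_polymonial_function real_polynomial_function_eq)

lemma even_moment_nonneg: "0 \<le> (\<integral>x. (y x :: real) ^ (2 * k) \<partial>\<nu>)"
  by (simp add: power_mult)

text \<open>
  The square roots of the even moments of \<open>\<nu>\<close>, increased by a unit point mass, bound \<open>\<parallel>y\<^sup>d\<parallel>\<close> in \<open>L\<^sup>2(\<nu>)\<close>.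
\<close>

definition carleman_bound :: "('a \<Rightarrow> real) \<Rightarrow> nat \<Rightarrow> real" where
  "carleman_bound y d = sqrt (1 + (\<integral>x. y x ^ (2 * d) \<partial>\<nu>))"

lemma carleman_bound_ge_1: "1 \<le> carleman_bound y d"
  unfolding carleman_bound_def by (simp add: power_mult)

lemma carleman_bound_log_convex:
  assumes y: "real_polynomial_function y"
  shows "(carleman_bound y (n + i))\<^sup>2 \<le> carleman_bound y n * carleman_bound y (n + 2 * i)"
proof -
  note [measurable] = measurable_polynomial[OF y]
  have int: "integrable \<nu> (\<lambda>x. y x ^ k)" for k
    using y by (intro integrable_polynomial) auto
  define a where "a = sqrt (\<integral>x. y x ^ (2 * n) \<partial>\<nu>)"
  define b where "b = sqrt (\<integral>x. y x ^ (2 * (n + 2 * i)) \<partial>\<nu>)"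
  have ab: "a \<ge> 0" "b \<ge> 0" "a\<^sup>2 = (\<integral>x. y x ^ (2 * n) \<partial>\<nu>)"
      "b\<^sup>2 = (\<integral>x. y x ^ (2 * (n + 2 * i)) \<partial>\<nu>)"
    by (simp_all only: a_def b_def real_sqrt_pow2 even_moment_nonneg real_sqrt_ge_zero)
  have "\<bar>\<integral>x. y x ^ n * y x ^ (n + 2 * i) \<partial>\<nu>\<bar> \<le> a * b"
    using integral_Cauchy_Schwarz[of "\<lambda>x. y x ^ n" \<nu> "\<lambda>x. y x ^ (n + 2 * i)"] int
    unfolding a_def b_def by (simp add: power_mult[symmetric] mult.commute)
  moreover have "(\<lambda>x. y x ^ n * y x ^ (n + 2 * i)) = (\<lambda>x. y x ^ (2 * (n + i)))"
    by (simp add: power_add[symmetric] mult_2 add_ac)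
  ultimately have le: "(\<integral>x. y x ^ (2 * (n + i)) \<partial>\<nu>) \<le> a * b" by simp
  have "(carleman_bound y (n + i))\<^sup>2 = 1 + (\<integral>x. y x ^ (2 * (n + i)) \<partial>\<nu>)"
    unfolding carleman_bound_def
    by (rule real_sqrt_pow2) (use even_moment_nonneg[of y "n + i"] in linarith)
  also have "\<dots> \<le> 1 + a * b" using le by simp
  also have "\<dots> \<le> sqrt ((1 + a\<^sup>2) * (1 + b\<^sup>2))"
  proof (rule real_le_rsqrt)
    have "(1 + a\<^sup>2) * (1 + b\<^sup>2) - (1 + a * b)\<^sup>2 = (a - b)\<^sup>2"
      by (simp add: power2_eq_square algebra_simps)
    then show "(1 + a * b)\<^sup>2 \<le> (1 + a\<^sup>2) * (1 + b\<^sup>2)"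
      by (metis diff_ge_0_iff_ge zero_le_power2)
  qed
  also have "\<dots> = carleman_bound y n * carleman_bound y (n + 2 * i)"
    unfolding carleman_bound_def ab by (rule real_sqrt_mult)
  finally show ?thesis .
qed

text \<open>
  The sequence that serves as \<open>M\<close> in Bang's argument: fourth roots of the moments of order \<open>4 k\<close>.
\<close>

lemma carleman_bound_divergent:
  assumes y: "real_polynomial_function y" and "carleman_condition \<nu> y"
  shows "\<not> summable (\<lambda>k. sqrt (carleman_bound y (2 * k)) / sqrt (carleman_bound y (2 * Suc k)))"
proof (rule not_summable_ratio_sqrt_even)
  show pos: "0 < carleman_bound y n" for n
    using carleman_bound_ge_1[of y n] by linarith
  show "(carleman_bound y (Suc n))\<^sup>2 \<le> carleman_bound y n * carleman_bound y (Suc (Suc n))" for n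
    using carleman_bound_log_convex[OF y, of n 1] by simp
  have "carleman_bound y (Suc n) powr (- 1 / (real n + 1))
      = (1 + (\<integral>x. y x ^ (2 * Suc n) \<partial>\<nu>)) powr (- 1 / real (2 * Suc n))" for n
  proof -
    have "0 \<le> 1 + (\<integral>x. y x ^ (2 * Suc n) \<partial>\<nu>)"
      using even_moment_nonneg[of y "Suc n"] by linarith
    then show ?thesis
      unfolding carleman_bound_def
      by (subst powr_half_sqrt[symmetric]) (simp_all add: powr_powr add.commute del: power_Suc)
  qed
  then show "\<not> summable (\<lambda>n. carleman_bound y n / carleman_bound y (Suc n))"
    using assms(2) unfolding carleman_condition_def
    by (intro not_summable_ratio pos carleman_bound_ge_1) simp
qed

end

locale carleman_weight = polynomial_moments \<nu> for \<nu> :: "'a::euclidean_space measure" +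
  fixes G :: "'a \<Rightarrow> real"
  assumes G: "real_polynomial_function G"
    and carleman: "b \<in> Basis \<Longrightarrow> carleman_condition \<nu> (\<lambda>x. x \<bullet> b)"
begin

text \<open>
  Replacing \<open>r\<^sup>2\<close> by \<open>u\<^sup>2\<close> in \<open>\<integral> r\<^sup>2 G d\<nu>\<close> is controlled by the distance of \<open>r\<close> and \<open>u\<close> in \<open>L\<^sup>2\<close> of the measure
  \<open>\<bar>G\<bar> \<nu>\<close>.
\<close>

definition \<rho> where "\<rho> = density \<nu> (\<lambda>x. ennreal \<bar>G x\<bar>)"

lemma measurable_G [measurable]: "G \<in> borel_measurable borel"
  by (rule measurable_polynomial[OF G])

lemma sets_\<rho> [measurable_cong]: "sets \<rho> = sets borel"
  by (simp add: \<rho>_def sets_borel)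

lemma integrable_\<rho>:
  "f \<in> borel_measurable borel \<Longrightarrow> integrable \<rho> f \<longleftrightarrow> integrable \<nu> (\<lambda>x. \<bar>G x\<bar> * f x)"
  unfolding \<rho>_def by (subst integrable_density) (auto simp: measurable_cong_sets[OF sets_borel refl])

lemma integral_\<rho>:
  "f \<in> borel_measurable borel \<Longrightarrow> (\<integral>x. f x \<partial>\<rho>) = (\<integral>x. \<bar>G x\<bar> * f x \<partial>\<nu>)"
  unfolding \<rho>_def by (subst integral_density) (auto simp: measurable_cong_sets[OF sets_borel refl])

text \<open>
  Not only \<open>u\<close> but all products of \<open>u\<close> with polynomials are required to be limits of polynomials.
  This is the form in which the property is inherited when further cosine factors are multiplied
  to \<open>u\<close>.
\<close>

definition approximable :: "('a \<Rightarrow> real) \<Rightarrow> bool" where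
  "approximable u \<longleftrightarrow> u \<in> borel_measurable borel \<and> (\<forall>x. \<bar>u x\<bar> \<le> 1) \<and>
    (\<forall>q e. real_polynomial_function q \<longrightarrow> 0 < e \<longrightarrow> poly_close \<rho> e (\<lambda>x. q x * u x))"

lemma approximable_1: "approximable (\<lambda>x. 1)"
  unfolding approximable_def poly_close_def
proof (intro conjI allI impI)
  fix q :: "'a \<Rightarrow> real" and e :: real
  assume q: "real_polynomial_function q" and "0 < e"
  note [measurable] = measurable_polynomial[OF q]
  show "(\<lambda>x. q x * 1) \<in> borel_measurable \<rho>" by simp
  show "\<exists>p. real_polynomial_function p \<and> p \<in> borel_measurable \<rho> \<and>
      integrable \<rho> (\<lambda>x. (q x * 1 - p x)\<^sup>2) \<and> sqrt (\<integral>x. (q x * 1 - p x)\<^sup>2 \<partial>\<rho>) \<le> e"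
    using q \<open>0 < e\<close> by (intro exI[of _ q]) simp
qed auto

text \<open>
  Two applications of the Cauchy-Schwarz inequality separate the power of \<open>y\<close> from \<open>q\<close> and from the weight:
  \<open>\<integral> y\<^sup>2\<^sup>k q\<^sup>2 \<bar>G\<bar> d\<nu> \<le> (\<integral> y\<^sup>4\<^sup>k d\<nu>)\<^sup>1\<^sup>/\<^sup>2 (\<integral> q\<^sup>4 G\<^sup>2 d\<nu>)\<^sup>1\<^sup>/\<^sup>2\<close>.  Thus \<open>q\<close> and \<open>G\<close> only enter
  through a constant, which is increased by \<open>1\<close> to make it positive.
\<close>

lemma moment_domination:
  assumes y: "real_polynomial_function y" and q: "real_polynomial_function q"
  shows "\<exists>C>0. \<forall>c k f. f \<in> borel_measurable borel \<longrightarrow> 0 \<le> c \<longrightarrow> (\<forall>x. \<bar>f x\<bar> \<le> c * \<bar>y x ^ k * q x\<bar>) \<longrightarrow>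
    poly_close \<rho> (c * (C * sqrt (carleman_bound y (2 * k)))) f"
proof (intro exI[of _ "1 + sqrt (sqrt (\<integral>x. (q x ^ 2 * G x)\<^sup>2 \<partial>\<nu>))"] conjI allI impI)
  show "0 < 1 + sqrt (sqrt (\<integral>x. (q x ^ 2 * G x)\<^sup>2 \<partial>\<nu>))" by (simp add: add_pos_nonneg)
  fix c :: real and k and f :: "'a \<Rightarrow> real"
  assume [measurable]: "f \<in> borel_measurable borel" and c: "0 \<le> c" and f: "\<forall>x. \<bar>f x\<bar> \<le> c * \<bar>y x ^ k * q x\<bar>"
  note [measurable] = measurable_polynomial[OF y] measurable_polynomial[OF q]
  have pf: "real_polynomial_function (\<lambda>x. (y x ^ (2 * k))\<^sup>2)" "real_polynomial_function (\<lambda>x. (q x ^ 2 * G x)\<^sup>2)"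
    using y q G by (auto intro!: real_polynomial_function_power real_polynomial_function.intros(4))
  have prod: "integrable \<nu> (\<lambda>x. y x ^ (2 * k) * \<bar>q x ^ 2 * G x\<bar>)"
    using integrable_polynomial[OF pf(1)] integrable_polynomial[OF pf(2)]
    by (intro integrable_mult_L2) auto
  have bound: "\<bar>G x\<bar> * (f x)\<^sup>2 \<le> c\<^sup>2 * (y x ^ (2 * k) * \<bar>q x ^ 2 * G x\<bar>)" for x
  proof -
    have "(f x)\<^sup>2 \<le> (c * \<bar>y x ^ k * q x\<bar>)\<^sup>2"
      using f by (metis abs_ge_zero power2_abs power_mono)
    then have "\<bar>G x\<bar> * (f x)\<^sup>2 \<le> \<bar>G x\<bar> * (c * \<bar>y x ^ k * q x\<bar>)\<^sup>2" by (intro mult_left_mono) auto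
    also have "\<dots> = c\<^sup>2 * (y x ^ (2 * k) * \<bar>q x ^ 2 * G x\<bar>)"
      by (simp add: power_mult[symmetric] power_mult_distrib abs_mult mult_ac)
    finally show ?thesis .
  qed
  have f2: "integrable \<nu> (\<lambda>x. \<bar>G x\<bar> * (f x)\<^sup>2)"
    by (rule Bochner_Integration.integrable_bound[OF integrable_mult_right[OF prod, of "c\<^sup>2"]])
      (use bound in \<open>auto simp: abs_mult power_mult\<close>)
  have "(\<integral>x. (f x)\<^sup>2 \<partial>\<rho>) \<le> (\<integral>x. c\<^sup>2 * (y x ^ (2 * k) * \<bar>q x ^ 2 * G x\<bar>) \<partial>\<nu>)"
    unfolding integral_\<rho>[of "\<lambda>x. (f x)\<^sup>2", simplified] using f2 prod bound
    by (intro integral_mono) auto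
  also have "\<dots> \<le> c\<^sup>2 * (sqrt (\<integral>x. (y x ^ (2 * k))\<^sup>2 \<partial>\<nu>) * sqrt (\<integral>x. (q x ^ 2 * G x)\<^sup>2 \<partial>\<nu>))"
    using integral_Cauchy_Schwarz[of "\<lambda>x. y x ^ (2 * k)" \<nu> "\<lambda>x. \<bar>q x ^ 2 * G x\<bar>"]
      integrable_polynomial[OF pf(1)] integrable_polynomial[OF pf(2)]
    by (simp add: mult_left_mono)
  finally have "sqrt (\<integral>x. (f x)\<^sup>2 \<partial>\<rho>)
      \<le> sqrt (c\<^sup>2 * (sqrt (\<integral>x. (y x ^ (2 * k))\<^sup>2 \<partial>\<nu>) * sqrt (\<integral>x. (q x ^ 2 * G x)\<^sup>2 \<partial>\<nu>)))"
    by (rule real_sqrt_le_mono)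
  also have "\<dots> = c * (sqrt (sqrt (\<integral>x. (q x ^ 2 * G x)\<^sup>2 \<partial>\<nu>)) * sqrt (sqrt (\<integral>x. (y x ^ (2 * k))\<^sup>2 \<partial>\<nu>)))"
    using c by (simp add: real_sqrt_mult mult_ac)
  also have "\<dots> \<le> c * ((1 + sqrt (sqrt (\<integral>x. (q x ^ 2 * G x)\<^sup>2 \<partial>\<nu>))) * sqrt (carleman_bound y (2 * k)))"
  proof -
    have "carleman_bound y (2 * k) = sqrt (1 + (\<integral>x. (y x ^ (2 * k))\<^sup>2 \<partial>\<nu>))"
      by (simp add: carleman_bound_def power_mult[symmetric] mult.commute)
    then show ?thesis
      using c by (intro mult_left_mono mult_mono) auto
  qed
  finally show "poly_close \<rho> (c * ((1 + sqrt (sqrt (\<integral>x. (q x ^ 2 * G x)\<^sup>2 \<partial>\<nu>))) * sqrt (carleman_bound y (2 * k)))) f"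
    using f2 by (intro poly_close_norm) (auto simp: integrable_\<rho>)
qed

text \<open>
  Bang's argument for \<open>v = q u\<close>: the functions \<open>y\<^sup>k q u\<close> are limits of polynomials because \<open>u\<close> is
  approximable, and \<open>\<bar>u\<bar> \<le> 1\<close> keeps them dominated by the moments of \<open>\<nu>\<close>.
\<close>

lemma approximable_mult_cos:
  assumes u: "approximable u" and b: "b \<in> Basis" and l: "0 \<le> l"
  shows "approximable (\<lambda>x. u x * cos (l * (x \<bullet> b) + \<phi>))"
proof -
  define y where "y x = x \<bullet> b" for x
  have y: "real_polynomial_function y"
    unfolding y_def by (intro real_polynomial_function.intros(1) bounded_linear_inner_left)
  have [measurable]: "u \<in> borel_measurable borel" "y \<in> borel_measurable borel"
    using u measurable_polynomial[OF y] by (auto simp: approximable_def)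
  have u1: "\<bar>u x\<bar> \<le> 1" for x using u by (auto simp: approximable_def)
  have "poly_close \<rho> e (\<lambda>x. q x * (u x * cos (l * y x + \<phi>)))"
    if q: "real_polynomial_function q" and e: "0 < e" for q e
  proof -
    note [measurable] = measurable_polynomial[OF q]
    obtain C where C: "C > 0" and dom: "\<And>c k f. f \<in> borel_measurable borel \<Longrightarrow> 0 \<le> c \<Longrightarrow>
        (\<And>x. \<bar>f x\<bar> \<le> c * \<bar>y x ^ k * q x\<bar>) \<Longrightarrow> poly_close \<rho> (c * (C * sqrt (carleman_bound y (2 * k)))) f"
      using moment_domination[OF y q] by blast
    have pos: "0 < carleman_bound y k" for k using carleman_bound_ge_1[of y k] by linarith
    interpret quasianalytic_approximation \<rho> "poly_close \<rho>" y "\<lambda>x. q x * u x" "\<lambda>k. C * sqrt (carleman_bound y (2 * k))"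
    proof
      fix c k and f :: "'a \<Rightarrow> real"
      assume f: "f \<in> borel_measurable \<rho>" "0 \<le> c" "\<And>x. \<bar>f x\<bar> \<le> c * \<bar>y x ^ k * (q x * u x)\<bar>"
      show "poly_close \<rho> (c * (C * sqrt (carleman_bound y (2 * k)))) f"
      proof (rule dom)
        fix x
        have "\<bar>y x ^ k * q x\<bar> * \<bar>u x\<bar> \<le> \<bar>y x ^ k * q x\<bar> * 1" by (intro mult_left_mono u1) auto
        then have "c * \<bar>y x ^ k * (q x * u x)\<bar> \<le> c * \<bar>y x ^ k * q x\<bar>"
          using f(2) by (intro mult_left_mono) (auto simp: abs_mult mult.assoc)
        with f(3)[of x] show "\<bar>f x\<bar> \<le> c * \<bar>y x ^ k * q x\<bar>" by linarith
      qed (use f measurable_cong_sets[OF sets_\<rho> refl] in auto)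
    next
      fix k e assume "0 < (e::real)"
      moreover have "real_polynomial_function (\<lambda>x. y x ^ k * q x)" using y q by auto
      ultimately show "poly_close \<rho> e (\<lambda>x. y x ^ k * (q x * u x))"
        using u unfolding approximable_def mult.assoc[symmetric] by blast
    next
      fix k
      have "(sqrt (carleman_bound y (2 * Suc k)))\<^sup>2 = sqrt ((carleman_bound y (2 * k + 2))\<^sup>2)"
        using pos by (simp add: less_imp_le)
      also have "\<dots> \<le> sqrt (carleman_bound y (2 * k) * carleman_bound y (2 * k + 2 * 2))"
        by (intro real_sqrt_le_mono carleman_bound_log_convex y)
      finally have "(sqrt (carleman_bound y (2 * Suc k)))\<^sup>2
          \<le> sqrt (carleman_bound y (2 * k)) * sqrt (carleman_bound y (2 * Suc (Suc k)))"
        by (simp add: real_sqrt_mult numeral_eq_Suc)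
      then have "C\<^sup>2 * (sqrt (carleman_bound y (2 * Suc k)))\<^sup>2
          \<le> C\<^sup>2 * (sqrt (carleman_bound y (2 * k)) * sqrt (carleman_bound y (2 * Suc (Suc k))))"
        by (intro mult_left_mono) auto
      then show "(C * sqrt (carleman_bound y (2 * Suc k)))\<^sup>2
          \<le> C * sqrt (carleman_bound y (2 * k)) * (C * sqrt (carleman_bound y (2 * Suc (Suc k))))"
        by (simp only: power2_eq_square mult_ac)
    next
      have "carleman_condition \<nu> y" using carleman[OF b] by (simp add: y_def[abs_def])
      from carleman_bound_divergent[OF y this]
      show "\<not> summable (\<lambda>k. C * sqrt (carleman_bound y (2 * k)) / (C * sqrt (carleman_bound y (2 * Suc k))))"
        using C by simp
    qed (use C pos poly_close_add poly_close_scale poly_close_mono in auto)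
    from near_cos[OF l e] show ?thesis by (simp add: mult.assoc)
  qed
  moreover have "\<bar>u x * cos (l * y x + \<phi>)\<bar> \<le> 1" for x
    using mult_mono[OF u1[of x] abs_cos_le_one[of "l * y x + \<phi>"]] by (simp add: abs_mult)
  ultimately show ?thesis unfolding approximable_def y_def[symmetric] by auto
qed

lemma approximable_mult_cos_power:
  assumes "approximable u" "b \<in> Basis" "0 \<le> l"
  shows "approximable (\<lambda>x. u x * cos (l * (x \<bullet> b) + \<phi>) ^ k)"
proof (induction k)
  case (Suc k)
  from approximable_mult_cos[OF Suc assms(2,3), of \<phi>] show ?case by (simp add: mult_ac)
qed (use assms in simp)

lemma approximable_prod_cos:
  assumes "0 \<le> l"
  shows "approximable (\<lambda>x. \<Prod>b\<in>Basis. cos (l * ((x - a) \<bullet> b)) ^ k)"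
proof -
  have "approximable (\<lambda>x. \<Prod>b\<in>B. cos (l * ((x - a) \<bullet> b)) ^ k)" if "finite B" "B \<subseteq> Basis" for B
    using that
  proof (induction B rule: finite_induct)
    case empty
    then show ?case using approximable_1 by simp
  next
    case (insert b B)
    then have "approximable (\<lambda>x. (\<Prod>b\<in>B. cos (l * ((x - a) \<bullet> b)) ^ k) * cos (l * (x \<bullet> b) + (- l * (a \<bullet> b))) ^ k)"
      using assms by (intro approximable_mult_cos_power) auto
    then show ?case
      using insert by (simp add: inner_diff_left right_diff_distrib mult.commute)
  qed
  then show ?thesis by simp
qed

lemma integrable_G: "integrable \<nu> G"
  by (rule integrable_polynomial[OF G])

text \<open>
  If \<open>r\<close> has distance at most \<open>d\<close> from \<open>u\<close>, then
  \<open>\<bar>\<integral> (u\<^sup>2 - r\<^sup>2) G d\<nu>\<bar> \<le> \<parallel>u - r\<parallel> \<parallel>u + r\<parallel> \<le> d (2 \<parallel>u\<parallel> + d)\<close> in the norm of \<open>L\<^sup>2(\<rho>)\<close>.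
\<close>

lemma approximable_nonneg:
  assumes nonneg: "\<And>r. real_polynomial_function r \<Longrightarrow> 0 \<le> (\<integral>x. (r x)\<^sup>2 * G x \<partial>\<nu>)"
    and u: "approximable u"
  shows "0 \<le> (\<integral>x. (u x)\<^sup>2 * G x \<partial>\<nu>)"
proof (rule field_le_epsilon)
  fix e :: real assume e: "0 < e"
  have [measurable]: "u \<in> borel_measurable borel" and u1: "\<And>x. \<bar>u x\<bar> \<le> 1"
    using u by (auto simp: approximable_def)
  define c where "c = sqrt (\<integral>x. 4 * (u x)\<^sup>2 \<partial>\<rho>)"
  (* The final error is d (c + d), which is at most d (c + 1), and this is at most e. *)
  define d where "d = min 1 (e / (c + 1))"
  have c0: "0 \<le> c" by (simp add: c_def)
  have d: "0 < d" "d \<le> 1" using e c0 by (auto simp: d_def)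
  have "d \<le> e / (c + 1)" by (simp add: d_def)
  then have dc: "d * (c + 1) \<le> e" using c0 by (subst (asm) pos_le_divide_eq) auto
  have "poly_close \<rho> d (\<lambda>x. 1 * u x)"
    using u d(1) unfolding approximable_def by blast
  then obtain r where r: "real_polynomial_function r"
      and int: "integrable \<rho> (\<lambda>x. (u x - r x)\<^sup>2)" and le: "sqrt (\<integral>x. (u x - r x)\<^sup>2 \<partial>\<rho>) \<le> d"
    unfolding poly_close_def by auto
  note [measurable] = measurable_polynomial[OF r]
  have u2: "integrable \<nu> (\<lambda>x. \<bar>G x\<bar> * (u x)\<^sup>2)"
    using u1 by (intro Bochner_Integration.integrable_bound[OF integrable_G])
      (auto simp: abs_mult intro!: mult_left_le AE_I2 abs_square_le_1[THEN iffD2])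
  have u2G: "integrable \<nu> (\<lambda>x. (u x)\<^sup>2 * G x)"
    using u1 by (intro Bochner_Integration.integrable_bound[OF integrable_G])
      (auto simp: abs_mult intro!: mult_left_le_one_le AE_I2 abs_square_le_1[THEN iffD2])
  have r2G: "integrable \<nu> (\<lambda>x. (r x)\<^sup>2 * G x)"
    using r G by (intro integrable_polynomial real_polynomial_function.intros(4)) auto
  have int': "integrable \<rho> (\<lambda>x. (2 * u x)\<^sup>2)"
    using integrable_mult_right[OF u2, of 4]
    by (subst integrable_\<rho>) (auto simp: power_mult_distrib mult_ac)
  have eq: "2 * u x + - (u x - r x) = u x + r x" for x by simp
  have int2: "integrable \<rho> (\<lambda>x. (- (u x - r x))\<^sup>2)" using int by (simp only: power2_minus)
  have "(\<lambda>x. 2 * u x) \<in> borel_measurable \<rho>" "(\<lambda>x. - (u x - r x)) \<in> borel_measurable \<rho>"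
    by measurable
  note integral_Minkowski[OF this int' int2]
  then have sum: "integrable \<rho> (\<lambda>x. (u x + r x)\<^sup>2)" "sqrt (\<integral>x. (u x + r x)\<^sup>2 \<partial>\<rho>) \<le> c + d"
    using le unfolding eq power2_minus by (simp_all add: c_def power_mult_distrib)
  have "\<bar>(\<integral>x. (u x)\<^sup>2 * G x \<partial>\<nu>) - (\<integral>x. (r x)\<^sup>2 * G x \<partial>\<nu>)\<bar> = \<bar>\<integral>x. ((u x)\<^sup>2 * G x - (r x)\<^sup>2 * G x) \<partial>\<nu>\<bar>"
    using u2G r2G by simp
  also have "(\<integral>x. ((u x)\<^sup>2 * G x - (r x)\<^sup>2 * G x) \<partial>\<nu>) = (\<integral>x. (u x - r x) * (sgn (G x) * (u x + r x)) \<partial>\<rho>)"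
    by (subst integral_\<rho>) (auto simp: power2_eq_square algebra_simps abs_sgn intro!: Bochner_Integration.integral_cong)
  also have "\<bar>\<dots>\<bar> \<le> sqrt (\<integral>x. (u x - r x)\<^sup>2 \<partial>\<rho>) * sqrt (\<integral>x. (sgn (G x) * (u x + r x))\<^sup>2 \<partial>\<rho>)"
  proof (rule integral_Cauchy_Schwarz)
    show "integrable \<rho> (\<lambda>x. (sgn (G x) * (u x + r x))\<^sup>2)"
      by (rule Bochner_Integration.integrable_bound[OF sum(1)])
        (auto simp: power_mult_distrib sgn_real_def)
  qed (use int in auto)
  also have "(\<integral>x. (sgn (G x) * (u x + r x))\<^sup>2 \<partial>\<rho>) = (\<integral>x. (u x + r x)\<^sup>2 \<partial>\<rho>)"
    by (subst (1 2) integral_\<rho>) (auto simp: power_mult_distrib sgn_real_def intro!: Bochner_Integration.integral_cong)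
  also have "sqrt (\<integral>x. (u x - r x)\<^sup>2 \<partial>\<rho>) * sqrt (\<integral>x. (u x + r x)\<^sup>2 \<partial>\<rho>) \<le> d * (c + d)"
    using le sum(2) d(1) by (intro mult_mono) auto
  also have "\<dots> \<le> d * (c + 1)" using d by (intro mult_left_mono) auto
  also have "\<dots> \<le> e" by (rule dc)
  finally show "0 \<le> (\<integral>x. (u x)\<^sup>2 * G x \<partial>\<nu>) + e"
    using nonneg[OF r] by linarith
qed

text \<open>
  The products over the coordinates of \<open>cos(t (x\<^sub>b - a\<^sub>b) / \<surd>k)\<^sup>k\<close> are approximable, bounded by \<open>1\<close>, and
  converge to \<open>exp(- t\<^sup>2 \<parallel>x - a\<parallel>\<^sup>2 / 2)\<close>.
\<close>

lemma gaussian_nonneg: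
  assumes nonneg: "\<And>r. real_polynomial_function r \<Longrightarrow> 0 \<le> (\<integral>x. (r x)\<^sup>2 * G x \<partial>\<nu>)"
    and t: "0 \<le> t"
  shows "0 \<le> (\<integral>x. exp (- (t * norm (x - a))\<^sup>2) * G x \<partial>\<nu>)"
proof -
  define w where "w k x = (\<Prod>b\<in>Basis. cos (t / sqrt (real k) * ((x - a) \<bullet> b)) ^ k)" for k x
  have [measurable]: "w k \<in> borel_measurable borel" for k
    unfolding w_def by measurable
  have w1: "\<bar>w k x\<bar> \<le> 1" for k x
    unfolding w_def abs_prod by (intro prod_le_1) (auto simp: power_abs power_le_one)
  have lim: "(\<lambda>k. (w k x)\<^sup>2) \<longlonglongrightarrow> exp (- (t * norm (x - a))\<^sup>2)" for x
  proof -
    have "(\<lambda>k. w k x) \<longlonglongrightarrow> (\<Prod>b\<in>Basis. exp (- (t * ((x - a) \<bullet> b))\<^sup>2 / 2))"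
      unfolding w_def using cos_power_tendsto_gaussian[of "t * ((x - a) \<bullet> _)"]
      by (intro tendsto_prod) simp
    also have "(\<Prod>b\<in>Basis. exp (- (t * ((x - a) \<bullet> b))\<^sup>2 / 2)) = exp (- (t * norm (x - a))\<^sup>2 / 2)"
    proof -
      have "(\<Sum>b\<in>Basis. - (t * ((x - a) \<bullet> b))\<^sup>2 / 2) = - (t\<^sup>2 * (\<Sum>b\<in>Basis. ((x - a) \<bullet> b)\<^sup>2)) / 2"
        by (simp add: power_mult_distrib sum_distrib_left sum_negf sum_divide_distrib)
      also have "(\<Sum>b\<in>Basis. ((x - a) \<bullet> b)\<^sup>2) = (norm (x - a))\<^sup>2"
        unfolding power2_norm_eq_inner by (subst euclidean_inner) (simp add: power2_eq_square)
      finally show ?thesis by (simp add: exp_sum[symmetric] power_mult_distrib)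
    qed
    finally have "(\<lambda>k. w k x) \<longlonglongrightarrow> exp (- (t * norm (x - a))\<^sup>2 / 2)" .
    then have "(\<lambda>k. (w k x)\<^sup>2) \<longlonglongrightarrow> (exp (- (t * norm (x - a))\<^sup>2 / 2))\<^sup>2"
      by (rule tendsto_power)
    then show ?thesis by (simp add: exp_double[symmetric])
  qed
  have "(\<lambda>k. \<integral>x. (w k x)\<^sup>2 * G x \<partial>\<nu>) \<longlonglongrightarrow> (\<integral>x. exp (- (t * norm (x - a))\<^sup>2) * G x \<partial>\<nu>)"
  proof (rule integral_dominated_convergence[where w = "\<lambda>x. \<bar>G x\<bar>"])
    show "AE x in \<nu>. (\<lambda>k. (w k x)\<^sup>2 * G x) \<longlonglongrightarrow> exp (- (t * norm (x - a))\<^sup>2) * G x"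
      by (intro AE_I2 tendsto_mult_right lim)
    show "AE x in \<nu>. norm ((w k x)\<^sup>2 * G x) \<le> \<bar>G x\<bar>" for k
      using w1 by (auto simp: abs_mult intro!: mult_left_le_one_le abs_square_le_1[THEN iffD2])
  qed (use integrable_G in auto)
  moreover have "0 \<le> (\<integral>x. (w k x)\<^sup>2 * G x \<partial>\<nu>)" for k
    unfolding w_def by (rule approximable_nonneg[OF nonneg approximable_prod_cos]) (use t in auto)
  ultimately show ?thesis by (intro LIMSEQ_le_const) auto
qed

text \<open>
  If \<open>G a < 0\<close>, then \<open>G \<le> G a / 2\<close> on some ball of radius \<open>r\<close> around \<open>a\<close>, and the ball of radius \<open>r / 2\<close>
  has positive mass.  Testing with the Gaussian of width \<open>1 / t\<close> at \<open>a\<close>, the smaller ball contributes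
  at most a negative multiple of \<open>exp(- t\<^sup>2 r\<^sup>2 / 4)\<close>, the rest of the larger ball
  contributes nothing positive, and everything outside it contributes at most a multiple of \<open>exp(- t\<^sup>2 r\<^sup>2)\<close>; for large \<open>t\<close> the integral is negative.
\<close>

theorem nonneg_on_support:
  assumes nonneg: "\<And>r. real_polynomial_function r \<Longrightarrow> 0 \<le> (\<integral>x. (r x)\<^sup>2 * G x \<partial>\<nu>)"
    and a: "a \<in> measure_support \<nu>"
  shows "0 \<le> G a"
proof (rule ccontr)
  assume "\<not> 0 \<le> G a"
  then have neg: "G a < G a / 2" by simp
  have "isCont G a"
    using G continuous_on_polymonial_function[of G UNIV]
    by (simp add: real_polynomial_function_eq continuous_on_eq_continuous_at)
  then have "eventually (\<lambda>x. G x < G a / 2) (nhds a)"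
    using neg order_tendstoD(2)[of G "G a" "nhds a"] isCont_def tendsto_at_iff_tendsto_nhds by blast
  then obtain r where r: "0 < r" and Gr: "\<And>x. dist x a < r \<Longrightarrow> G x < G a / 2"
    unfolding eventually_nhds_metric by blast
  define m where "m = measure \<nu> (ball a (r / 2))"
  have "emeasure \<nu> (ball a (r / 2)) > 0"
    using a r unfolding measure_support_def by (auto simp: centre_in_ball)
  then have m: "0 < m" unfolding m_def by (simp add: emeasure_eq_measure)
  define I where "I = (\<integral>x. \<bar>G x\<bar> \<partial>\<nu>)"
  have key: "m * \<bar>G a\<bar> / 2 * exp (- (t * (r / 2))\<^sup>2) \<le> exp (- (t * r)\<^sup>2) * I" if t: "0 \<le> t" for t
  proof -
    have bound: "exp (- (t * norm (x - a))\<^sup>2) * G x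
        \<le> exp (- (t * (r / 2))\<^sup>2) * (G a / 2) * indicator (ball a (r / 2)) x + exp (- (t * r)\<^sup>2) * \<bar>G x\<bar>" for x
    proof (cases "dist x a < r")
      case False
      then have "exp (- (t * norm (x - a))\<^sup>2) \<le> exp (- (t * r)\<^sup>2)"
        using t r by (auto simp: dist_norm intro!: power_mono mult_left_mono)
      then have "exp (- (t * norm (x - a))\<^sup>2) * \<bar>G x\<bar> \<le> exp (- (t * r)\<^sup>2) * \<bar>G x\<bar>"
        by (intro mult_right_mono) auto
      moreover have "exp (- (t * norm (x - a))\<^sup>2) * G x \<le> exp (- (t * norm (x - a))\<^sup>2) * \<bar>G x\<bar>"
        by (intro mult_left_mono) auto
      ultimately have "exp (- (t * norm (x - a))\<^sup>2) * G x \<le> exp (- (t * r)\<^sup>2) * \<bar>G x\<bar>"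
        by linarith
      moreover have "x \<notin> ball a (r / 2)" using False r by (auto simp: dist_commute)
      ultimately show ?thesis by simp
    next
      case True
      then have Gx: "G x < G a / 2" by (rule Gr)
      then have Gx0: "G x < 0" using neg by linarith
      show ?thesis
      proof (cases "x \<in> ball a (r / 2)")
        case True
        then have "norm (x - a) \<le> r / 2" by (simp add: dist_norm norm_minus_commute)
        then have "(t * norm (x - a))\<^sup>2 \<le> (t * (r / 2))\<^sup>2"
          using t by (intro power_mono mult_left_mono) auto
        then have "exp (- (t * (r / 2))\<^sup>2) \<le> exp (- (t * norm (x - a))\<^sup>2)" by simp
        then have "exp (- (t * norm (x - a))\<^sup>2) * G x \<le> exp (- (t * (r / 2))\<^sup>2) * G x"
          using Gx0 by (intro mult_right_mono_neg) auto
        also have "\<dots> \<le> exp (- (t * (r / 2))\<^sup>2) * (G a / 2)"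
          using Gx by (intro mult_left_mono) auto
        finally show ?thesis using True by (simp add: add_increasing2)
      next
        case False
        have "exp (- (t * norm (x - a))\<^sup>2) * G x \<le> 0" using Gx0 by (simp add: mult_nonneg_nonpos)
        then show ?thesis using False by (simp add: order_trans)
      qed
    qed
    have int1: "integrable \<nu> (\<lambda>x. exp (- (t * norm (x - a))\<^sup>2) * G x)"
      by (rule Bochner_Integration.integrable_bound[OF integrable_G])
        (auto simp: abs_mult intro!: mult_left_le_one_le)
    have int2: "integrable \<nu> (\<lambda>x. exp (- (t * (r / 2))\<^sup>2) * (G a / 2) * indicator (ball a (r / 2)) x + exp (- (t * r)\<^sup>2) * \<bar>G x\<bar>)"
      using integrable_G by (intro Bochner_Integration.integrable_add integrable_mult_right integrable_real_indicator)
        (auto simp: sets_borel emeasure_eq_measure)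
    have "0 \<le> (\<integral>x. exp (- (t * norm (x - a))\<^sup>2) * G x \<partial>\<nu>)" by (rule gaussian_nonneg[OF nonneg t])
    also have "\<dots> \<le> (\<integral>x. exp (- (t * (r / 2))\<^sup>2) * (G a / 2) * indicator (ball a (r / 2)) x + exp (- (t * r)\<^sup>2) * \<bar>G x\<bar> \<partial>\<nu>)"
      by (intro integral_mono int1 int2 bound)
    also have "\<dots> = exp (- (t * (r / 2))\<^sup>2) * (G a / 2) * m + exp (- (t * r)\<^sup>2) * I"
      using integrable_G by (subst Bochner_Integration.integral_add)
        (auto simp: sets_borel emeasure_eq_measure m_def I_def)
    finally show ?thesis using neg by (simp add: mult_ac)
  qed
  have "(\<lambda>n::nat. exp (- ((3 / 4) * (real n * r)\<^sup>2)) * I) \<longlonglongrightarrow> 0 * I"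
    using r by (intro tendsto_mult_right) real_asymp
  moreover have "m * \<bar>G a\<bar> / 2 \<le> exp (- ((3 / 4) * (real n * r)\<^sup>2)) * I" for n :: nat
  proof -
    have "m * \<bar>G a\<bar> / 2 = (m * \<bar>G a\<bar> / 2 * exp (- (real n * (r / 2))\<^sup>2)) * exp ((real n * (r / 2))\<^sup>2)"
      by (simp add: exp_minus)
    also have "\<dots> \<le> (exp (- (real n * r)\<^sup>2) * I) * exp ((real n * (r / 2))\<^sup>2)"
      by (intro mult_right_mono key) auto
    also have "\<dots> = exp (- (real n * r)\<^sup>2 + (real n * (r / 2))\<^sup>2) * I"
      by (simp only: exp_add mult_ac)
    also have "- (real n * r)\<^sup>2 + (real n * (r / 2))\<^sup>2 = - ((3 / 4) * (real n * r)\<^sup>2)"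
      by (simp add: power2_eq_square field_simps)
    finally show ?thesis .
  qed
  ultimately have "m * \<bar>G a\<bar> / 2 \<le> 0 * I" by (intro LIMSEQ_le_const) auto
  moreover have "0 < m * \<bar>G a\<bar>" using m neg by (intro mult_pos_pos) auto
  ultimately show False by simp
qed

end

section \<open>Polynomials as functions and partial integration\<close>

abbreviation const_poly :: "real \<Rightarrow> 'v rpoly" where
  "const_poly c \<equiv> Poly_Mapping.single 0 c"

lemma sum_single_keys: "(\<Sum>\<alpha>\<in>Poly_Mapping.keys p. Poly_Mapping.single \<alpha> (Poly_Mapping.lookup p \<alpha>)) = p"
  by (rule poly_mapping_eqI) (auto simp: lookup_sum lookup_single when_def in_keys_iff if_distrib cong: if_cong)

lemma single_exponent_induct:
  fixes \<alpha> :: "'v exponent"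
  assumes const: "P (const_poly c)" and pvar: "\<And>p i. P p \<Longrightarrow> P (pvar i * p)"
  shows "P (Poly_Mapping.single \<alpha> c)"
proof (induction \<alpha> rule: Poly_Mapping.update_induct)
  case const
  then show ?case by (rule assms(1))
next
  case (update \<beta> i k)
  have eq: "Poly_Mapping.update i k \<beta> = Poly_Mapping.single i k + \<beta>"
    using update by (intro poly_mapping_eqI) (auto simp: Poly_Mapping.lookup_update lookup_add lookup_single when_def in_keys_iff)
  have "P (Poly_Mapping.single (Poly_Mapping.single i k + \<beta>) c)"
  proof (induction k)
    case 0
    then show ?case using update by simp
  next
    case (Suc k)
    have "Poly_Mapping.single (Poly_Mapping.single i (Suc k) + \<beta>) c
        = pvar i * Poly_Mapping.single (Poly_Mapping.single i k + \<beta>) c"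
      by (simp add: pvar_def mult_single single_add[symmetric] add.assoc[symmetric])
    then show ?case using Suc pvar by simp
  qed
  then show ?case by (simp add: eq)
qed

lemma rpoly_induct [case_names const add pvar]:
  assumes const: "\<And>c. P (const_poly c)" and add: "\<And>p q. P p \<Longrightarrow> P q \<Longrightarrow> P (p + q)"
    and pvar: "\<And>p i. P p \<Longrightarrow> P (pvar i * p)"
  shows "P p"
proof -
  have "P (\<Sum>\<alpha>\<in>A. Poly_Mapping.single \<alpha> (Poly_Mapping.lookup p \<alpha>))" if "finite A" for A
    using that
  proof (induction A rule: finite_induct)
    case empty
    then show ?case using const[of 0] by simp
  next
    case (insert \<alpha> A)
    have "P (Poly_Mapping.single \<alpha> (Poly_Mapping.lookup p \<alpha>))"
      by (rule single_exponent_induct[of P, OF const pvar])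
    with insert show ?case by (simp add: add)
  qed
  from this[of "Poly_Mapping.keys p"] show ?thesis by (simp add: sum_single_keys)
qed

lemma poly_eval_add [simp]: "poly_eval (p + q) x = poly_eval p x + poly_eval q x"
  by (simp add: poly_eval_riesz riesz_add)

lemma monom_eval_add: "monom_eval (\<alpha> + \<beta>) x = monom_eval \<alpha> x * monom_eval \<beta> x"
  by (simp add: monom_eval_def lookup_add power_add prod.distrib)

lemma poly_eval_const [simp]: "poly_eval (const_poly c) x = c"
  by (simp add: poly_eval_riesz monom_eval_def)

lemma poly_eval_0 [simp]: "poly_eval 0 x = 0" and poly_eval_1 [simp]: "poly_eval 1 x = 1"
  using poly_eval_const[of 0 x] poly_eval_const[of 1 x] by (simp_all del: poly_eval_const)

lemma poly_eval_pvar [simp]: "poly_eval (pvar i) x = x i"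
proof -
  have "(\<Prod>j\<in>UNIV. x j ^ (1 when i = j)) = (\<Prod>j\<in>UNIV. if j = i then x j else 1)"
    by (intro prod.cong) (auto simp: when_def)
  then show ?thesis by (simp add: pvar_def poly_eval_riesz monom_eval_def lookup_single)
qed

lemma poly_eval_mult [simp]: "poly_eval (p * q) x = poly_eval p x * poly_eval q x"
proof -
  have "p * q = (\<Sum>\<alpha>\<in>Poly_Mapping.keys p. \<Sum>\<beta>\<in>Poly_Mapping.keys q.
      Poly_Mapping.single (\<alpha> + \<beta>) (Poly_Mapping.lookup p \<alpha> * Poly_Mapping.lookup q \<beta>))"
    by (subst (1 2) sum_single_keys[symmetric]) (simp add: sum_product mult_single)
  then show ?thesis
    by (simp add: poly_eval_riesz riesz_sum monom_eval_add)
      (simp add: riesz_def sum_product mult_ac)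
qed

lemma poly_eval_uminus [simp]: "poly_eval (- p) x = - poly_eval p x"
  using poly_eval_add[of p "- p" x] by (simp del: poly_eval_add)

lemma poly_eval_diff [simp]: "poly_eval (p - q) x = poly_eval p x - poly_eval q x"
  using poly_eval_add[of p "- q" x] by (simp del: poly_eval_add)

lemma poly_eval_sum [simp]: "poly_eval (\<Sum>i\<in>I. p i) x = (\<Sum>i\<in>I. poly_eval (p i) x)"
  by (simp add: poly_eval_riesz riesz_sum)

lemma poly_eval_power [simp]: "poly_eval (p ^ k) x = poly_eval p x ^ k"
  by (induction k) simp_all

lemma poly_eval_prod [simp]: "poly_eval (\<Prod>i\<in>I. p i) x = (\<Prod>i\<in>I. poly_eval (p i) x)"
  by (induction I rule: infinite_finite_induct) simp_all

lemma real_polynomial_function_poly_eval: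
  "real_polynomial_function (\<lambda>x :: real^'n. poly_eval p (($) x))"
proof (induction p rule: rpoly_induct)
  case (pvar p i)
  have "real_polynomial_function (\<lambda>x :: real^'n. x $ i)"
    by (intro real_polynomial_function.intros(1) bounded_linear_vec_nth)
  from real_polynomial_function.intros(4)[OF this pvar] show ?case by simp
qed (auto intro: real_polynomial_function.intros)

lemma poly_eval_of_real_polynomial_function:
  fixes f :: "real^'n \<Rightarrow> real"
  assumes "real_polynomial_function f"
  shows "\<exists>p. \<forall>x. poly_eval p (($) x) = f x"
  using assms
proof (induction f rule: real_polynomial_function.induct)
  case (linear f)
  have "f x = (\<Sum>i\<in>UNIV. x $ i * f (axis i 1))" for x
  proof -
    interpret bounded_linear f by fact
    have "f x = f (\<Sum>i\<in>UNIV. (x $ i) *\<^sub>R axis i 1)"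
      using basis_expansion[of x] by (simp add: scalar_mult_eq_scaleR)
    then show ?thesis by (simp add: sum scaleR)
  qed
  note this[symmetric]
  moreover have "poly_eval (\<Sum>i\<in>UNIV. pvar i * const_poly (f (axis i 1))) (($) x)
      = (\<Sum>i\<in>UNIV. x $ i * f (axis i 1))" for x
    by simp
  ultimately show ?case by (metis (no_types, lifting))
next
  case (const c)
  show ?case by (intro exI[of _ "const_poly c"]) simp
next
  case (add f g)
  then obtain p q where "\<forall>x. poly_eval p (($) x) = f x" "\<forall>x. poly_eval q (($) x) = g x" by blast
  then show ?case by (intro exI[of _ "p + q"]) simp
next
  case (mult f g)
  then obtain p q where "\<forall>x. poly_eval p (($) x) = f x" "\<forall>x. poly_eval q (($) x) = g x" by blast
  then show ?case by (intro exI[of _ "p * q"]) simp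
qed

lemma poly_eval2_mult [simp]: "poly_eval2 (p * q) x y = poly_eval2 p x y * poly_eval2 q x y"
  and poly_eval2_add [simp]: "poly_eval2 (p + q) x y = poly_eval2 p x y + poly_eval2 q x y"
  and poly_eval2_power [simp]: "poly_eval2 (p ^ k) x y = poly_eval2 p x y ^ k"
  and poly_eval2_const [simp]: "poly_eval2 (const_poly c) x y = c"
  and poly_eval2_1 [simp]: "poly_eval2 1 x y = 1"
  and poly_eval2_Inl [simp]: "poly_eval2 (pvar (Inl i)) x y = x $ i"
  and poly_eval2_Inr [simp]: "poly_eval2 (pvar (Inr j)) x y = y $ j"
  by (simp_all add: poly_eval2_def)

lemma riesz_const_mult: "riesz z (const_poly c * p) = c * riesz z p"
proof -
  have "const_poly c * p = (\<Sum>\<alpha>\<in>Poly_Mapping.keys p. Poly_Mapping.single \<alpha> (c * Poly_Mapping.lookup p \<alpha>))"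
    by (subst sum_single_keys[of p, symmetric]) (simp add: sum_distrib_left mult_single)
  then show ?thesis by (simp add: riesz_sum) (simp add: riesz_def sum_distrib_left mult_ac)
qed

lemma integral_y_superset:
  assumes "finite A" "Poly_Mapping.keys p \<subseteq> A"
  shows "integral_y \<nu> p = (\<Sum>\<gamma>\<in>A. Poly_Mapping.single (Poly_Mapping.map_key Inl \<gamma>)
    (Poly_Mapping.lookup p \<gamma> * (\<integral>y. monom_eval (Poly_Mapping.map_key Inr \<gamma>) (($) y) \<partial>\<nu>)))"
  unfolding integral_y_def using assms
  by (intro sum.mono_neutral_left) (auto simp: in_keys_iff)

lemma integral_y_add: "integral_y \<nu> (p + q) = integral_y \<nu> p + integral_y \<nu> q"
proof -
  let ?A = "Poly_Mapping.keys p \<union> Poly_Mapping.keys q"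
  have "Poly_Mapping.keys (p + q) \<subseteq> ?A" by (rule Poly_Mapping.keys_add)
  then show ?thesis
    by (simp add: integral_y_superset[of ?A] lookup_add distrib_right single_add sum.distrib)
qed

lemma integral_y_0 [simp]: "integral_y \<nu> 0 = 0"
  by (simp add: integral_y_def)

lemma integral_y_sum: "integral_y \<nu> (\<Sum>i\<in>I. p i) = (\<Sum>i\<in>I. integral_y \<nu> (p i))"
  by (induction I rule: infinite_finite_induct) (simp_all add: integral_y_add)

lemma integral_y_single: "integral_y \<nu> (Poly_Mapping.single \<gamma> c) =
    Poly_Mapping.single (Poly_Mapping.map_key Inl \<gamma>)
      (c * (\<integral>y. monom_eval (Poly_Mapping.map_key Inr \<gamma>) (($) y) \<partial>\<nu>))"
  by (simp add: integral_y_def)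

text \<open>
  Partial integration is linear over \<open>\<real>[x]\<close>: a monomial free of \<open>y\<close> can be taken out of the integral.
\<close>

lemma integral_y_single_Inl_mult:
  assumes "Poly_Mapping.map_key Inr \<delta> = 0"
  shows "integral_y \<nu> (Poly_Mapping.single \<delta> c * p)
    = Poly_Mapping.single (Poly_Mapping.map_key Inl \<delta>) c * integral_y \<nu> p"
proof -
  have key: "integral_y \<nu> (Poly_Mapping.single \<delta> c * Poly_Mapping.single \<gamma> d)
      = Poly_Mapping.single (Poly_Mapping.map_key Inl \<delta>) c * integral_y \<nu> (Poly_Mapping.single \<gamma> d)" for \<gamma> d
    using assms by (simp add: mult_single integral_y_single map_key_plus mult.assoc)
  have "Poly_Mapping.single \<delta> c * p
      = (\<Sum>\<gamma>\<in>Poly_Mapping.keys p. Poly_Mapping.single \<delta> c * Poly_Mapping.single \<gamma> (Poly_Mapping.lookup p \<gamma>))"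
    by (subst sum_single_keys[of p, symmetric]) (simp add: sum_distrib_left)
  then have "integral_y \<nu> (Poly_Mapping.single \<delta> c * p)
      = (\<Sum>\<gamma>\<in>Poly_Mapping.keys p. Poly_Mapping.single (Poly_Mapping.map_key Inl \<delta>) c
          * integral_y \<nu> (Poly_Mapping.single \<gamma> (Poly_Mapping.lookup p \<gamma>)))"
    by (simp add: integral_y_sum key)
  also have "\<dots> = Poly_Mapping.single (Poly_Mapping.map_key Inl \<delta>) c
      * integral_y \<nu> (\<Sum>\<gamma>\<in>Poly_Mapping.keys p. Poly_Mapping.single \<gamma> (Poly_Mapping.lookup p \<gamma>))"
    by (simp add: integral_y_sum sum_distrib_left)
  finally show ?thesis by (simp only: sum_single_keys)
qed

text \<open>
  The embedding of \<open>\<real>[x]\<close> into \<open>\<real>[x,y]\<close>.  Its values and its compatibility with partial integration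
  are both recorded for the same witness.
\<close>

lemma ex_polynomial_in_x:
  fixes p :: "'n::finite rpoly"
  shows "\<exists>p' :: ('n + 'm::finite) rpoly. (\<forall>(\<nu> :: (real^'m) measure) h. integral_y \<nu> (p' * h) = p * integral_y \<nu> h) \<and>
    (\<forall>x y. poly_eval2 p' x y = poly_eval p (($) x))"
proof (induction p rule: rpoly_induct)
  case (const c)
  show ?case
    by (intro exI[of _ "const_poly c"]) (auto simp: integral_y_single_Inl_mult)
next
  case (add p q)
  then obtain p' q' :: "('n + 'm) rpoly" where
    "\<And>(\<nu> :: (real^'m) measure) h. integral_y \<nu> (p' * h) = p * integral_y \<nu> h" "\<And>x y. poly_eval2 p' x y = poly_eval p (($) x)"
    "\<And>(\<nu> :: (real^'m) measure) h. integral_y \<nu> (q' * h) = q * integral_y \<nu> h" "\<And>x y. poly_eval2 q' x y = poly_eval q (($) x)"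
    by metis
  then show ?case by (intro exI[of _ "p' + q'"]) (simp add: distrib_right integral_y_add)
next
  case (pvar p i)
  then obtain p' :: "('n + 'm) rpoly" where p':
    "\<And>(\<nu> :: (real^'m) measure) h. integral_y \<nu> (p' * h) = p * integral_y \<nu> h" "\<And>x y. poly_eval2 p' x y = poly_eval p (($) x)"
    by metis
  have "Poly_Mapping.map_key Inr (Poly_Mapping.single (Inl i :: 'n + 'm) 1) = (0 :: 'm exponent)"
    by (rule poly_mapping_eqI) (simp add: lookup_single)
  moreover have "Poly_Mapping.map_key Inl (Poly_Mapping.single (Inl i :: 'n + 'm) 1) = (Poly_Mapping.single i 1 :: 'n exponent)"
    by (rule poly_mapping_eqI) (simp add: lookup_single when_def)
  ultimately have "integral_y \<nu> (pvar (Inl i) * h) = pvar i * integral_y \<nu> h" for \<nu> :: "(real^'m) measure" and h :: "('n + 'm) rpoly"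
    unfolding pvar_def by (subst integral_y_single_Inl_mult) auto
  then show ?case
    using p' by (intro exI[of _ "pvar (Inl i) * p'"]) (simp add: mult.assoc)
qed

lemma ex_polynomial_in_y:
  fixes p :: "'m::finite rpoly"
  shows "\<exists>p' :: ('n::finite + 'm) rpoly. \<forall>x y. poly_eval2 p' x y = poly_eval p (($) y)"
proof (induction p rule: rpoly_induct)
  case (const c)
  show ?case by (intro exI[of _ "const_poly c"]) simp
next
  case (add p q)
  then obtain p' q' :: "('n + 'm) rpoly" where "\<forall>x y. poly_eval2 p' x y = poly_eval p (($) y)"
    "\<forall>x y. poly_eval2 q' x y = poly_eval q (($) y)" by blast
  then show ?case by (intro exI[of _ "p' + q'"]) simp
next
  case (pvar p i)
  then obtain p' :: "('n + 'm) rpoly" where "\<forall>x y. poly_eval2 p' x y = poly_eval p (($) y)" by blast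
  then show ?case by (intro exI[of _ "pvar (Inr i) * p'"]) simp
qed

lemma continuous_on_poly_eval: "continuous_on S (\<lambda>x :: real^'n. poly_eval p (($) x))"
  by (intro continuous_on_polymonial_function)
    (simp add: real_polynomial_function_eq[symmetric] real_polynomial_function_poly_eval)

section \<open>Functionals that are positive on a ball\<close>

text \<open>
  If \<open>b\<^sub>1 > N b\<^sub>0\<close>, logarithmic convexity makes all later ratios at least \<open>b\<^sub>1 / b\<^sub>0 > N\<close>, so that \<open>b\<close> would
  grow faster than \<open>N\<^sup>k\<close>.
\<close>

lemma log_convex_growth:
  fixes b :: "nat \<Rightarrow> real"
  assumes nonneg: "\<And>k. 0 \<le> b k" and lc: "\<And>k. (b (Suc k))\<^sup>2 \<le> b k * b (Suc (Suc k))"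
    and bound: "\<And>k. b k \<le> C * N ^ k" and N: "0 < N"
  shows "b 1 \<le> N * b 0"
proof (rule ccontr)
  assume "\<not> b 1 \<le> N * b 0"
  then have gt: "N * b 0 < b 1" by simp
  have b0: "0 < b 0"
  proof (rule ccontr)
    assume "\<not> 0 < b 0"
    then have "b 0 = 0" using nonneg[of 0] by simp
    then show False using lc[of 0] gt by simp
  qed
  define \<theta> where "\<theta> = b 1 / b 0"
  have \<theta>: "N < \<theta>" using gt b0 by (simp add: \<theta>_def field_simps)
  have step: "0 < b k \<and> \<theta> * b k \<le> b (Suc k)" for k
  proof (induction k)
    case 0
    then show ?case using b0 by (simp add: \<theta>_def)
  next
    case (Suc k)
    then have pos: "0 < b (Suc k)" using \<theta> N by (meson less_le_trans less_trans mult_pos_pos)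
    have "\<theta> * b (Suc k) * b k \<le> b (Suc k) * b (Suc k)"
      using Suc pos by (simp add: mult_ac mult_left_mono)
    also have "\<dots> \<le> b (Suc (Suc k)) * b k" using lc[of k] by (simp add: power2_eq_square mult_ac)
    finally show ?case using Suc pos by simp
  qed
  have "\<theta> ^ k * b 0 \<le> b k" for k
  proof (induction k)
    case (Suc k)
    have "\<theta> * (\<theta> ^ k * b 0) \<le> \<theta> * b k" using Suc \<theta> N by (intro mult_left_mono) auto
    with step[of k] show ?case by simp
  qed simp
  with bound have "\<theta> ^ k * b 0 \<le> C * N ^ k" for k using order_trans by blast
  then have le: "(\<theta> / N) ^ k \<le> C / b 0" for k
    using N b0 by (simp add: power_divide field_simps)
  have "1 < \<theta> / N" using \<theta> N by simp
  then obtain k where "C / b 0 < (\<theta> / N) ^ k" using real_arch_pow by blast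
  with le[of k] show False by simp
qed

locale ball_positive_functional =
  fixes L :: "'v::finite rpoly \<Rightarrow> real" and N :: real
  assumes N_pos: "0 < N"
    and L_add: "L (p + q) = L p + L q"
    and L_const_mult: "L (const_poly c * p) = c * L p"
    and L_square: "0 \<le> L (p\<^sup>2)"
    and L_ball: "0 \<le> L ((const_poly N - (\<Sum>i\<in>UNIV. (pvar i)\<^sup>2)) * p\<^sup>2)"
begin

lemma L_0 [simp]: "L 0 = 0"
  using L_add[of 0 0] by simp

lemma L_diff: "L (p - q) = L p - L q"
  using L_add[of "p - q" q] by simp

lemma L_sum: "L (\<Sum>i\<in>I. f i) = (\<Sum>i\<in>I. L (f i))"
  by (induction I rule: infinite_finite_induct) (simp_all add: L_add)

text \<open>
  In the Hilbert space completion of \<open>\<real>[x]\<close> for the form \<open>L(p q)\<close> these are the polynomials that act as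
  positive operators.  Products of commuting positive operators are positive; the lemmas below
  prove the instances that are needed without forming the completion.
\<close>

definition positive_multiplier :: "'v rpoly \<Rightarrow> bool" where
  "positive_multiplier a \<longleftrightarrow> (\<forall>p. 0 \<le> L (a * p\<^sup>2))"

lemma positive_multiplierD: "positive_multiplier a \<Longrightarrow> 0 \<le> L (a * p\<^sup>2)"
  by (simp add: positive_multiplier_def)

lemma positive_multiplier_1: "positive_multiplier 1"
  by (simp add: positive_multiplier_def L_square)

lemma positive_multiplier_const_mult:
  "0 \<le> c \<Longrightarrow> positive_multiplier a \<Longrightarrow> positive_multiplier (const_poly c * a)"
  by (simp add: positive_multiplier_def mult.assoc L_const_mult)

lemma L_Cauchy_Schwarz:
  assumes "positive_multiplier a"
  shows "(L (a * p * q))\<^sup>2 \<le> L (a * p\<^sup>2) * L (a * q\<^sup>2)"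
proof (rule quadratic_discriminant_le)
  fix t
  have sq: "const_poly (2 * t) = const_poly t + const_poly t" "const_poly (t\<^sup>2) = (const_poly t)\<^sup>2"
    by (simp_all add: single_add[symmetric] power2_eq_square mult_single)
  have "a * (p + const_poly t * q)\<^sup>2 = a * p\<^sup>2 + const_poly (2 * t) * (a * p * q) + const_poly (t\<^sup>2) * (a * q\<^sup>2)"
    unfolding sq by (simp add: power2_eq_square algebra_simps)
  then show "0 \<le> L (a * p\<^sup>2) + 2 * t * L (a * p * q) + t\<^sup>2 * L (a * q\<^sup>2)"
    using positive_multiplierD[OF assms, of "p + const_poly t * q"] by (simp only: L_add L_const_mult)
qed (rule positive_multiplierD[OF assms])

lemma positive_multiplier_interval: "positive_multiplier (const_poly N - (pvar i)\<^sup>2)"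
  unfolding positive_multiplier_def
proof
  fix p :: "'v rpoly"
  have "(\<Sum>j\<in>UNIV. (pvar j)\<^sup>2) = (pvar i)\<^sup>2 + (\<Sum>j\<in>UNIV - {i}. (pvar j :: 'v rpoly)\<^sup>2)"
    by (rule sum.remove) auto
  then have "(const_poly N - (pvar i)\<^sup>2) * p\<^sup>2
      = (const_poly N - (\<Sum>j\<in>UNIV. (pvar j)\<^sup>2)) * p\<^sup>2 + (\<Sum>j\<in>UNIV - {i}. (pvar j * p)\<^sup>2)"
    by (simp add: algebra_simps power_mult_distrib sum_distrib_left)
  then show "0 \<le> L ((const_poly N - (pvar i)\<^sup>2) * p\<^sup>2)"
    using L_ball[of p] by (simp only: L_add L_sum) (simp add: L_square sum_nonneg)
qed

lemma L_power_bound: "L ((pvar i ^ k * q)\<^sup>2) \<le> N ^ k * L (q\<^sup>2)"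
proof (induction k)
  case (Suc k)
  have "0 \<le> L ((const_poly N - (pvar i)\<^sup>2) * (pvar i ^ k * q)\<^sup>2)"
    by (intro positive_multiplierD positive_multiplier_interval)
  also have "(const_poly N - (pvar i)\<^sup>2) * (pvar i ^ k * q)\<^sup>2
      = const_poly N * (pvar i ^ k * q)\<^sup>2 - (pvar i ^ Suc k * q)\<^sup>2"
    by (simp add: algebra_simps power_mult_distrib power2_eq_square)
  finally have "L ((pvar i ^ Suc k * q)\<^sup>2) \<le> N * L ((pvar i ^ k * q)\<^sup>2)"
    by (simp only: L_diff L_const_mult)
  also have "\<dots> \<le> N * (N ^ k * L (q\<^sup>2))" using Suc N_pos by (intro mult_left_mono) auto
  finally show ?case by (simp add: mult.assoc)
qed simp

text \<open>
  The inequality \<open>L(a x\<^sub>i\<^sup>2 p\<^sup>2) \<le> N L(a p\<^sup>2)\<close> follows from the growth of \<open>b\<^sub>k = L(a x\<^sub>i\<^sup>2\<^sup>k p\<^sup>2)\<close>.  The sequence is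
  logarithmically convex because \<open>a\<close> is a positive multiplier, and the bound by a multiple of \<open>N\<^sup>k\<close>
  comes from the Cauchy-Schwarz inequality for \<open>L\<close> itself, applied to \<open>x\<^sub>i\<^sup>k a p\<^sup>2\<close> and \<open>x\<^sub>i\<^sup>k\<close>.
\<close>

lemma positive_multiplier_interval_mult:
  assumes a: "positive_multiplier a"
  shows "positive_multiplier ((const_poly N - (pvar i)\<^sup>2) * a)"
  unfolding positive_multiplier_def
proof
  fix p
  define b where "b k = L (a * (pvar i ^ k * p)\<^sup>2)" for k
  define C where "C = sqrt (L ((a * p\<^sup>2)\<^sup>2) * L 1)"
  have "b 1 \<le> N * b 0"
  proof (rule log_convex_growth[where C = C])
    show "0 \<le> b k" for k unfolding b_def by (rule positive_multiplierD[OF a])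
    show "(b (Suc k))\<^sup>2 \<le> b k * b (Suc (Suc k))" for k
    proof -
      have "a * (pvar i ^ Suc k * p)\<^sup>2 = a * (pvar i ^ k * p) * (pvar i ^ Suc (Suc k) * p)"
        by (simp add: power2_eq_square algebra_simps)
      then show ?thesis unfolding b_def using L_Cauchy_Schwarz[OF a] by simp
    qed
    show "b k \<le> C * N ^ k" for k
    proof -
      have "a * (pvar i ^ k * p)\<^sup>2 = 1 * (pvar i ^ k * (a * p\<^sup>2)) * (pvar i ^ k * 1)"
        by (simp add: power2_eq_square algebra_simps)
      then have "(b k)\<^sup>2 \<le> L ((pvar i ^ k * (a * p\<^sup>2))\<^sup>2) * L ((pvar i ^ k * 1)\<^sup>2)"
        unfolding b_def using L_Cauchy_Schwarz[OF positive_multiplier_1, of "pvar i ^ k * (a * p\<^sup>2)" "pvar i ^ k * 1"] by simp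
      also have "\<dots> \<le> (N ^ k * L ((a * p\<^sup>2)\<^sup>2)) * (N ^ k * L (1\<^sup>2))"
        using N_pos by (intro mult_mono L_power_bound) (auto simp: L_square)
      also have "\<dots> = (C * N ^ k)\<^sup>2"
        using L_square[of 1] L_square[of "a * p\<^sup>2"] by (simp add: C_def power_mult_distrib power2_eq_square[of "N ^ k"])
      finally show ?thesis
        using L_square[of 1] L_square[of "a * p\<^sup>2"] N_pos by (elim power2_le_imp_le) (simp add: C_def)
    qed
  qed (rule N_pos)
  moreover have "(const_poly N - (pvar i)\<^sup>2) * a * p\<^sup>2 = const_poly N * (a * (pvar i ^ 0 * p)\<^sup>2) - a * (pvar i ^ 1 * p)\<^sup>2"
    by (simp add: algebra_simps power_mult_distrib)
  ultimately show "0 \<le> L ((const_poly N - (pvar i)\<^sup>2) * a * p\<^sup>2)"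
    by (simp only: L_diff L_const_mult b_def)
qed

definition radius where "radius = sqrt N"

lemma radius_pos: "0 < radius" and radius_square: "radius * radius = N"
  using N_pos by (auto simp: radius_def)

text \<open>
  The affine coordinate that maps the edge \<open>[- \<surd>N, \<surd>N]\<close> of the cube onto \<open>[0, 1]\<close>.
\<close>

definition coord :: "'v \<Rightarrow> 'v rpoly" where
  "coord i = const_poly (1 / (2 * radius)) * (const_poly radius + pvar i)"

lemma const_poly_mult: "const_poly a * const_poly b = (const_poly (a * b) :: 'v rpoly)"
  by (simp add: mult_single)

lemma one_minus_coord: "1 - coord i = const_poly (1 / (2 * radius)) * (const_poly radius - pvar i)"
proof -
  have "const_poly (1 / (2 * radius)) * const_poly radius + const_poly (1 / (2 * radius)) * const_poly radius = (1 :: 'v rpoly)"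
    using radius_pos by (simp add: const_poly_mult single_add[symmetric] single_one)
  then show ?thesis unfolding coord_def by (simp add: algebra_simps)
qed

lemma pvar_eq_coord: "pvar i = const_poly (2 * radius) * coord i - const_poly radius"
proof -
  have "const_poly (2 * radius) * coord i = (const_poly (2 * radius) * const_poly (1 / (2 * radius))) * (const_poly radius + pvar i)"
    by (simp add: coord_def mult.assoc)
  also have "const_poly (2 * radius) * const_poly (1 / (2 * radius)) = (1 :: 'v rpoly)"
    using radius_pos by (simp add: const_poly_mult)
  finally show ?thesis by simp
qed

text \<open>
  Both linear factors lie in the quadratic module of the interval:
  \<open>2 \<surd>N (\<surd>N \<plusminus> x\<^sub>i) = (\<surd>N \<plusminus> x\<^sub>i)\<^sup>2 + (N - x\<^sub>i\<^sup>2)\<close>.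
\<close>

lemma positive_multiplier_linear_mult:
  assumes a: "positive_multiplier a" and s: "s = 1 \<or> s = - 1"
  shows "positive_multiplier ((const_poly radius + s * pvar i) * a)"
  unfolding positive_multiplier_def
proof
  fix p
  have ss: "s * s = 1" using s by auto
  have RR: "const_poly radius * const_poly radius = (const_poly N :: 'v rpoly)" by (simp add: const_poly_mult radius_square)
  have "const_poly (2 * radius) * ((const_poly radius + s * pvar i) * a * p\<^sup>2)
      = (2 * (const_poly radius * const_poly radius) + 2 * const_poly radius * (s * pvar i)) * (a * p\<^sup>2)"
  proof -
    have "const_poly (2 * radius) = 2 * (const_poly radius :: 'v rpoly)"
      using const_poly_mult[of 2 radius] by (simp add: single_numeral)
    then show ?thesis by (simp add: algebra_simps)
  qed
  also have "\<dots> = a * ((const_poly radius + s * pvar i) * p)\<^sup>2 + (const_poly N - (s * s) * (pvar i)\<^sup>2) * a * p\<^sup>2"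
    unfolding RR[symmetric] by (simp add: algebra_simps power2_eq_square)
  finally have "L (const_poly (2 * radius) * ((const_poly radius + s * pvar i) * a * p\<^sup>2))
      = L (a * ((const_poly radius + s * pvar i) * p)\<^sup>2) + L ((const_poly N - (pvar i)\<^sup>2) * a * p\<^sup>2)"
    by (simp add: L_add ss)
  moreover have "0 \<le> L (a * ((const_poly radius + s * pvar i) * p)\<^sup>2)"
    by (rule positive_multiplierD[OF a])
  moreover have "0 \<le> L ((const_poly N - (pvar i)\<^sup>2) * a * p\<^sup>2)"
    by (rule positive_multiplierD[OF positive_multiplier_interval_mult[OF a]])
  ultimately have "0 \<le> (2 * radius) * L ((const_poly radius + s * pvar i) * a * p\<^sup>2)"
    unfolding L_const_mult by linarith
  then show "0 \<le> L ((const_poly radius + s * pvar i) * a * p\<^sup>2)"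
    using radius_pos by (auto simp: zero_le_mult_iff)
qed

lemma positive_multiplier_coord_mult:
  assumes "positive_multiplier a"
  shows "positive_multiplier (coord i * a)" "positive_multiplier ((1 - coord i) * a)"
proof -
  show "positive_multiplier (coord i * a)"
    using positive_multiplier_const_mult[of "1 / (2 * radius)", OF _ positive_multiplier_linear_mult[OF assms, of 1 i]] radius_pos
    by (simp add: coord_def mult.assoc)
  show "positive_multiplier ((1 - coord i) * a)"
    using positive_multiplier_const_mult[of "1 / (2 * radius)", OF _ positive_multiplier_linear_mult[OF assms, of "- 1" i]] radius_pos
    by (simp add: one_minus_coord mult.assoc)
qed

lemma positive_multiplier_coord_power_mult:
  assumes "positive_multiplier a"
  shows "positive_multiplier (coord i ^ k * (1 - coord i) ^ l * a)"
proof -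
  have "positive_multiplier ((1 - coord i) ^ l * a)"
    by (induction l) (simp_all add: assms mult.assoc positive_multiplier_coord_mult)
  then have "positive_multiplier (coord i ^ k * ((1 - coord i) ^ l * a))"
    by (induction k) (simp_all add: mult.assoc positive_multiplier_coord_mult)
  then show ?thesis by (simp add: mult.assoc)
qed

lemma L_bernstein_nonneg:
  "0 \<le> L (\<Prod>i\<in>UNIV. of_nat (c i) * (coord i ^ k i * (1 - coord i) ^ l i))"
proof -
  have "positive_multiplier (\<Prod>i\<in>I. of_nat (c i) * (coord i ^ k i * (1 - coord i) ^ l i))" if "finite I" for I
    using that
  proof (induction I rule: finite_induct)
    case (insert i I)
    have "positive_multiplier (const_poly (of_nat (c i)) * (coord i ^ k i * (1 - coord i) ^ l i *
        (\<Prod>i\<in>I. of_nat (c i) * (coord i ^ k i * (1 - coord i) ^ l i))))"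
      by (intro positive_multiplier_const_mult positive_multiplier_coord_power_mult insert.IH) simp
    then show ?case using insert by (simp add: mult.assoc)
  qed (simp add: positive_multiplier_1)
  from positive_multiplierD[OF this, of UNIV 1] show ?thesis by simp
qed

end

section \<open>Weak cluster points of discrete measures\<close>

text \<open>
  By Tychonoff's theorem the functions with values in \<open>[0, 1]\<close> form a compact space in the topology of pointwise
  convergence.  The index set may be uncountable, so a subsequence need not exist, but a
  filter finer than \<open>sequentially\<close> does.
\<close>

lemma setwise_limit_along_filter:
  fixes m :: "nat \<Rightarrow> 'b \<Rightarrow> real"
  assumes m: "\<And>n A. m n A \<in> {0..1}"
  obtains F l where "F \<noteq> bot" "F \<le> sequentially" "\<And>A. ((\<lambda>n. m n A) \<longlongrightarrow> l A) F"
proof -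
  have "compact (PiE UNIV (\<lambda>_. {0..1::real}) :: ('b \<Rightarrow> real) set)"
    unfolding compactin_euclidean_iff[symmetric] euclidean_product_topology[symmetric]
    by (subst compactin_PiE) (simp add: compactin_euclidean_iff)
  moreover have "m n \<in> PiE UNIV (\<lambda>_. {0..1})" for n
    using m[of n] by (auto simp: PiE_def Pi_def extensional_def)
  then have "eventually (\<lambda>x. x \<in> PiE UNIV (\<lambda>_. {0..1})) (filtermap m sequentially)"
    unfolding eventually_filtermap by simp
  ultimately obtain l where l: "inf (nhds l) (filtermap m sequentially) \<noteq> bot"
    unfolding compact_filter by (metis filtermap_bot_iff sequentially_bot)
  define F where "F = inf (filtercomap m (nhds l)) sequentially"
  have "F \<noteq> bot"
  proof
    assume "F = bot"
    then have "eventually (\<lambda>_. False) F" by simp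
    then obtain P R where P: "eventually P (nhds l)" and R: "eventually R sequentially"
        and "\<And>n. P (m n) \<Longrightarrow> \<not> R n"
      unfolding F_def eventually_inf eventually_filtercomap by metis
    then have "eventually (\<lambda>x. \<not> P x) (filtermap m sequentially)"
      unfolding eventually_filtermap by (auto elim: eventually_mono)
    with P have "eventually (\<lambda>_. False) (inf (nhds l) (filtermap m sequentially))"
      unfolding eventually_inf by blast
    with l show False by (simp add: trivial_limit_def)
  qed
  moreover have "F \<le> sequentially" by (simp add: F_def)
  moreover have "((\<lambda>n. m n A) \<longlongrightarrow> l A) F" for A
  proof -
    have "filterlim m (nhds l) F"
      unfolding F_def by (intro filterlim_mono[OF filterlim_filtercomap]) auto
    moreover have "filterlim (\<lambda>x. x A) (nhds (l A)) (nhds l)"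
    proof (rule topological_tendstoI)
      fix U assume "open U" "l A \<in> U"
      moreover have "open ((\<lambda>x. x A) -` U)"
        using \<open>open U\<close> by (intro open_vimage continuous_on_product_coordinates)
      ultimately show "eventually (\<lambda>x. x A \<in> U) (nhds l)"
        unfolding eventually_nhds by auto
    qed
    ultimately show ?thesis by (rule filterlim_compose[rotated])
  qed
  ultimately show thesis using that by blast
qed

text \<open>
  Limits of probabilities along a filter, taken separately for every set, remain finitely additive and
  are defined on all sets.
\<close>

locale finitely_additive_probability =
  fixes c :: "'b set \<Rightarrow> real"
  assumes nonneg: "0 \<le> c A" and total: "c UNIV = 1"
    and additive: "A \<inter> B = {} \<Longrightarrow> c (A \<union> B) = c A + c B"
begin

lemma content_empty [simp]: "c {} = 0"
  using additive[of "{}" "{}"] by simp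

lemma content_UN:
  assumes "finite I" "disjoint_family_on A I"
  shows "c (\<Union>i\<in>I. A i) = (\<Sum>i\<in>I. c (A i))"
  using assms
proof (induction I rule: finite_induct)
  case (insert i I)
  have "A i \<inter> (\<Union>j\<in>I. A j) = {}"
    using insert by (fastforce simp: disjoint_family_on_def)
  moreover have "disjoint_family_on A I"
    using insert.prems by (rule disjoint_family_on_mono[rotated]) auto
  ultimately show ?case using insert by (simp add: additive)
qed simp

text \<open>
  The distribution of a function with finite range under the finitely additive probability.  It is
  countably additive, since only finitely many members of a disjoint family meet the range.
\<close>

definition push :: "'d measure \<Rightarrow> ('b \<Rightarrow> 'd) \<Rightarrow> 'd measure" where
  "push N f = measure_of (space N) (sets N) (\<lambda>X. ennreal (c (f -` X)))"

lemma emeasure_push: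
  fixes f :: "'b \<Rightarrow> 'd"
  assumes fin: "finite (range f)" and X: "X \<in> sets N"
  shows "emeasure (push N f) X = ennreal (c (f -` X))"
  unfolding push_def
proof (rule emeasure_measure_of_sigma)
  show "sigma_algebra (space N) (sets N)" by (rule sets.sigma_algebra_axioms)
  show "positive (sets N) (\<lambda>X. ennreal (c (f -` X)))" by (simp add: positive_def)
  show "countably_additive (sets N) (\<lambda>X. ennreal (c (f -` X)))"
  proof (rule countably_additiveI)
    fix A :: "nat \<Rightarrow> 'd set"
    assume dis: "disjoint_family A"
    define I where "I = {i. A i \<inter> range f \<noteq> {}}"
    have "\<forall>i\<in>I. \<exists>y. y \<in> A i \<inter> range f" by (auto simp: I_def)
    then obtain p where p: "\<And>i. i \<in> I \<Longrightarrow> p i \<in> A i \<inter> range f" by metis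
    have "inj_on p I"
      using p dis by (intro inj_onI) (metis IntE disjoint_family_on_def UNIV_I disjoint_iff)
    moreover have "p ` I \<subseteq> range f" using p by auto
    ultimately have I: "finite I" using fin by (metis finite_imageD finite_subset)
    have "suminf (\<lambda>i. ennreal (c (f -` A i))) = (\<Sum>i\<in>I. ennreal (c (f -` A i)))"
    proof (rule suminf_finite[OF I])
      fix i assume "i \<notin> I"
      then have "f -` A i = {}" by (auto simp: I_def)
      then show "ennreal (c (f -` A i)) = 0" by simp
    qed
    also have "\<dots> = ennreal (\<Sum>i\<in>I. c (f -` A i))" by (simp add: nonneg sum_ennreal)
    also have "(\<Sum>i\<in>I. c (f -` A i)) = c (\<Union>i\<in>I. f -` A i)"
      using dis by (intro content_UN[symmetric] I) (fastforce simp: disjoint_family_on_def)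
    also have "(\<Union>i\<in>I. f -` A i) = f -` (\<Union>i. A i)" by (auto simp: I_def)
    finally show "suminf (\<lambda>i. ennreal (c (f -` A i))) = ennreal (c (f -` \<Union> (range A)))" .
  qed
qed (rule X)

lemma sets_push [simp]: "sets (push N f) = sets N" and space_push [simp]: "space (push N f) = space N"
  by (simp_all add: push_def)

lemma prob_space_push:
  assumes "finite (range f)" "range f \<subseteq> space N"
  shows "prob_space (push N f)"
proof
  have "f -` space N = UNIV" using assms(2) by auto
  then show "emeasure (push N f) (space (push N f)) = 1"
    using assms(1) by (simp add: emeasure_push total)
qed

lemma distr_push:
  assumes "finite (range f)" and h: "h \<in> measurable N L" and "range f \<subseteq> space N"
  shows "distr (push N f) L h = push L (\<lambda>x. h (f x))"
proof (rule measure_eqI)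
  fix X assume "X \<in> sets (distr (push N f) L h)"
  then have X: "X \<in> sets L" by simp
  have "finite (range (\<lambda>x. h (f x)))" using assms(1) by (metis finite_imageI image_image)
  moreover have "f -` (h -` X \<inter> space N) = (\<lambda>x. h (f x)) -` X" using assms(3) by auto
  moreover have "h \<in> measurable (push N f) L" using h by (simp cong: measurable_cong_sets)
  ultimately show "emeasure (distr (push N f) L h) X = emeasure (push L (\<lambda>x. h (f x))) X"
    using X h assms(1) by (simp add: emeasure_distr emeasure_push measurable_sets)
qed simp

text \<open>
  The joint distributions of finitely many of the functions \<open>a k\<close> form a projective family, so the
  Daniell-Kolmogorov theorem yields a countably additive joint distribution of all of them.
\<close>

lemma coordinates_have_limit_measure:
  fixes a :: "nat \<Rightarrow> 'b \<Rightarrow> 'a::polish_space"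
  assumes fin: "\<And>k. finite (range (a k))"
  obtains L :: "(nat \<Rightarrow> 'a) measure"
  where "prob_space L" "sets L = sets (PiM UNIV (\<lambda>_. borel))"
    "\<And>J X. finite J \<Longrightarrow> X \<in> sets (PiM J (\<lambda>_. borel)) \<Longrightarrow>
      emeasure L (prod_emb UNIV (\<lambda>_. borel) J X) = ennreal (c {x. (\<lambda>k\<in>J. a k x) \<in> X})"
proof -
  define P where "P J = push (PiM J (\<lambda>_. borel)) (\<lambda>x. \<lambda>k\<in>J. a k x)" for J
  have fin': "finite (range (\<lambda>x. \<lambda>k\<in>J. a k x))" if "finite J" for J
    by (rule finite_subset[OF _ finite_PiE[OF that fin]]) auto
  interpret polish_projective UNIV P
  proof (intro polish_projective.intro projective_family.intro)
    fix J H :: "nat set" assume JH: "J \<subseteq> H" "finite H"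
    have "(\<lambda>f. restrict f J) \<in> measurable (PiM H (\<lambda>_. borel)) (PiM J (\<lambda>_. borel :: 'a measure))"
      by (rule measurable_restrict_subset[OF JH(1)])
    then have "distr (P H) (PiM J (\<lambda>_. borel)) (\<lambda>f. restrict f J)
        = push (PiM J (\<lambda>_. borel)) (\<lambda>x. restrict (\<lambda>k\<in>H. a k x) J)"
      unfolding P_def by (intro distr_push fin' JH) (auto simp: space_PiM)
    also have "(\<lambda>x. restrict (\<lambda>k\<in>H. a k x) J) = (\<lambda>x. \<lambda>k\<in>J. a k x)"
      using JH(1) by (auto simp: restrict_def fun_eq_iff)
    finally show "P J = distr (P H) (PiM J (\<lambda>_. borel)) (\<lambda>f. restrict f J)" by (simp only: P_def)
  next
    fix J :: "nat set" assume "finite J"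
    then show "prob_space (P J)"
      unfolding P_def by (intro prob_space_push fin') (auto simp: space_PiM)
  qed
  show thesis
  proof (rule that[of lim])
    fix J and X :: "(nat \<Rightarrow> 'a) set" assume "finite J" "X \<in> sets (PiM J (\<lambda>_. borel))"
    then show "emeasure lim (prod_emb UNIV (\<lambda>_. borel) J X) = ennreal (c {x. (\<lambda>k\<in>J. a k x) \<in> X})"
      by (subst emeasure_lim_emb) (auto simp: P_def emeasure_push fin' vimage_def)
  qed (simp_all add: P.prob_space_axioms)
qed

end


text \<open>
  Let \<open>c\<close> be the setwise limit of the discrete measures along a filter, and let \<open>a k\<close> round each point of \<open>K\<close>
  to a finite \<open>2\<^sup>-\<^sup>k\<close>-net.  In the joint distribution of the sequence \<open>(a k)\<close> under \<open>c\<close>, almost every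
  sequence converges, because consecutive members are \<open>2 \<cdot> 2\<^sup>-\<^sup>k\<close>-close; the law of the limit is \<open>\<mu>\<close>.
  For a continuous \<open>f\<close> and fixed \<open>k\<close> the integrals of \<open>f \<circ> a k\<close> are finite sums, so they converge along
  the filter, and uniform continuity on \<open>K\<close> makes the error of replacing \<open>f\<close> by \<open>f \<circ> a k\<close> small uniformly
  in all the discrete measures.
\<close>

theorem discrete_measures_weak_cluster_point:
  fixes node :: "nat \<Rightarrow> 'i \<Rightarrow> 'a::euclidean_space" and w :: "nat \<Rightarrow> 'i \<Rightarrow> real"
  assumes K: "compact K" and S: "\<And>n. finite (S n)" and node: "\<And>n i. i \<in> S n \<Longrightarrow> node n i \<in> K"
    and w: "\<And>n i. i \<in> S n \<Longrightarrow> 0 \<le> w n i" and w1: "\<And>n. (\<Sum>i\<in>S n. w n i) = 1"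
  obtains \<mu> F where "prob_space \<mu>" "sets \<mu> = sets borel" "AE x in \<mu>. x \<in> K" "F \<noteq> bot" "F \<le> sequentially"
    "\<And>f :: 'a \<Rightarrow> real. continuous_on UNIV f \<Longrightarrow>
      ((\<lambda>n. \<Sum>i\<in>S n. w n i * f (node n i)) \<longlongrightarrow> (\<integral>x. f x \<partial>\<mu>)) F"
proof -
  define m where "m n A = (\<Sum>i\<in>S n. w n i * indicator A (node n i))" for n and A :: "'a set"
  have m01: "m n A \<in> {0..1}" for n A
  proof -
    have "m n A \<le> (\<Sum>i\<in>S n. w n i * 1)"
      unfolding m_def by (intro sum_mono mult_left_mono w) (auto simp: indicator_def)
    then show ?thesis using w w1 by (auto simp: m_def intro!: sum_nonneg mult_nonneg_nonneg)
  qed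
  obtain F c where F: "F \<noteq> bot" "F \<le> sequentially" and c: "\<And>A. ((\<lambda>n. m n A) \<longlongrightarrow> c A) F"
    using setwise_limit_along_filter[of m, OF m01] by metis
  interpret finitely_additive_probability c
  proof
    show "0 \<le> c A" for A
      using m01 by (intro tendsto_lowerbound[OF c] F(1)) auto
    have "((\<lambda>n. m n UNIV) \<longlongrightarrow> 1) F" by (simp add: m_def w1)
    then show "c UNIV = 1" using tendsto_unique[OF F(1) c] by blast
    fix A B :: "'a set" assume "A \<inter> B = {}"
    then have "m n (A \<union> B) = m n A + m n B" for n
      by (auto simp: m_def sum.distrib[symmetric] distrib_left[symmetric] indicator_def intro!: sum.cong)
    then have "((\<lambda>n. m n (A \<union> B)) \<longlongrightarrow> c A + c B) F" by (simp add: tendsto_add c)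
    then show "c (A \<union> B) = c A + c B" using tendsto_unique[OF F(1) c] by blast
  qed
  have "S 0 \<noteq> {}" using w1[of 0] by auto
  then obtain x0 where x0: "x0 \<in> K" using node by blast
  have "\<exists>N. finite N \<and> N \<subseteq> K \<and> K \<subseteq> (\<Union>v\<in>N. ball v ((1/2) ^ k))" for k :: nat
    using seq_compact_imp_totally_bounded[OF compact_imp_seq_compact[OF K], rule_format, of "(1/2) ^ k"] by auto
  then obtain N where N: "\<And>k. finite (N k)" "\<And>k. N k \<subseteq> K" "\<And>k. K \<subseteq> (\<Union>v\<in>N k. ball v ((1/2) ^ k))"
    by metis
  have "\<exists>v\<in>N k. dist v x < (1/2) ^ k" if "x \<in> K" for k x
    using subsetD[OF N(3)[of k] that] unfolding UN_iff mem_ball .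
  then have a_ex: "\<exists>v. v \<in> N k \<and> dist v x < (1/2) ^ k" if "x \<in> K" for k x
    using that by blast
  define a' where "a' k x = (SOME v. v \<in> N k \<and> dist v x < (1/2) ^ k)" for k x
  have a': "a' k x \<in> N k \<and> dist (a' k x) x < (1/2) ^ k" if "x \<in> K" for k x
    unfolding a'_def by (rule someI_ex[OF a_ex[OF that]])
  (* Points outside K carry no mass; sending them to x0 makes the properties of a k hold
     everywhere. *)
  define r where "r x = (if x \<in> K then x else x0)" for x
  have rK: "r x \<in> K" for x using x0 by (simp add: r_def)
  define a where "a k x = a' k (r x)" for k x
  have aN: "a k x \<in> N k" for k x unfolding a_def using a' rK by blast
  have a_near: "dist (a k x) x < (1/2) ^ k" if "x \<in> K" for k x
    using a'[OF that, of k] that by (simp add: a_def r_def)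
  have a_step: "dist (a k x) (a (Suc k) x) < 2 * (1/2) ^ k" for k x
  proof -
    have "dist (a k x) (a (Suc k) x) \<le> dist (a k x) (r x) + dist (a (Suc k) x) (r x)"
      by (rule dist_triangle2)
    also have "\<dots> < (1/2) ^ k + (1/2) ^ Suc k"
      unfolding a_def using a'[OF rK] by (intro add_strict_mono) blast+
    also have "\<dots> \<le> 2 * (1/2) ^ k" by simp
    finally show ?thesis .
  qed
  have fin_a: "finite (range (a k))" for k
    by (rule finite_subset[OF _ N(1)[of k]]) (use aN in auto)
  obtain L :: "(nat \<Rightarrow> 'a) measure" where "prob_space L" and L: "sets L = sets (PiM UNIV (\<lambda>_. borel))"
    and emb: "\<And>J X. finite J \<Longrightarrow> X \<in> sets (PiM J (\<lambda>_. borel)) \<Longrightarrow>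
      emeasure L (prod_emb UNIV (\<lambda>_. borel) J X) = ennreal (c {x. (\<lambda>k\<in>J. a k x) \<in> X})"
    by (rule coordinates_have_limit_measure[of a, OF fin_a]) (rule that)
  interpret L: prob_space L by fact
  have spL: "space L = UNIV" using sets_eq_imp_space_eq[OF L] by (simp add: space_PiM)
  have [measurable]: "(\<lambda>\<omega>. \<omega> k) \<in> borel_measurable L" for k
    by (subst measurable_cong_sets[OF L refl]) (rule measurable_component_singleton, simp)
  have AE_J: "AE \<omega> in L. restrict \<omega> J \<in> X"
    if J: "finite J" and X: "X \<in> sets (PiM J (\<lambda>_. borel))" and "\<And>x. (\<lambda>k\<in>J. a k x) \<in> X" for J X
  proof (rule L.AE_prob_1[of "prod_emb UNIV (\<lambda>_. borel) J X", THEN AE_mp])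
    show "L.prob (prod_emb UNIV (\<lambda>_. borel) J X) = 1"
      using that emb[OF J X] total by (simp add: measure_def)
    show "AE \<omega> in L. \<omega> \<in> prod_emb UNIV (\<lambda>_. borel) J X \<longrightarrow> restrict \<omega> J \<in> X"
      by (simp add: prod_emb_def)
  qed
  have AE_N: "AE \<omega> in L. \<omega> k \<in> N k" for k
  proof -
    have [measurable]: "N k \<in> sets borel" by (intro borel_closed finite_imp_closed N)
    have "{f \<in> space (PiM {k} (\<lambda>_. borel)). f k \<in> N k} \<in> sets (PiM {k} (\<lambda>_. borel :: 'a measure))"
      by measurable
    from AE_J[OF _ this] show ?thesis using aN by (simp add: space_PiM)
  qed
  have AE_step: "AE \<omega> in L. dist (\<omega> k) (\<omega> (Suc k)) < 2 * (1/2) ^ k" for k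
  proof -
    have "{f \<in> space (PiM {k, Suc k} (\<lambda>_. borel)). dist (f k) (f (Suc k)) < 2 * (1/2) ^ k}
        \<in> sets (PiM {k, Suc k} (\<lambda>_. borel :: 'a measure))"
      by measurable
    from AE_J[OF _ this] show ?thesis using a_step by (simp add: space_PiM)
  qed
  define X where "X \<omega> = lim (\<lambda>k. \<omega> k)" for \<omega> :: "nat \<Rightarrow> 'a"
  have [measurable]: "X \<in> borel_measurable L"
    unfolding X_def by (rule borel_measurable_lim_metric) simp
  have conv: "AE \<omega> in L. (\<lambda>k. \<omega> k) \<longlonglongrightarrow> X \<omega>"
  proof -
    have "AE \<omega> in L. \<forall>k. dist (\<omega> k) (\<omega> (Suc k)) < 2 * (1/2) ^ k"
      using AE_step by (simp add: AE_all_countable)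
    then show ?thesis
    proof eventually_elim
      case (elim \<omega>)
      have "summable (\<lambda>k. \<omega> (Suc k) - \<omega> k)"
      proof (rule summable_comparison_test')
        show "summable (\<lambda>k. 2 * (1/2 :: real) ^ k)" by simp
        show "norm (\<omega> (Suc k) - \<omega> k) \<le> 2 * (1/2) ^ k" for k
          using elim[rule_format, of k] by (simp add: dist_norm norm_minus_commute less_imp_le)
      qed
      then have "convergent (\<lambda>n. \<Sum>k<n. \<omega> (Suc k) - \<omega> k)" by (simp add: summable_iff_convergent)
      then have "convergent (\<lambda>n. \<omega> n - \<omega> 0)" by (simp add: sum_lessThan_telescope)
      then have "convergent (\<lambda>n. (\<omega> n - \<omega> 0) + \<omega> 0)" by (intro convergent_add convergent_const)
      then show ?case by (simp add: X_def convergent_LIMSEQ_iff)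
    qed
  qed
  have inK: "AE \<omega> in L. \<forall>k. \<omega> k \<in> K"
    unfolding AE_all_countable
  proof
    fix k show "AE \<omega> in L. \<omega> k \<in> K" using AE_N[of k] N(2)[of k] by (auto elim: eventually_mono)
  qed
  have XK: "AE \<omega> in L. X \<omega> \<in> K"
    using conv inK by eventually_elim (use closed_sequentially[OF compact_imp_closed[OF K]] in blast)
  define \<mu> where "\<mu> = distr L borel X"
  have lim_f: "((\<lambda>n. \<Sum>i\<in>S n. w n i * f (node n i)) \<longlongrightarrow> (\<integral>x. f x \<partial>\<mu>)) F"
    if f: "continuous_on UNIV f" for f :: "'a \<Rightarrow> real"
  proof -
    have [measurable]: "f \<in> borel_measurable borel" using f by (rule borel_measurable_continuous_onI)
    obtain B where B: "\<And>x. x \<in> K \<Longrightarrow> \<bar>f x\<bar> \<le> B"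
      using compact_imp_bounded[OF compact_continuous_image[OF continuous_on_subset[OF f] K]]
      by (auto simp: bounded_iff)
    have level: "((\<lambda>n. \<Sum>i\<in>S n. w n i * f (a k (node n i))) \<longlongrightarrow> (\<integral>\<omega>. f (\<omega> k) \<partial>L)) F" for k
    proof -
      have prob: "measure L {\<omega>. \<omega> k = v} = c {x. a k x = v}" for v
      proof -
        have s: "{f \<in> space (PiM {k} (\<lambda>_. borel)). f k = v} \<in> sets (PiM {k} (\<lambda>_. borel :: 'a measure))"
          by measurable
        have "{\<omega>. \<omega> k = v} = prod_emb UNIV (\<lambda>_. borel) {k} {f \<in> space (PiM {k} (\<lambda>_. borel)). f k = v}"
          by (auto simp: prod_emb_def space_PiM)
        then show ?thesis using emb[OF _ s] by (simp add: measure_def space_PiM nonneg)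
      qed
      have "{\<omega> \<in> space L. \<omega> k = v} \<in> sets L" for v by measurable
      then have [measurable]: "{\<omega>. \<omega> k = v} \<in> sets L" for v by (simp add: spL)
      have "(\<integral>\<omega>. f (\<omega> k) \<partial>L) = (\<integral>\<omega>. (\<Sum>v\<in>N k. f v * indicator {\<omega>. \<omega> k = v} \<omega>) \<partial>L)"
      proof (rule integral_cong_AE)
        show "AE \<omega> in L. f (\<omega> k) = (\<Sum>v\<in>N k. f v * indicator {\<omega>. \<omega> k = v} \<omega>)"
          using AE_N[of k] by eventually_elim (simp add: indicator_def N(1) if_distrib cong: if_cong)
      qed measurable
      also have "\<dots> = (\<Sum>v\<in>N k. \<integral>\<omega>. f v * indicator {\<omega>. \<omega> k = v} \<omega> \<partial>L)"
        by (intro Bochner_Integration.integral_sum integrable_mult_right integrable_real_indicator) (auto simp: L.emeasure_eq_measure)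
      also have "\<dots> = (\<Sum>v\<in>N k. f v * c {x. a k x = v})"
        by (simp add: prob spL)
      finally have eq: "(\<integral>\<omega>. f (\<omega> k) \<partial>L) = (\<Sum>v\<in>N k. f v * c {x. a k x = v})" .
      have "(\<Sum>i\<in>S n. w n i * f (a k (node n i))) = (\<Sum>v\<in>N k. f v * m n {x. a k x = v})" for n
      proof -
        have ind: "(\<Sum>v\<in>N k. f v * indicator {x. a k x = v} y) = f (a k y)" for y
          using aN[of k y] by (simp add: indicator_def N(1) if_distrib cong: if_cong)
        have "(\<Sum>v\<in>N k. f v * m n {x. a k x = v})
            = (\<Sum>i\<in>S n. w n i * (\<Sum>v\<in>N k. f v * indicator {x. a k x = v} (node n i)))"
          unfolding m_def sum_distrib_left by (subst sum.swap) (simp add: mult_ac)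
        then show ?thesis by (simp add: ind)
      qed
      then show ?thesis unfolding eq by (simp add: tendsto_intros c)
    qed
    have "(\<lambda>k. \<integral>\<omega>. f (\<omega> k) \<partial>L) \<longlonglongrightarrow> (\<integral>\<omega>. f (X \<omega>) \<partial>L)"
    proof (rule integral_dominated_convergence[where w = "\<lambda>_. B"])
      show "AE \<omega> in L. (\<lambda>k. f (\<omega> k)) \<longlonglongrightarrow> f (X \<omega>)"
        using conv by eventually_elim (use f in \<open>auto intro: continuous_on_tendsto_compose\<close>)
      show "AE \<omega> in L. norm (f (\<omega> k)) \<le> B" for k
        using inK by eventually_elim (simp add: B)
    qed auto
    also have "(\<integral>\<omega>. f (X \<omega>) \<partial>L) = (\<integral>x. f x \<partial>\<mu>)" by (simp add: \<mu>_def integral_distr)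
    finally have levels: "(\<lambda>k. \<integral>\<omega>. f (\<omega> k) \<partial>L) \<longlonglongrightarrow> (\<integral>x. f x \<partial>\<mu>)" .
    show ?thesis
      unfolding tendsto_iff
    proof (intro allI impI)
      fix e :: real assume e: "0 < e"
      obtain d where d: "d > 0" and dist_f: "\<And>x y. x \<in> K \<Longrightarrow> y \<in> K \<Longrightarrow> dist x y < d \<Longrightarrow> dist (f x) (f y) < e / 3"
        using compact_uniformly_continuous[OF continuous_on_subset[OF f] K] e
        unfolding uniformly_continuous_on_def by (metis divide_pos_pos subset_UNIV zero_less_numeral)
      have "eventually (\<lambda>k. (1/2 :: real) ^ k < d) sequentially"
        using d LIMSEQ_realpow_zero[of "1/2 :: real"] order_tendstoD(2) by fastforce
      moreover have "eventually (\<lambda>k. dist (\<integral>\<omega>. f (\<omega> k) \<partial>L) (\<integral>x. f x \<partial>\<mu>) < e / 3) sequentially"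
        using e by (intro tendstoD[OF levels]) simp
      ultimately have "eventually (\<lambda>k. (1/2 :: real) ^ k < d \<and> dist (\<integral>\<omega>. f (\<omega> k) \<partial>L) (\<integral>x. f x \<partial>\<mu>) < e / 3) sequentially"
        by (rule eventually_conj)
      then obtain k where k: "(1/2 :: real) ^ k < d" "dist (\<integral>\<omega>. f (\<omega> k) \<partial>L) (\<integral>x. f x \<partial>\<mu>) < e / 3"
        using eventually_happens'[OF sequentially_bot] by blast
      have approx: "dist (\<Sum>i\<in>S n. w n i * f (node n i)) (\<Sum>i\<in>S n. w n i * f (a k (node n i))) \<le> e / 3" for n
      proof -
        have "dist (\<Sum>i\<in>S n. w n i * f (node n i)) (\<Sum>i\<in>S n. w n i * f (a k (node n i)))
            = \<bar>\<Sum>i\<in>S n. w n i * (f (node n i) - f (a k (node n i)))\<bar>"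
          by (simp add: dist_real_def sum_subtractf right_diff_distrib)
        also have "\<dots> \<le> (\<Sum>i\<in>S n. w n i * (e / 3))"
        proof (rule order_trans[OF sum_abs sum_mono])
          fix i assume i: "i \<in> S n"
          have "dist (node n i) (a k (node n i)) < d"
            using a_near[OF node[OF i], of k] k(1) by (simp add: dist_commute)
          then have "dist (f (node n i)) (f (a k (node n i))) < e / 3"
            using dist_f node[OF i] aN N(2) by blast
          then show "\<bar>w n i * (f (node n i) - f (a k (node n i)))\<bar> \<le> w n i * (e / 3)"
            using w[OF i] unfolding abs_mult dist_real_def
            by (intro mult_mono) auto
        qed
        also have "\<dots> = e / 3" by (simp only: sum_distrib_right[symmetric] w1 mult_1_left)
        finally show ?thesis .
      qed
      have "eventually (\<lambda>n. dist (\<Sum>i\<in>S n. w n i * f (a k (node n i))) (\<integral>\<omega>. f (\<omega> k) \<partial>L) < e / 3) F"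
        using e by (intro tendstoD[OF level]) simp
      then show "eventually (\<lambda>n. dist (\<Sum>i\<in>S n. w n i * f (node n i)) (\<integral>x. f x \<partial>\<mu>) < e) F"
      proof eventually_elim
        case (elim n)
        with approx[of n] k(2) show ?case unfolding dist_real_def by linarith
      qed
    qed
  qed
  show thesis
  proof (rule that[of \<mu> F])
    show "prob_space \<mu>" unfolding \<mu>_def by (rule L.prob_space_distr) simp
    show "AE x in \<mu>. x \<in> K"
      unfolding \<mu>_def using XK by (subst AE_distr_iff) (auto simp: borel_compact K)
  qed (use F lim_f in \<open>auto simp: \<mu>_def\<close>)
qed

section \<open>Bernstein weights and the representing measure\<close>

text \<open>
  The Bernstein operator maps a binomial coefficient, viewed as a polynomial in the node, to a multiple of a
  monomial without any error term.  Expand \<open>t\<^sup>a = t\<^sup>a (t + (1 - t))\<^sup>k\<^sup>-\<^sup>a\<close>.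
\<close>

lemma bernstein_moment:
  fixes t :: "'a::comm_ring_1"
  assumes "a \<le> k"
  shows "of_nat (k choose a) * t ^ a
    = (\<Sum>j\<le>k. of_nat (j choose a) * (of_nat (k choose j) * (t ^ j * (1 - t) ^ (k - j))))"
proof -
  have "t ^ a = t ^ a * (t + (1 - t)) ^ (k - a)" by simp
  also have "\<dots> = (\<Sum>l\<le>k - a. of_nat ((k - a) choose l) * t ^ (a + l) * (1 - t) ^ (k - a - l))"
    by (subst binomial_ring) (simp add: sum_distrib_left power_add mult_ac)
  finally have "of_nat (k choose a) * t ^ a
      = (\<Sum>l\<le>k - a. of_nat ((k choose a) * ((k - a) choose l)) * t ^ (a + l) * (1 - t) ^ (k - a - l))"
    by (simp add: sum_distrib_left mult.assoc)
  also have "\<dots> = (\<Sum>j\<in>{a..k}. of_nat ((k choose a) * ((k - a) choose (j - a))) * t ^ j * (1 - t) ^ (k - j))"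
    by (rule sum.reindex_bij_witness[of _ "\<lambda>j. j - a" "\<lambda>l. a + l"]) (use assms in auto)
  also have "\<dots> = (\<Sum>j\<in>{a..k}. of_nat (j choose a) * (of_nat (k choose j) * (t ^ j * (1 - t) ^ (k - j))))"
    by (intro sum.cong refl) (simp add: choose_mult[symmetric] mult_ac)
  also have "\<dots> = (\<Sum>j\<le>k. of_nat (j choose a) * (of_nat (k choose j) * (t ^ j * (1 - t) ^ (k - j))))"
    by (intro sum.mono_neutral_left) (auto simp: binomial_eq_0 not_le)
  finally show ?thesis .
qed

text \<open>
  The quotient of binomial coefficients is the product of the factors \<open>(j - l) / (k - l)\<close> for \<open>l < a\<close>, each of
  which differs from \<open>j / k\<close> by at most \<open>l / (k - l)\<close>.  The parameter \<open>A\<close> gives all factors the same error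
  bound; truncated subtraction handles the factors with \<open>l \<ge> j\<close>.
\<close>

lemma choose_ratio_approx:
  assumes "j \<le> k" "A < k" "a \<le> A"
  shows "\<bar>real (j choose a) / real (k choose a) - (real j / real k) ^ a\<bar> \<le> real a * (real A / (real k - real A))
    \<and> real (j choose a) \<le> real (k choose a)"
  using assms(3)
proof (induction a)
  case (Suc a)
  define q where "q = real (j choose a) / real (k choose a)"
  define f where "f = real (j - a) / real (k - a)"
  define t where "t = real j / real k"
  have k: "0 < k" "a < k" using assms Suc.prems by auto
  have kca: "0 < real (k choose a)" "0 < real (k choose Suc a)" using k by simp_all
  have absorb: "real (Suc a) * real (n choose Suc a) = real (n - a) * real (n choose a)" for n
    using binomial_absorb_comp[of n a] binomial_absorption[of a n]
    by (metis of_nat_mult)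
  have ratio: "real (j choose Suc a) / real (k choose Suc a) = q * f"
  proof -
    have "real (j choose Suc a) / real (k choose Suc a)
        = (real (Suc a) * real (j choose Suc a)) / (real (Suc a) * real (k choose Suc a))" by simp
    also have "\<dots> = q * f" unfolding absorb q_def f_def by (simp add: mult.commute)
    finally show ?thesis .
  qed
  have IH: "\<bar>q - t ^ a\<bar> \<le> real a * (real A / (real k - real A))" "real (j choose a) \<le> real (k choose a)"
    using Suc by (auto simp: q_def t_def)
  have f01: "0 \<le> f" "f \<le> 1" using assms(1) k by (auto simp: f_def)
  have t01: "0 \<le> t" "t \<le> 1" using assms(1) k by (auto simp: t_def)
  have q01: "0 \<le> q" "q \<le> 1" using IH(2) kca by (auto simp: q_def)
  have "\<bar>f - t\<bar> \<le> real a / (real k - real a)"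
  proof (cases "a \<le> j")
    case True
    have "t - f = real a * (real k - real j) / (real k * (real k - real a))"
      using True k by (simp add: f_def t_def of_nat_diff field_simps)
    also have "\<dots> = (real a / (real k - real a)) * ((real k - real j) / real k)"
      by (simp add: mult.commute)
    finally have eq: "t - f = (real a / (real k - real a)) * ((real k - real j) / real k)" .
    have "0 \<le> t - f" unfolding eq using k assms(1) by (intro mult_nonneg_nonneg divide_nonneg_nonneg) auto
    moreover have "t - f \<le> (real a / (real k - real a)) * 1"
      unfolding eq using k assms(1) by (intro mult_left_mono) auto
    ultimately show ?thesis by simp
  next
    case False
    then have "f = 0" by (simp add: f_def)
    moreover have "t \<le> real a / (real k - real a)"
      unfolding t_def using False k by (intro frac_le) auto
    ultimately show ?thesis using t01 by simp
  qed
  also have "\<dots> \<le> real A / (real k - real A)"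
    using Suc.prems assms by (intro frac_le) auto
  finally have ft: "\<bar>f - t\<bar> \<le> real A / (real k - real A)" .
  have "\<bar>q * f - t ^ a * t\<bar> = \<bar>(q - t ^ a) * f + t ^ a * (f - t)\<bar>" by (simp add: algebra_simps)
  also have "\<dots> \<le> \<bar>q - t ^ a\<bar> * f + t ^ a * \<bar>f - t\<bar>"
    using f01 t01 by (intro order_trans[OF abs_triangle_ineq]) (simp add: abs_mult)
  also have "\<dots> \<le> \<bar>q - t ^ a\<bar> * 1 + 1 * \<bar>f - t\<bar>"
    using f01 t01 by (intro add_mono mult_left_mono mult_right_mono) (auto simp: power_le_one)
  also have "\<dots> \<le> real a * (real A / (real k - real A)) + real A / (real k - real A)"
    using IH ft by simp
  also have "\<dots> = real (Suc a) * (real A / (real k - real A))"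
    by (simp only: of_nat_Suc distrib_right mult_1_left add.commute)
  finally have main: "\<bar>q * f - t ^ a * t\<bar> \<le> real (Suc a) * (real A / (real k - real A))" .
  have "q * f \<le> 1" using q01 f01 by (simp add: mult_le_one)
  then have "real (j choose Suc a) \<le> real (k choose Suc a)"
    using kca unfolding ratio[symmetric] by simp
  with main show ?case unfolding ratio t_def[symmetric] by (simp add: mult.commute)
qed simp

context ball_positive_functional begin

text \<open>
  The mass that the \<open>k\<close>-th discrete approximation of \<open>L\<close> puts on the node of the grid with index \<open>j\<close>.
\<close>

definition bernstein_weight :: "nat \<Rightarrow> ('v \<Rightarrow> nat) \<Rightarrow> real" where
  "bernstein_weight k j = L (\<Prod>i\<in>UNIV. of_nat (k choose j i) * (coord i ^ j i * (1 - coord i) ^ (k - j i)))"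

definition grid :: "nat \<Rightarrow> ('v \<Rightarrow> nat) set" where
  "grid k = PiE UNIV (\<lambda>_. {..k})"

lemma finite_grid [simp]: "finite (grid k)"
  unfolding grid_def by (rule finite_PiE) auto

lemma grid_le: "j \<in> grid k \<Longrightarrow> j i \<le> k"
  by (auto simp: grid_def)

lemma bernstein_weight_nonneg: "0 \<le> bernstein_weight k j"
  unfolding bernstein_weight_def by (rule L_bernstein_nonneg)

lemma L_of_nat_mult: "L (of_nat n * p) = real n * L p"
  using L_const_mult[of "real n" p] by simp

lemma bernstein_weight_moment:
  assumes "\<And>i. \<alpha> i \<le> k"
  shows "(\<Sum>j\<in>grid k. bernstein_weight k j * (\<Prod>i\<in>UNIV. real (j i choose \<alpha> i)))
    = (\<Prod>i\<in>UNIV. real (k choose \<alpha> i)) * L (\<Prod>i\<in>UNIV. coord i ^ \<alpha> i)"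
proof -
  have "(\<Prod>i\<in>UNIV. of_nat (k choose \<alpha> i) * coord i ^ \<alpha> i)
      = (\<Prod>i\<in>UNIV. \<Sum>j\<le>k. of_nat (j choose \<alpha> i) * (of_nat (k choose j) * (coord i ^ j * (1 - coord i) ^ (k - j))))"
    by (intro prod.cong refl bernstein_moment assms)
  also have "\<dots> = (\<Sum>j\<in>grid k. \<Prod>i\<in>UNIV. of_nat (j i choose \<alpha> i) * (of_nat (k choose j i) * (coord i ^ j i * (1 - coord i) ^ (k - j i))))"
    unfolding grid_def by (rule prod_sum_PiE) auto
  also have "\<dots> = (\<Sum>j\<in>grid k. of_nat (\<Prod>i\<in>UNIV. j i choose \<alpha> i) *
      (\<Prod>i\<in>UNIV. of_nat (k choose j i) * (coord i ^ j i * (1 - coord i) ^ (k - j i))))"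
    by (simp add: prod.distrib)
  finally have eq: "of_nat (\<Prod>i\<in>UNIV. k choose \<alpha> i) * (\<Prod>i\<in>UNIV. coord i ^ \<alpha> i)
      = (\<Sum>j\<in>grid k. of_nat (\<Prod>i\<in>UNIV. j i choose \<alpha> i) *
      (\<Prod>i\<in>UNIV. of_nat (k choose j i) * (coord i ^ j i * (1 - coord i) ^ (k - j i))))"
    by (simp add: prod.distrib)
  have "L (of_nat (\<Prod>i\<in>UNIV. k choose \<alpha> i) * (\<Prod>i\<in>UNIV. coord i ^ \<alpha> i))
      = (\<Sum>j\<in>grid k. real (\<Prod>i\<in>UNIV. j i choose \<alpha> i) * bernstein_weight k j)"
    unfolding eq L_sum L_of_nat_mult bernstein_weight_def ..
  then show ?thesis unfolding L_of_nat_mult by (simp add: mult.commute)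
qed

lemma sum_bernstein_weight: "(\<Sum>j\<in>grid k. bernstein_weight k j) = L 1"
  using bernstein_weight_moment[of "\<lambda>_. 0" k] by simp

definition node :: "nat \<Rightarrow> ('v \<Rightarrow> nat) \<Rightarrow> real^'v" where
  "node k j = (\<chi> i. 2 * radius * (real (j i) / real k) - radius)"

definition discrete :: "nat \<Rightarrow> 'v rpoly \<Rightarrow> real" where
  "discrete k p = (\<Sum>j\<in>grid k. bernstein_weight k j * poly_eval p (($) (node k j)))"

lemma poly_eval_coord_node: "poly_eval (coord i) (($) (node k j)) = real (j i) / real k"
  using radius_pos by (simp add: coord_def node_def field_simps)

text \<open>
  The exact moments of \<open>bernstein_weight_moment\<close> involve quotients of binomial coefficients; these are close to
  the powers \<open>(j\<^sub>i / k)\<^sup>\<alpha>\<^sup>i\<close> uniformly over the grid, and the total mass is \<open>L 1\<close> for every \<open>k\<close>.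
\<close>

lemma discrete_coord_tendsto:
  "(\<lambda>k. discrete k (\<Prod>i\<in>UNIV. coord i ^ \<alpha> i)) \<longlonglongrightarrow> L (\<Prod>i\<in>UNIV. coord i ^ \<alpha> i)"
proof -
  define A where "A = (\<Sum>i\<in>UNIV. \<alpha> i)"
  have \<alpha>: "\<alpha> i \<le> A" for i unfolding A_def by (rule member_le_sum) auto
  define d where "d k = real CARD('v) * (real A * (real A / (real k - real A)))" for k :: nat
  have "norm (discrete k (\<Prod>i\<in>UNIV. coord i ^ \<alpha> i) - L (\<Prod>i\<in>UNIV. coord i ^ \<alpha> i)) \<le> L 1 * d k" if k: "A < k" for k
  proof -
    have \<alpha>k: "\<alpha> i \<le> k" for i using \<alpha>[of i] k by simp
    have pos: "0 < (\<Prod>i\<in>UNIV. real (k choose \<alpha> i))" using \<alpha>k by (intro prod_pos) simp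
    have "L (\<Prod>i\<in>UNIV. coord i ^ \<alpha> i)
        = (\<Sum>j\<in>grid k. bernstein_weight k j * (\<Prod>i\<in>UNIV. real (j i choose \<alpha> i))) / (\<Prod>i\<in>UNIV. real (k choose \<alpha> i))"
      unfolding bernstein_weight_moment[of \<alpha> k, OF \<alpha>k]
      by (rule nonzero_mult_div_cancel_left[symmetric]) (use pos in linarith)
    also have "\<dots> = (\<Sum>j\<in>grid k. bernstein_weight k j * (\<Prod>i\<in>UNIV. real (j i choose \<alpha> i) / real (k choose \<alpha> i)))"
      by (simp add: sum_divide_distrib prod_dividef)
    finally have "discrete k (\<Prod>i\<in>UNIV. coord i ^ \<alpha> i) - L (\<Prod>i\<in>UNIV. coord i ^ \<alpha> i)
        = (\<Sum>j\<in>grid k. bernstein_weight k j * ((\<Prod>i\<in>UNIV. (real (j i) / real k) ^ \<alpha> i)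
            - (\<Prod>i\<in>UNIV. real (j i choose \<alpha> i) / real (k choose \<alpha> i))))"
      by (simp add: discrete_def poly_eval_coord_node sum_subtractf right_diff_distrib)
    also have "norm \<dots> \<le> (\<Sum>j\<in>grid k. bernstein_weight k j * d k)"
    proof (rule sum_norm_le)
      fix j assume j: "j \<in> grid k"
      have approx: "\<bar>real (j i choose \<alpha> i) / real (k choose \<alpha> i) - (real (j i) / real k) ^ \<alpha> i\<bar>
          \<le> real (\<alpha> i) * (real A / (real k - real A))" "real (j i choose \<alpha> i) \<le> real (k choose \<alpha> i)" for i
        using choose_ratio_approx[OF grid_le[OF j] k \<alpha>] by auto
      have "norm ((\<Prod>i\<in>UNIV. (real (j i) / real k) ^ \<alpha> i) - (\<Prod>i\<in>UNIV. real (j i choose \<alpha> i) / real (k choose \<alpha> i)))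
          \<le> (\<Sum>i\<in>UNIV. norm ((real (j i) / real k) ^ \<alpha> i - real (j i choose \<alpha> i) / real (k choose \<alpha> i)))"
      proof (rule norm_prod_diff)
        fix i
        show "norm ((real (j i) / real k) ^ \<alpha> i) \<le> 1"
          using grid_le[OF j, of i] k by (simp add: power_le_one)
        show "norm (real (j i choose \<alpha> i) / real (k choose \<alpha> i)) \<le> 1"
          using approx(2)[of i] \<alpha>k[of i] by simp
      qed
      also have "\<dots> \<le> (\<Sum>i\<in>(UNIV :: 'v set). real A * (real A / (real k - real A)))"
      proof (rule sum_mono)
        fix i
        have "norm ((real (j i) / real k) ^ \<alpha> i - real (j i choose \<alpha> i) / real (k choose \<alpha> i))
            \<le> real (\<alpha> i) * (real A / (real k - real A))"
          using approx(1)[of i] by (simp add: abs_minus_commute)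
        also have "\<dots> \<le> real A * (real A / (real k - real A))"
          using \<alpha>[of i] k by (intro mult_right_mono) auto
        finally show "norm ((real (j i) / real k) ^ \<alpha> i - real (j i choose \<alpha> i) / real (k choose \<alpha> i))
            \<le> real A * (real A / (real k - real A))" .
      qed
      also have "\<dots> = d k" by (simp add: d_def)
      finally show "norm (bernstein_weight k j * ((\<Prod>i\<in>UNIV. (real (j i) / real k) ^ \<alpha> i)
            - (\<Prod>i\<in>UNIV. real (j i choose \<alpha> i) / real (k choose \<alpha> i)))) \<le> bernstein_weight k j * d k"
        using bernstein_weight_nonneg[of k j] by (simp only: norm_mult) (simp add: mult_left_mono)
    qed
    also have "\<dots> = L 1 * d k" by (simp only: sum_distrib_right[symmetric] sum_bernstein_weight)
    finally show ?thesis .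
  qed
  then have "eventually (\<lambda>k. norm (discrete k (\<Prod>i\<in>UNIV. coord i ^ \<alpha> i) - L (\<Prod>i\<in>UNIV. coord i ^ \<alpha> i)) \<le> L 1 * d k) sequentially"
    by (intro eventually_mono[OF eventually_gt_at_top[of A]])
  moreover have "d \<longlonglongrightarrow> 0"
    unfolding d_def by real_asymp
  then have "(\<lambda>k. L 1 * d k) \<longlonglongrightarrow> 0"
    by (rule tendsto_mult_right_zero)
  ultimately have "(\<lambda>k. discrete k (\<Prod>i\<in>UNIV. coord i ^ \<alpha> i) - L (\<Prod>i\<in>UNIV. coord i ^ \<alpha> i)) \<longlonglongrightarrow> 0"
    by (rule Lim_null_comparison)
  then show ?thesis by (rule LIM_zero_cancel)
qed

lemma discrete_add: "discrete k (p + q) = discrete k p + discrete k q"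
  by (simp add: discrete_def distrib_left sum.distrib)

lemma discrete_diff: "discrete k (p - q) = discrete k p - discrete k q"
  by (simp add: discrete_def right_diff_distrib sum_subtractf)

lemma discrete_const_mult: "discrete k (const_poly c * p) = c * discrete k p"
  by (simp add: discrete_def sum_distrib_left mult_ac)

text \<open>
  Convergence is known on products of the affine coordinates, and the variables are affine functions of them.  The
  factor \<open>\<Prod>\<^sub>i coord i\<^sup>\<alpha>\<^sup>i\<close> in the induction hypothesis absorbs the coordinates produced by a new variable.
\<close>

lemma discrete_tendsto: "(\<lambda>k. discrete k p) \<longlonglongrightarrow> L p"
proof -
  have "\<forall>\<alpha>. (\<lambda>k. discrete k (p * (\<Prod>i\<in>UNIV. coord i ^ \<alpha> i))) \<longlonglongrightarrow> L (p * (\<Prod>i\<in>UNIV. coord i ^ \<alpha> i))"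
  proof (induction p rule: rpoly_induct)
    case (const c)
    then show ?case
      unfolding discrete_const_mult L_const_mult by (intro allI tendsto_mult_left discrete_coord_tendsto)
  next
    case (add p q)
    then show ?case unfolding distrib_right discrete_add L_add by (intro allI tendsto_add) auto
  next
    case (pvar p i)
    show ?case
    proof
      fix \<alpha> :: "'v \<Rightarrow> nat"
      have up: "coord i * (\<Prod>i\<in>UNIV. coord i ^ \<alpha> i) = (\<Prod>l\<in>UNIV. coord l ^ (\<alpha>(i := Suc (\<alpha> i))) l)"
      proof -
        have "(\<Prod>l\<in>UNIV. coord l ^ (\<alpha>(i := Suc (\<alpha> i))) l)
            = coord i ^ Suc (\<alpha> i) * (\<Prod>l\<in>UNIV - {i}. coord l ^ \<alpha> l)"
          by (subst prod.remove[of UNIV i]) (auto intro!: prod.cong)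
        also have "\<dots> = coord i * (\<Prod>i\<in>UNIV. coord i ^ \<alpha> i)"
          by (subst prod.remove[of UNIV i "\<lambda>l. coord l ^ \<alpha> l"]) (auto simp: mult.assoc)
        finally show ?thesis ..
      qed
      have eq: "pvar i * p * (\<Prod>i\<in>UNIV. coord i ^ \<alpha> i)
          = const_poly (2 * radius) * (p * (\<Prod>l\<in>UNIV. coord l ^ (\<alpha>(i := Suc (\<alpha> i))) l)) - const_poly radius * (p * (\<Prod>i\<in>UNIV. coord i ^ \<alpha> i))"
        unfolding up[symmetric] by (subst pvar_eq_coord) (simp add: algebra_simps)
      show "(\<lambda>k. discrete k (pvar i * p * (\<Prod>i\<in>UNIV. coord i ^ \<alpha> i))) \<longlonglongrightarrow> L (pvar i * p * (\<Prod>i\<in>UNIV. coord i ^ \<alpha> i))"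
        unfolding eq discrete_diff L_diff discrete_const_mult L_const_mult
        by (intro tendsto_diff tendsto_mult_left pvar[rule_format])
    qed
  qed
  from this[rule_format, of "\<lambda>_. 0"] show ?thesis by simp
qed

text \<open>
  The discrete measures have total mass \<open>L 1\<close>.  If this is \<open>0\<close>, the Cauchy-Schwarz inequality gives \<open>L = 0\<close>;
  otherwise they are normalized, and \<open>\<mu>\<close> is \<open>L 1\<close> times a weak cluster point.  The index is shifted by
  one because the grid with \<open>k = 0\<close> has no meaningful nodes.
\<close>

theorem representing_measure:
  obtains \<mu> :: "(real^'v) measure" where "finite_measure \<mu>" "sets \<mu> = sets borel"
    "AE x in \<mu>. x \<in> cbox (\<chi> i. - radius) (\<chi> i. radius)" "\<And>p. L p = (\<integral>x. poly_eval p (($) x) \<partial>\<mu>)"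
proof (cases "L 1 = 0")
  case True
  have "L p = 0" for p
    using L_Cauchy_Schwarz[OF positive_multiplier_1, of p 1] True by simp
  then show thesis by (intro that[of "null_measure borel"]) 
      (auto intro!: finite_measureI AE_I'[of UNIV] simp: null_sets_def)
next
  case False
  then have L1: "0 < L 1" using L_square[of 1] by simp
  obtain \<mu> F where "prob_space \<mu>" and \<mu>: "sets \<mu> = sets borel" "AE x in \<mu>. x \<in> cbox (\<chi> i. - radius) (\<chi> i. radius)"
    and F: "F \<noteq> bot" "F \<le> sequentially"
    and lim: "\<And>f :: real^'v \<Rightarrow> real. continuous_on UNIV f \<Longrightarrow>
      ((\<lambda>n. \<Sum>j\<in>grid (Suc n). bernstein_weight (Suc n) j / L 1 * f (node (Suc n) j)) \<longlongrightarrow> (\<integral>x. f x \<partial>\<mu>)) F"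
  proof (rule discrete_measures_weak_cluster_point[of "cbox (\<chi> i. - radius) (\<chi> i. radius)" "\<lambda>n. grid (Suc n)"
        "\<lambda>n. node (Suc n)" "\<lambda>n j. bernstein_weight (Suc n) j / L 1"])
    show "node (Suc n) j \<in> cbox (\<chi> i. - radius) (\<chi> i. radius)" if "j \<in> grid (Suc n)" for n j
    proof -
      have "0 \<le> real (j i) / real (Suc n)" "real (j i) / real (Suc n) \<le> 1" for i
        using grid_le[OF that, of i] by auto
      then have "0 \<le> 2 * radius * (real (j i) / real (Suc n))" "2 * radius * (real (j i) / real (Suc n)) \<le> 2 * radius * 1" for i
        using radius_pos by (intro mult_nonneg_nonneg mult_left_mono; simp)+
      then show ?thesis by (simp add: mem_box_cart node_def)
    qed
    show "(\<Sum>j\<in>grid (Suc n). bernstein_weight (Suc n) j / L 1) = 1" for n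
      using L1 by (simp add: sum_divide_distrib[symmetric] sum_bernstein_weight)
  qed (use L1 bernstein_weight_nonneg in auto)
  interpret prob_space \<mu> by fact
  have int: "(\<integral>x. poly_eval p (($) x) \<partial>\<mu>) = L p / L 1" for p
  proof -
    have "((\<lambda>n. discrete (Suc n) p / L 1) \<longlongrightarrow> (\<integral>x. poly_eval p (($) x) \<partial>\<mu>)) F"
      using lim[OF continuous_on_poly_eval] by (simp add: discrete_def sum_divide_distrib)
    moreover have "((\<lambda>n. discrete (Suc n) p / L 1) \<longlongrightarrow> L p / L 1) F"
      using L1 by (intro tendsto_divide tendsto_const tendsto_mono[OF F(2)] LIMSEQ_Suc discrete_tendsto) auto
    ultimately show ?thesis by (rule tendsto_unique[OF F(1)])
  qed
  show thesis
  proof (rule that[of "density \<mu> (\<lambda>_. ennreal (L 1))"])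
    show "finite_measure (density \<mu> (\<lambda>_. ennreal (L 1)))"
      by (rule finite_measureI) (simp add: emeasure_density_const emeasure_eq_measure ennreal_mult_eq_top_iff)
    show "AE x in density \<mu> (\<lambda>_. ennreal (L 1)). x \<in> cbox (\<chi> i. - radius) (\<chi> i. radius)"
      using \<mu>(2) by (subst AE_density) auto
    show "L p = (\<integral>x. poly_eval p (($) x) \<partial>density \<mu> (\<lambda>_. ennreal (L 1)))" for p
    proof -
      have "(\<lambda>x :: real^'v. poly_eval p (($) x)) \<in> borel_measurable borel"
        by (intro borel_measurable_continuous_onI continuous_on_poly_eval)
      then show ?thesis
        using L1 int[of p] by (subst integral_density) (auto simp: measurable_cong_sets[OF \<mu>(1) refl])
    qed
  qed (use \<mu> in simp)
qed

end

section \<open>Supports, Carleman conditions and quadratic modules\<close>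

text \<open>
  The complement of the support is a union of null sets from a countable basis of the topology.
\<close>

lemma AE_in_measure_support:
  fixes M :: "'a::second_countable_topology measure"
  assumes sets: "sets M = sets borel"
  shows "AE x in M. x \<in> measure_support M"
proof -
  obtain B :: "'a set set" where B: "countable B" "topological_basis B"
    using ex_countable_basis by blast
  define C where "C = {U \<in> B. emeasure M U = 0}"
  have "\<Union>C \<in> null_sets M"
  proof (rule null_sets_UN'[where N = id, simplified])
    show "countable C" using B(1) by (auto simp: C_def)
    show "U \<in> null_sets M" if "U \<in> C" for U
      using that topological_basis_open[OF B(2)] sets by (auto simp: C_def null_sets_def)
  qed
  moreover have "- measure_support M \<subseteq> \<Union>C"
  proof
    fix x assume "x \<in> - measure_support M"
    then obtain U where U: "open U" "x \<in> U" "emeasure M U = 0"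
      by (auto simp: measure_support_def)
    then obtain V where V: "V \<in> B" "x \<in> V" "V \<subseteq> U"
      using topological_basisE[OF B(2)] by metis
    have "emeasure M V \<le> emeasure M U"
      using V(3) U(1) sets by (intro emeasure_mono) auto
    then have "V \<in> C" using U(3) V(1) by (simp add: C_def)
    then show "x \<in> \<Union>C" using V(2) by blast
  qed
  ultimately show ?thesis by (intro AE_I'[of "\<Union>C"]) auto
qed

lemma real_polynomial_function_monom:
  "real_polynomial_function (\<lambda>x :: real^'n. monom_eval \<alpha> (($) x))"
  using real_polynomial_function_poly_eval[of "Poly_Mapping.single \<alpha> 1"]
  by (simp add: poly_eval_riesz)

lemma real_polynomial_function_poly_eval2_x:
  "real_polynomial_function (\<lambda>x. poly_eval2 h x y)"
proof (induction h rule: rpoly_induct)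
  case (pvar p i)
  have "real_polynomial_function (\<lambda>x. poly_eval2 (pvar i) x y)"
    by (cases i) (auto intro!: real_polynomial_function.intros(1,2) bounded_linear_vec_nth)
  from real_polynomial_function.intros(4)[OF this pvar] show ?case by simp
qed (auto intro: real_polynomial_function.intros)

lemma poly_eval2_expand: "poly_eval2 h x y = (\<Sum>\<gamma>\<in>Poly_Mapping.keys h. Poly_Mapping.lookup h \<gamma> *
    (monom_eval (Poly_Mapping.map_key Inl \<gamma>) (($) x) * monom_eval (Poly_Mapping.map_key Inr \<gamma>) (($) y)))"
  by (simp add: poly_eval2_def poly_eval_def monom_eval_sum)

lemma integral_poly_eval2_x:
  assumes "finite_moments \<mu>"
  shows "(\<integral>x. poly_eval2 h x y \<partial>\<mu>) = (\<Sum>\<gamma>\<in>Poly_Mapping.keys h. Poly_Mapping.lookup h \<gamma> *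
    ((\<integral>x. monom_eval (Poly_Mapping.map_key Inl \<gamma>) (($) x) \<partial>\<mu>) * monom_eval (Poly_Mapping.map_key Inr \<gamma>) (($) y)))"
proof -
  have "integrable \<mu> (\<lambda>x. monom_eval \<beta> (($) x))" for \<beta>
    using assms by (simp add: finite_moments_def)
  then show ?thesis unfolding poly_eval2_expand by simp
qed

lemma real_polynomial_function_integral_x:
  assumes "finite_moments \<mu>"
  shows "real_polynomial_function (\<lambda>y. \<integral>x. poly_eval2 h x y \<partial>\<mu>)"
  unfolding integral_poly_eval2_x[OF assms]
  by (intro real_polynomial_function_sum real_polynomial_function.intros(2,4) real_polynomial_function_monom) simp

lemma integral_poly_eval2_swap:
  assumes \<mu>: "finite_moments \<mu>" and \<nu>: "finite_moments \<nu>"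
  shows "(\<integral>y. \<integral>x. poly_eval2 h x y \<partial>\<mu> \<partial>\<nu>) = (\<integral>x. poly_eval (integral_y \<nu> h) (($) x) \<partial>\<mu>)"
proof -
  have "integrable \<mu> (\<lambda>x. monom_eval \<beta> (($) x))" "integrable \<nu> (\<lambda>y. monom_eval \<beta>' (($) y))" for \<beta> \<beta>'
    using assms by (simp_all add: finite_moments_def)
  then show ?thesis
    unfolding poly_eval_integral_y[OF \<nu>] integral_poly_eval2_x[OF \<mu>]
    unfolding poly_eval2_expand by simp
qed

lemma polynomial_moments_of_finite_moments:
  fixes \<nu> :: "(real^'m::finite) measure"
  assumes "sets \<nu> = sets borel" "finite_measure \<nu>" "finite_moments \<nu>"
  shows "polynomial_moments \<nu>"
proof -
  interpret finite_measure \<nu> by fact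
  show ?thesis
  proof
    fix f :: "real^'m \<Rightarrow> real" assume "real_polynomial_function f"
    then obtain p where p: "\<And>x. poly_eval p (($) x) = f x"
      using poly_eval_of_real_polynomial_function by blast
    have "integrable \<nu> (\<lambda>x. poly_eval p (($) x))"
      using assms(3) by (simp add: poly_eval_def finite_moments_def)
    then show "integrable \<nu> f" by (simp add: p)
  qed fact
qed

text \<open>
  If the terms \<open>s\<^sub>d\<close> with the increased moments are summable, they tend to \<open>0\<close>, so the moments eventually exceed \<open>1\<close>;
  then adding \<open>1\<close> changes the moment by a factor of at most \<open>2\<close> and the term by a factor of at least
  \<open>1 / 2\<close>, and Carleman's series would converge.  Vanishing moments are excluded first:
  one of them forces the coordinate to vanish almost everywhere, and then \<open>s\<^sub>d = 1\<close> for all \<open>d\<close>.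
\<close>

lemma carleman_condition_coordinate:
  fixes \<nu> :: "(real^'m::finite) measure"
  assumes sets: "sets \<nu> = sets borel" and fm: "finite_moments \<nu>" and carleman: "carleman \<nu>"
  shows "carleman_condition \<nu> (\<lambda>y. y $ j)"
  unfolding carleman_condition_def
proof
  define m where "m d = (\<integral>y. (y $ j) ^ (2 * d) \<partial>\<nu>)" for d :: nat
  define s where "s d = (1 + m (Suc d)) powr (- 1 / real (2 * Suc d))" for d
  assume "summable (\<lambda>d. (1 + (\<integral>y. (y $ j) ^ (2 * Suc d) \<partial>\<nu>)) powr (- 1 / real (2 * Suc d)))"
  then have s: "summable s" by (simp add: s_def[abs_def] m_def)
  have m0: "0 \<le> m d" for d by (simp add: m_def power_mult)
  have int: "integrable \<nu> (\<lambda>y. (y $ j) ^ k)" for k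
  proof -
    have "monom_eval (Poly_Mapping.single j k) (($) y) = (y $ j) ^ k" for y :: "real^'m"
    proof -
      have "monom_eval (Poly_Mapping.single j k) (($) y) = (\<Prod>i\<in>UNIV. if i = j then y $ j ^ k else 1)"
        unfolding monom_eval_def by (intro prod.cong) (auto simp: lookup_single when_def)
      then show ?thesis by simp
    qed
    moreover have "integrable \<nu> (\<lambda>y. monom_eval (Poly_Mapping.single j k) (($) y))"
      using fm by (simp add: finite_moments_def)
    ultimately show ?thesis by simp
  qed
  have mpos: "0 < m (Suc d)" for d
  proof (rule ccontr)
    assume "\<not> 0 < m (Suc d)"
    then have "(\<integral>y. (y $ j) ^ (2 * Suc d) \<partial>\<nu>) = 0" using m0[of "Suc d"] by (simp add: m_def)
    moreover have "AE y in \<nu>. 0 \<le> (y $ j) ^ (2 * Suc d)"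
      by (intro AE_I2 zero_le_even_power) simp
    ultimately have "AE y in \<nu>. (y $ j) ^ (2 * Suc d) = 0"
      using integral_nonneg_eq_0_iff_AE[OF int] by blast
    then have "AE y in \<nu>. y $ j = 0" by eventually_elim (simp only: power_eq_0_iff)
    then have "m (Suc k) = 0" for k
      unfolding m_def by (intro integral_eq_zero_AE) auto
    then have "s = (\<lambda>_. 1)" by (simp add: s_def fun_eq_iff)
    with s show False by (simp add: summable_const_iff)
  qed
  define t where "t d = m (Suc d) powr (- 1 / real (2 * Suc d))" for d
  have two: "1 / 2 \<le> 2 powr (- 1 / real (2 * Suc d))" for d
  proof -
    have "2 powr (- 1 :: real) \<le> 2 powr (- 1 / real (2 * Suc d))"
      by (intro powr_mono) (auto simp: field_simps)
    then show ?thesis by (simp add: powr_minus_divide)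
  qed
  have "eventually (\<lambda>d. s d < 1 / 2) sequentially"
    using summable_LIMSEQ_zero[OF s] by (rule order_tendstoD) simp
  then have "eventually (\<lambda>d. norm (t d) \<le> 2 * s d) sequentially"
  proof eventually_elim
    case (elim d)
    have "1 \<le> m (Suc d)"
    proof (rule ccontr)
      assume "\<not> 1 \<le> m (Suc d)"
      then have "2 powr (- 1 / real (2 * Suc d)) \<le> s d"
        unfolding s_def using mpos[of d] by (intro powr_mono2') auto
      with two[of d] elim show False by linarith
    qed
    then have "(2 * m (Suc d)) powr (- 1 / real (2 * Suc d)) \<le> s d"
      unfolding s_def by (intro powr_mono2') auto
    then have "2 powr (- 1 / real (2 * Suc d)) * t d \<le> s d"
      using mpos[of d] by (simp add: powr_mult t_def)
    moreover have "1 / 2 * t d \<le> 2 powr (- 1 / real (2 * Suc d)) * t d"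
      by (intro mult_right_mono two) (simp add: t_def)
    ultimately show ?case by (simp add: t_def)
  qed
  moreover have "summable (\<lambda>d. 2 * s d)" using s by (rule summable_mult)
  ultimately have t: "summable t" by (rule summable_comparison_test_ev)
  have "(\<lambda>d. carleman_term \<nu> j (Suc d)) = (\<lambda>d. ennreal (t d))"
    using mpos unfolding carleman_term_def t_def m_def[symmetric]
    by (simp add: fun_eq_iff less_imp_neq[THEN not_sym])
  moreover have "suminf (\<lambda>d. ennreal (t d)) = ennreal (suminf t)"
    by (rule suminf_ennreal_eq[OF _ summable_sums[OF t]]) (simp add: t_def)
  ultimately have "suminf (\<lambda>d. carleman_term \<nu> j (Suc d)) = ennreal (suminf t)"
    by (simp only:)
  moreover have "suminf (\<lambda>d. carleman_term \<nu> j (Suc d)) = \<infinity>"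
    using carleman by (simp add: carleman_def)
  ultimately show False by simp
qed

text \<open>
  For a bounded function the moment of order \<open>n\<close> grows at most like \<open>D\<^sup>n\<close>, so the terms of Carleman's series stay
  above \<open>1 / D\<close>.
\<close>

lemma (in finite_measure) carleman_condition_bounded:
  assumes [measurable]: "f \<in> borel_measurable M" and bound: "AE x in M. \<bar>f x\<bar> \<le> B"
  shows "carleman_condition M f"
  unfolding carleman_condition_def
proof
  define c where "c = measure M (space M)"
  define D where "D = (1 + c) * max 1 B"
  have c: "0 \<le> c" by (simp add: c_def)
  then have D: "1 \<le> D" unfolding D_def using mult_mono[of 1 "1 + c" 1 "max 1 B"] by simp
  assume s: "summable (\<lambda>d. (1 + (\<integral>x. f x ^ (2 * Suc d) \<partial>M)) powr (- 1 / real (2 * Suc d)))"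
  have "1 / D \<le> (1 + (\<integral>x. f x ^ (2 * Suc d) \<partial>M)) powr (- 1 / real (2 * Suc d))" for d
  proof -
    define n where "n = 2 * Suc d"
    have n: "1 \<le> n" "even n" by (auto simp: n_def)
    have I0: "0 \<le> (\<integral>x. f x ^ n \<partial>M)" using n(2) by (intro integral_nonneg_AE) auto
    have "(\<integral>x. f x ^ n \<partial>M) \<le> (\<integral>x. max 1 B ^ n \<partial>M)"
    proof (rule integral_mono_AE')
      show "AE x in M. f x ^ n \<le> max 1 B ^ n"
        using bound
      proof eventually_elim
        case (elim x)
        have "f x ^ n = \<bar>f x\<bar> ^ n" using n(2) by (simp add: power_even_abs)
        also have "\<dots> \<le> max 1 B ^ n" using elim by (intro power_mono) auto
        finally show ?case .
      qed
    qed auto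
    then have "1 + (\<integral>x. f x ^ n \<partial>M) \<le> max 1 B ^ n + c * max 1 B ^ n"
      by (simp add: c_def add_mono one_le_power mult.commute)
    also have "\<dots> = (1 + c) * max 1 B ^ n" by (simp add: distrib_right)
    also have "\<dots> \<le> (1 + c) ^ n * max 1 B ^ n"
      using c n(1) by (intro mult_right_mono self_le_power) auto
    also have "\<dots> = D powr real n" using D by (simp add: D_def power_mult_distrib powr_realpow)
    finally have le: "1 + (\<integral>x. f x ^ n \<partial>M) \<le> D powr real n" .
    have "1 / D = (D powr real n) powr (- 1 / real n)"
      using D n(1) by (simp add: powr_powr powr_minus_divide)
    also have "\<dots> \<le> (1 + (\<integral>x. f x ^ n \<partial>M)) powr (- 1 / real n)"
      using le I0 by (intro powr_mono2') auto
    finally show ?thesis by (simp add: n_def)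
  qed
  then have "1 / D \<le> 0"
    using summable_LIMSEQ_zero[OF s] by (intro LIMSEQ_le_const) auto
  with D show False by simp
qed

lemma sums_of_squares_0: "0 \<in> sums_of_squares"
  unfolding sums_of_squares_def by (auto intro!: exI[of _ 0])

lemma sums_of_squares_power2: "q\<^sup>2 \<in> sums_of_squares"
  unfolding sums_of_squares_def by (auto intro!: exI[of _ 1] exI[of _ "\<lambda>_. q"])

lemma sums_of_squares_mult_power2:
  assumes "p \<in> sums_of_squares"
  shows "q\<^sup>2 * p \<in> sums_of_squares"
proof -
  obtain k :: nat and r where "p = (\<Sum>i<k. (r i)\<^sup>2)"
    using assms by (auto simp: sums_of_squares_def)
  then have "q\<^sup>2 * p = (\<Sum>i<k. (q * r i)\<^sup>2)"
    by (simp add: sum_distrib_left power_mult_distrib)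
  then show ?thesis unfolding sums_of_squares_def by auto
qed

lemma poly_eval2_sum_of_squares:
  assumes "p \<in> sums_of_squares"
  shows "0 \<le> poly_eval2 p x y"
  using assms by (auto simp: sums_of_squares_def poly_eval2_def sum_nonneg)

lemma quadratic_module_generator:
  assumes "j \<le> s"
  shows "integral_y \<nu> (q\<^sup>2 * g j) \<in> quadratic_module s g \<nu>"
proof -
  define \<tau> where "\<tau> i = (if i = j then q\<^sup>2 else 0)" for i
  have "(\<Sum>i\<le>s. integral_y \<nu> (\<tau> i * g i)) = (\<Sum>i\<le>s. if i = j then integral_y \<nu> (q\<^sup>2 * g j) else 0)"
    by (intro sum.cong) (auto simp: \<tau>_def)
  then have "integral_y \<nu> (q\<^sup>2 * g j) = (\<Sum>i\<le>s. integral_y \<nu> (\<tau> i * g i))"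
    using assms by simp
  moreover have "\<forall>i\<le>s. \<tau> i \<in> sums_of_squares"
    by (auto simp: \<tau>_def sums_of_squares_0 sums_of_squares_power2)
  ultimately show ?thesis unfolding quadratic_module_def by blast
qed

lemma quadratic_module_mult_power2:
  fixes g :: "nat \<Rightarrow> ('n::finite + 'm::finite) rpoly" and p :: "'n rpoly"
  assumes "f \<in> quadratic_module s g \<nu>"
  shows "p\<^sup>2 * f \<in> quadratic_module s g \<nu>"
proof -
  obtain \<tau> where f: "f = (\<Sum>j\<le>s. integral_y \<nu> (\<tau> j * g j))" and \<tau>: "\<forall>j\<le>s. \<tau> j \<in> sums_of_squares"
    using assms unfolding quadratic_module_def by blast
  obtain p' :: "('n + 'm) rpoly" where p': "\<And>h. integral_y \<nu> (p' * h) = p * integral_y \<nu> h"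
    using ex_polynomial_in_x[of p] by metis
  have "integral_y \<nu> (p'\<^sup>2 * \<tau> j * g j) = p\<^sup>2 * integral_y \<nu> (\<tau> j * g j)" for j
    by (simp add: power2_eq_square mult.assoc p')
  then have "p\<^sup>2 * f = (\<Sum>j\<le>s. integral_y \<nu> (p'\<^sup>2 * \<tau> j * g j))"
    by (simp add: f sum_distrib_left)
  moreover have "\<forall>j\<le>s. p'\<^sup>2 * \<tau> j \<in> sums_of_squares"
    using \<tau> by (simp add: sums_of_squares_mult_power2)
  ultimately show ?thesis
    unfolding quadratic_module_def by (auto intro!: exI[of _ "\<lambda>j. p'\<^sup>2 * \<tau> j"])
qed

lemma riesz_eq_integral:
  assumes "\<And>\<alpha>. integrable \<mu> (\<lambda>x. monom_eval \<alpha> (($) x)) \<and> z \<alpha> = (\<integral>x. monom_eval \<alpha> (($) x) \<partial>\<mu>)"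
  shows "riesz z f = (\<integral>x. poly_eval f (($) x) \<partial>\<mu>)"
  using assms by (simp add: riesz_def poly_eval_def)

lemma riesz_nonneg_of_moment_sequence:
  fixes g :: "nat \<Rightarrow> ('n::finite + 'm::finite) rpoly"
  assumes g0: "g 0 = 1" and K: "K = {x. \<forall>y\<in>measure_support \<nu>. \<forall>j\<in>{1..s}. 0 \<le> poly_eval2 (g j) x y}"
    and \<nu>: "sets \<nu> = sets borel" "finite_moments \<nu>"
    and z: "moment_sequence K z" and f: "f \<in> quadratic_module s g \<nu>"
  shows "0 \<le> riesz z f"
proof -
  obtain \<mu> where \<mu>: "sets \<mu> = sets borel" "measure_support \<mu> \<subseteq> K"
    and mom: "\<And>\<alpha>. integrable \<mu> (\<lambda>x. monom_eval \<alpha> (($) x)) \<and> z \<alpha> = (\<integral>x. monom_eval \<alpha> (($) x) \<partial>\<mu>)"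
    using z unfolding moment_sequence_def by blast
  obtain \<tau> where f: "f = (\<Sum>j\<le>s. integral_y \<nu> (\<tau> j * g j))" and \<tau>: "\<forall>j\<le>s. \<tau> j \<in> sums_of_squares"
    using f unfolding quadratic_module_def by blast
  have "0 \<le> poly_eval f (($) x)" if x: "x \<in> K" for x
  proof -
    have "0 \<le> (\<integral>y. poly_eval2 (\<tau> j * g j) x y \<partial>\<nu>)" if "j \<le> s" for j
    proof (rule integral_nonneg_AE)
      have "0 \<le> poly_eval2 (g j) x y" if "y \<in> measure_support \<nu>" for y
        using x K that \<open>j \<le> s\<close> g0 by (cases "j = 0") auto
      then show "AE y in \<nu>. 0 \<le> poly_eval2 (\<tau> j * g j) x y"
        using AE_in_measure_support[OF \<nu>(1)] \<tau> that
        by (auto elim!: eventually_mono simp: poly_eval2_sum_of_squares)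
    qed
    then show ?thesis unfolding f poly_eval_sum poly_eval_integral_y[OF \<nu>(2)] by (intro sum_nonneg) (simp del: poly_eval2_mult)
  qed
  then have "0 \<le> (\<integral>x. poly_eval f (($) x) \<partial>\<mu>)"
    using AE_in_measure_support[OF \<mu>(1)] \<mu>(2) by (intro integral_nonneg_AE) (auto elim!: eventually_mono)
  then show ?thesis by (simp add: riesz_eq_integral[OF mom])
qed

text \<open>
  Without mass the quadratic module would be \<open>{0}\<close>, but \<open>N - \<Sum>\<^sub>i x\<^sub>i\<^sup>2\<close> has the value \<open>N > 0\<close> at the origin.
\<close>

lemma archimedean_mass_pos:
  fixes g :: "nat \<Rightarrow> ('n::finite + 'm::finite) rpoly"
  assumes "finite_measure \<nu>" "archimedean (quadratic_module s g \<nu>)"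
  shows "0 < measure \<nu> (space \<nu>)"
proof (rule ccontr)
  interpret finite_measure \<nu> by fact
  assume "\<not> 0 < measure \<nu> (space \<nu>)"
  then have "measure \<nu> (space \<nu>) = 0" using measure_nonneg[of \<nu> "space \<nu>"] by linarith
  then have "space \<nu> \<in> null_sets \<nu>" by (simp add: null_sets_def emeasure_eq_measure)
  then have "AE y in \<nu>. False" by (intro AE_I'[of "space \<nu>"]) auto
  then have "(\<integral>y. h y \<partial>\<nu>) = 0" for h :: "real^'m \<Rightarrow> real" by (intro integral_eq_zero_AE) (auto elim: eventually_mono)
  then have "integral_y \<nu> p = 0" for p :: "('n + 'm) rpoly" by (simp add: integral_y_def)
  moreover obtain N :: int where N: "0 < N" "of_int N - (\<Sum>i\<in>UNIV. (pvar i)\<^sup>2) \<in> quadratic_module s g \<nu>"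
    using assms(2) unfolding archimedean_def by blast
  ultimately have "of_int N - (\<Sum>i\<in>UNIV. (pvar i :: 'n rpoly)\<^sup>2) = 0"
    by (auto simp: quadratic_module_def)
  then have "poly_eval (of_int N - (\<Sum>i\<in>UNIV. (pvar i :: 'n rpoly)\<^sup>2)) (\<lambda>_. 0) = 0" by simp
  moreover have "poly_eval (of_int N :: 'n rpoly) (\<lambda>_. 0) = of_int N"
    using poly_eval_const[of "of_int N"] by (simp del: poly_eval_const)
  ultimately show False using N(1) by simp
qed

text \<open>
  For \<open>p \<in> \<real>[x]\<close> the quadratic module contains \<open>\<integral> p\<^sup>2 d\<nu> = \<nu>(\<real>\<^sup>m) p\<^sup>2\<close>, and dividing by the mass of \<open>\<nu>\<close>
  shows that the Riesz functional is nonnegative on squares.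
\<close>

lemma ball_positive_functional_riesz:
  fixes g :: "nat \<Rightarrow> ('n::finite + 'm::finite) rpoly"
  assumes g0: "g 0 = 1" and fin: "finite_measure \<nu>" and arch: "archimedean (quadratic_module s g \<nu>)"
    and pos: "\<And>f. f \<in> quadratic_module s g \<nu> \<Longrightarrow> 0 \<le> riesz z f"
  shows "\<exists>N. ball_positive_functional (riesz z) N"
proof -
  interpret finite_measure \<nu> by fact
  obtain N :: int where N: "0 < N" "of_int N - (\<Sum>i\<in>UNIV. (pvar i)\<^sup>2) \<in> quadratic_module s g \<nu>"
    using arch unfolding archimedean_def by blast
  have "ball_positive_functional (riesz z) (of_int N)"
  proof
    fix p :: "'n rpoly"
    obtain p' :: "('n + 'm) rpoly" where p': "\<And>h. integral_y \<nu> (p' * h) = p * integral_y \<nu> h"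
      using ex_polynomial_in_x[of p] by metis
    define c where "c = measure \<nu> (space \<nu>)"
    have c: "0 < c" unfolding c_def by (rule archimedean_mass_pos[OF fin arch])
    have "integral_y \<nu> (1 :: ('n + 'm) rpoly) = const_poly c"
    proof -
      have "Poly_Mapping.map_key Inl 0 = (0 :: 'n exponent)" "Poly_Mapping.map_key Inr 0 = (0 :: 'm exponent)"
        by simp_all
      then show ?thesis
        using integral_y_single[of \<nu> "0 :: ('n + 'm) exponent" 1] by (simp add: monom_eval_def c_def)
    qed
    then have "integral_y \<nu> (p'\<^sup>2 * g 0) = const_poly c * p\<^sup>2"
      using p'[of "p' * 1"] p'[of 1] by (simp add: g0 power2_eq_square mult_ac)
    with pos[OF quadratic_module_generator[of 0 s \<nu> p' g]] have "0 \<le> c * riesz z (p\<^sup>2)"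
      by (simp add: riesz_const_mult)
    with c show "0 \<le> riesz z (p\<^sup>2)" by (simp add: zero_le_mult_iff)
    show "0 \<le> riesz z ((const_poly (of_int N) - (\<Sum>i\<in>UNIV. (pvar i)\<^sup>2)) * p\<^sup>2)"
      using pos[OF quadratic_module_mult_power2[OF N(2), of p]] by (simp add: mult.commute)
  qed (use N(1) in \<open>simp_all add: riesz_add riesz_const_mult\<close>)
  then show ?thesis ..
qed

text \<open>
  The representing measure \<open>\<mu>\<close> is supported in \<open>K\<close> by two applications of \<open>nonneg_on_support\<close>: to \<open>\<nu>\<close> and
  the averages \<open>\<integral> p\<^sup>2 g\<^sub>j(\<cdot>,y) d\<mu>\<close>, which makes these averages nonnegative for \<open>y \<in> Q\<close>, and then to \<open>\<mu>\<close> and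
  \<open>g\<^sub>j(\<cdot>,y)\<close>.
\<close>

lemma moment_sequence_of_riesz_nonneg:
  fixes g :: "nat \<Rightarrow> ('n::finite + 'm::finite) rpoly"
  assumes g0: "g 0 = 1" and K: "K = {x. \<forall>y\<in>measure_support \<nu>. \<forall>j\<in>{1..s}. 0 \<le> poly_eval2 (g j) x y}"
    and \<nu>: "sets \<nu> = sets borel" "finite_measure \<nu>" "finite_moments \<nu>" "carleman \<nu>"
    and arch: "archimedean (quadratic_module s g \<nu>)"
    and pos: "\<And>f. f \<in> quadratic_module s g \<nu> \<Longrightarrow> 0 \<le> riesz z f"
  shows "moment_sequence K z"
proof -
  obtain N where "ball_positive_functional (riesz z) N"
    using ball_positive_functional_riesz[OF g0 \<nu>(2) arch pos] by blast
  then interpret L: ball_positive_functional "riesz z" N .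
  obtain \<mu> :: "(real^'n) measure" where fin: "finite_measure \<mu>" and \<mu>: "sets \<mu> = sets borel"
    and box: "AE x in \<mu>. x \<in> cbox (\<chi> i. - L.radius) (\<chi> i. L.radius)"
    and L: "\<And>p. riesz z p = (\<integral>x. poly_eval p (($) x) \<partial>\<mu>)"
    using L.representing_measure by blast
  interpret \<mu>: finite_measure \<mu> by fact
  have "finite_moments \<mu>"
    unfolding finite_moments_def
  proof
    fix \<alpha>
    have cont: "continuous_on S (\<lambda>x :: real^'n. monom_eval \<alpha> (($) x))" for S
      using continuous_on_poly_eval[of S "Poly_Mapping.single \<alpha> 1"] by (simp add: poly_eval_riesz)
    obtain B where B: "\<And>x :: real^'n. x \<in> cbox (\<chi> i. - L.radius) (\<chi> i. L.radius) \<Longrightarrow> norm (monom_eval \<alpha> (($) x)) \<le> B"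
      using compact_imp_bounded[OF compact_continuous_image[OF cont compact_cbox]]
      unfolding bounded_iff by blast
    show "integrable \<mu> (\<lambda>x. monom_eval \<alpha> (($) x))"
    proof (rule \<mu>.integrable_const_bound)
      show "AE x in \<mu>. norm (monom_eval \<alpha> (($) x)) \<le> B" using box by eventually_elim (rule B)
      show "(\<lambda>x. monom_eval \<alpha> (($) x)) \<in> borel_measurable \<mu>"
        unfolding measurable_cong_sets[OF \<mu> refl] by (rule borel_measurable_continuous_onI[OF cont])
    qed
  qed
  note fm = this
  interpret \<mu>m: polynomial_moments \<mu>
    by (rule polynomial_moments_of_finite_moments[OF \<mu> fin fm])
  have carl_\<mu>: "carleman_condition \<mu> (\<lambda>x. x \<bullet> b)" if b_in: "b \<in> Basis" for b
  proof (rule \<mu>.carleman_condition_bounded)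
    obtain i where b: "b = axis i 1" using b_in by (auto simp: Basis_vec_def)
    show "AE x in \<mu>. \<bar>x \<bullet> b\<bar> \<le> L.radius"
      using box by eventually_elim (auto simp: b inner_axis mem_box_cart abs_le_iff minus_le_iff)
    show "(\<lambda>x. x \<bullet> b) \<in> borel_measurable \<mu>" by (simp add: measurable_cong_sets[OF \<mu> refl])
  qed
  interpret \<nu>m: polynomial_moments \<nu>
    by (rule polynomial_moments_of_finite_moments[OF \<nu>(1-3)])
  have carl_\<nu>: "carleman_condition \<nu> (\<lambda>y. y \<bullet> b)" if b_in: "b \<in> Basis" for b
  proof -
    obtain j where b: "b = axis j 1" using b_in by (auto simp: Basis_vec_def)
    show ?thesis using carleman_condition_coordinate[OF \<nu>(1,3,4), of j] by (simp add: b inner_axis)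
  qed
  have average: "0 \<le> (\<integral>x. (p x)\<^sup>2 * poly_eval2 (g j) x y \<partial>\<mu>)"
    if p: "real_polynomial_function p" and j: "j \<le> s" and y: "y \<in> measure_support \<nu>" for p j y
  proof -
    obtain P where P: "\<And>x. poly_eval P (($) x) = p x"
      using poly_eval_of_real_polynomial_function[OF p] by blast
    obtain P' :: "('n + 'm) rpoly" where P': "\<And>x y. poly_eval2 P' x y = p x"
      using ex_polynomial_in_x[of P] P by metis
    define G where "G y = (\<integral>x. poly_eval2 (P'\<^sup>2 * g j) x y \<partial>\<mu>)" for y
    have "real_polynomial_function G"
      unfolding G_def[abs_def] by (rule real_polynomial_function_integral_x[OF fm])
    then interpret carleman_weight \<nu> G
      by unfold_locales (assumption, rule carl_\<nu>)
    have "0 \<le> G y"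
    proof (rule nonneg_on_support[OF _ y])
      fix r :: "real^'m \<Rightarrow> real" assume r: "real_polynomial_function r"
      obtain P2 where P2: "\<And>y. poly_eval P2 (($) y) = r y"
        using poly_eval_of_real_polynomial_function[OF r] by blast
      obtain R' :: "('n + 'm) rpoly" where R': "\<And>x y. poly_eval2 R' x y = r y"
        using ex_polynomial_in_y[of P2] P2 by metis
      have "(\<integral>y. (r y)\<^sup>2 * G y \<partial>\<nu>) = (\<integral>y. \<integral>x. poly_eval2 ((R' * P')\<^sup>2 * g j) x y \<partial>\<mu> \<partial>\<nu>)"
        by (simp add: G_def R' P' power_mult_distrib mult.assoc)
      also have "\<dots> = riesz z (integral_y \<nu> ((R' * P')\<^sup>2 * g j))"
        unfolding L by (rule integral_poly_eval2_swap[OF fm \<nu>(3)])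
      also have "0 \<le> \<dots>" by (intro pos quadratic_module_generator j)
      finally show "0 \<le> (\<integral>y. (r y)\<^sup>2 * G y \<partial>\<nu>)" .
    qed
    then show ?thesis by (simp add: G_def P')
  qed
  have "measure_support \<mu> \<subseteq> K"
  proof
    fix a assume a: "a \<in> measure_support \<mu>"
    have "0 \<le> poly_eval2 (g j) a y" if y: "y \<in> measure_support \<nu>" and j: "j \<in> {1..s}" for y j
    proof -
      interpret carleman_weight \<mu> "\<lambda>x. poly_eval2 (g j) x y"
        by unfold_locales (rule real_polynomial_function_poly_eval2_x, rule carl_\<mu>)
      show ?thesis using average[OF _ _ y, of _ j] j by (intro nonneg_on_support[OF _ a]) auto
    qed
    then show "a \<in> K" by (simp add: K)
  qed
  moreover have "z \<alpha> = (\<integral>x. monom_eval \<alpha> (($) x) \<partial>\<mu>)" for \<alpha>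
    using L[of "Poly_Mapping.single \<alpha> 1"] by (simp add: poly_eval_riesz)
  moreover have "\<And>\<alpha>. integrable \<mu> (\<lambda>x. monom_eval \<alpha> (($) x))"
    using fm by (simp add: finite_moments_def)
  ultimately show ?thesis
    unfolding moment_sequence_def using \<mu> fin by blast
qed

theorem theorem4p1:
  fixes Q :: "(real^'m::finite) set"
    and s :: nat
    and g :: "nat \<Rightarrow> ('n::finite + 'm) rpoly"
    and K :: "(real^'n) set"
    and \<nu> :: "(real^'m) measure"
    and z :: "'n exponent \<Rightarrow> real"
  assumes "closed Q"
    and "g 0 = 1"
    and "K = {x. \<forall>y\<in>Q. \<forall>j\<in>{1..s}. poly_eval2 (g j) x y \<ge> 0}"
    and "sets \<nu> = sets borel"
    and "finite_measure \<nu>"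
    and "finite_moments \<nu>"
    and "measure_support \<nu> = Q"
    and "carleman \<nu>"
    and "archimedean (quadratic_module s g \<nu>)"
  shows "moment_sequence K z \<longleftrightarrow> (\<forall>f\<in>quadratic_module s g \<nu>. riesz z f \<ge> 0)"
proof -
  have K: "K = {x. \<forall>y\<in>measure_support \<nu>. \<forall>j\<in>{1..s}. 0 \<le> poly_eval2 (g j) x y}"
    using assms(3,7) by simp
  show ?thesis
    using riesz_nonneg_of_moment_sequence[OF assms(2) K assms(4,6)]
      moment_sequence_of_riesz_nonneg[OF assms(2) K assms(4-6,8,9)]
    by blast
qed

end
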